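(* Let $Y$ be a compact, connected, oriented 3-orbifold whose singular set $\Sigma Y$ is an oriented link $L_1\cup\dots\cup L_k$ and whose boundary is empty or a union of tori. Suppose $H_1^{orb}(Y)\cong H_1(|Y|)$. Then there is a canonical bijection $Eul(Y)\leftrightarrow Eul(|Y|)$ between the set of orbifold Euler structures on $Y$ and the set of Euler structures on the underlying 3-manifold $|Y|$.
   Context: **Orbifolds.** $Y$ is a 3-orbifold with underlying compact 3-manifold $|Y|$; its singular set is an oriented link $L_1\cup\dots\cup L_k$ in the interior of $|Y|$. Around each $L_i$ there is a neighborhood $N_i=(S^1\times D^2)/\mathbb{Z}_{\alpha_i}$ ($\alpha_i$ is the multiplicity of $L_i$), where $\mathbb{Z}_{\alpha_i}$ acts by rotations about the core and $L_i=S^1\times\mathbf 0$. Let $X$ be the complement in $|Y|$ of the interiors of the $N_i$, and $\mu_i$ the meridian of $L_i$, oriented to have linking number $1$ with $L_i$. $H_1^{orb}(Y)$ is the abelianization of the orbifold fundamental group, and $H_1^{orb}(Y)\cong H_1(X)/\langle\mu_1^{\alpha_1},\dots,\mu_k^{\alpha_k}\rangle$ (groups written multiplicatively). $\widehat Y$ denotes the orbifold cover of $Y$ with deck group $H_1^{orb}(Y)$: take the regular cover of $X$ with deck group $H_1^{orb}(Y)$ and fill in its boundary over each $\partial N_i$ canonically by orbifold covers of $N_i$. $|\widehat Y|$ is its underlying space, with projection $|\widehat Y|\to|Y|$. For a 3-manifold $M$, $\widehat M$ is the cover of $M$ with deck group $H_1(M)$. **Cells.** Identifying $D^2/\mathbb{Z}_{\alpha_i}$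 with a disk, each $N_i$ gets the cell decomposition with the following open cells: on the boundary torus, the 0-cell $(1,1)$, the two 1-cells $(S^1-\mathbf 1)\times\mathbf 1$ and $\mathbf 1\times(\partial D^2-\mathbf 1)$, and one 2-cell; in the interior, the 0-cell $(1,0)$, the 1-cells $\mathbf 1\times int([0,1])$ and $(S^1-\mathbf 1)\times\mathbf 0$, the 2-cells $(S^1-\mathbf 1)\times int([0,1])$ and $\mathbf 1\times int(D^2)$, and the 3-cell $(S^1-\mathbf 1)\times int(D^2)$. In particular $L_i$ consists of one 0-cell $e_i^0=(1,0)$ and one 1-cell $e_i^1=(S^1-\mathbf 1)\times\mathbf 0$. These are extended to a cell decomposition of $|Y|$; the cells not in $\Sigma Y$ are denoted $\{e_j\}_{j\in J}$. The cell decomposition lifts to $|\widehat Y|$, and $H_1^{orb}(Y)$ acts on the cells of $|\widehat Y|$. **Orbifold Euler structures.** Let $h_i\in H_1^{orb}(Y)$ be the class of $L_i$ (the class of the parallel copy of $L_i$ in $\partial N_i$; it is determined up to powers of $\mu_i$, which act trivially on the cells over $L_i$). Consider lifts $\hat e=\{\hat e_j\}_{j\in J}\cup\bigcup_i\{\hat e_i^0,\hat e_i^1\}$ (one cell of $|\widehat Y|$ over each cell of $|Y|$) such that for every $i$, $\partial\hat e_i^1=\pm(h_i-1)\hat e_i^0$, i.e. the endpoints of $\hat e^1_i$ are $\hat e_i^0$ and $h_i\hat e_i^0$. For two such lifts put $\hat f/\hat e=\prod_{j\in J}(\hat f_j/\hat e_j)^{(-1)^{\dim e_j}}\in H_1^{orb}(Y)$,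 where $\hat f_j/\hat e_j$ is the unique element of $H_1^{orb}(Y)$ taking $\hat e_j$ to $\hat f_j$ (cells in $\Sigma Y$ are omitted from the product). Set $\hat e\sim\hat f$ if $\hat f/\hat e=1$. $Eul(Y)$ is the set of equivalence classes. **Euler structures on a manifold.** For a compact, connected, orientable 3-manifold $M$ with a cell structure, $Eul(M)$ is the set of all lifts of the cells $\{e_i\}_{i\in I}$ of $M$ to $\widehat M$, modulo $\{\hat e_i\}\sim\{\hat f_i\}$ if and only if $\prod_{i\in I}(\hat f_i/\hat e_i)^{(-1)^{\dim e_i}}=1$ in $H_1(M)$ (product over all cells). For $|Y|$ the cell structure used is the cell decomposition $\{e_j\}_{j\in J}\cup\bigcup_i\{e_i^0,e_i^1\}$ of $|Y|$ extending the cell decompositions of the neighborhoods $N_i$. **Meaning of "canonical".** When $H_1^{orb}(Y)\cong H_1(|Y|)$, $|\widehat Y|$ is identified with $\widehat{|Y|}$; the canonical map $Eul(Y)\to Eul(|Y|)$ sends the class of a lift $\{\hat e_j\}_{j\in J}\cup\bigcup_i\{\hat e_i^0,\hat e_i^1\}$ satisfying the boundary condition $\partial\hat e_i^1=\pm(h_i-1)\hat e_i^0$ for every $i$ over the singular curves $L_i$ to the class of the same lift regarded as a lift to $\widehat{|Y|}$. *)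

theory Defs
  imports "HOL-Analysis.Analysis" "HOL-Homology.Homology"
begin

section \<open>Topological manifolds with boundary\<close>

definition half_space :: "nat \<Rightarrow> (nat \<Rightarrow> real) topology" where
  "half_space n = subtopology (Euclidean_space n) {x. 0 \<le> x 0}"

definition manifold_with_boundary :: "nat \<Rightarrow> 'a topology \<Rightarrow> bool" where
  "manifold_with_boundary n M \<longleftrightarrow>
     Hausdorff_space M \<and> second_countable M \<and>
     (\<forall>x\<in>topspace M. \<exists>U V. openin M U \<and> x \<in> U \<and> openin (half_space n) V \<and>
        subtopology M U homeomorphic_space subtopology (half_space n) V)"

definition manifold_interior :: "nat \<Rightarrow> 'a topology \<Rightarrow> 'a set" where
  "manifold_interior n M =
     {x \<in> topspace M. \<exists>U V. openin M U \<and> x \<in> U \<and> openin (Euclidean_space n) V \<and>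
        subtopology M U homeomorphic_space subtopology (Euclidean_space n) V}"

definition manifold_boundary :: "nat \<Rightarrow> 'a topology \<Rightarrow> 'a set" where
  "manifold_boundary n M = topspace M - manifold_interior n M"

text \<open>An orientation is a locally consistent choice of generators of the local homology groups
  \<open>H\<^sub>n(M, M - x)\<close> at the interior points.\<close>

definition manifold_orientation :: "nat \<Rightarrow> 'a topology \<Rightarrow> ('a \<Rightarrow> 'a chain set) \<Rightarrow> bool" where
  "manifold_orientation n M \<omega> \<longleftrightarrow>
     (\<forall>x\<in>manifold_interior n M.
        \<omega> x \<in> carrier (relative_homology_group (int n) M (topspace M - {x})) \<and>
        generate (relative_homology_group (int n) M (topspace M - {x})) {\<omega> x}
          = carrier (relative_homology_group (int n) M (topspace M - {x}))) \<and>
     (\<forall>x\<in>manifold_interior n M. \<exists>U. openin M U \<and> x \<in> U \<and> U \<subseteq> manifold_interior n M \<and>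
        (\<exists>c\<in>carrier (relative_homology_group (int n) M (topspace M - U)). \<forall>y\<in>U.
           hom_induced (int n) M (topspace M - U) M (topspace M - {y}) id c = \<omega> y))"

abbreviation circle :: "complex set" where "circle \<equiv> sphere 0 1"
abbreviation disc :: "complex set" where "disc \<equiv> cball 0 1"
abbreviation open_disc :: "complex set" where "open_disc \<equiv> ball 0 1"

definition toral_boundary :: "'a topology \<Rightarrow> bool" where
  "toral_boundary M \<longleftrightarrow>
     (\<forall>C\<in>connected_components_of (subtopology M (manifold_boundary 3 M)).
        subtopology M C homeomorphic_space top_of_set (circle \<times> circle))"


section \<open>Orbifolds whose singular set is a link\<close>

text \<open>
  The orbifold is given by its underlying space, an orientation, the number of singular curves,
  their multiplicities \<open>\<alpha>\<^sub>i\<close> and neighbourhoods \<open>N\<^sub>i = (S\<^sup>1 \<times> D\<^sup>2) / \<int>\<^bsub>\<alpha>\<^sub>i\<^esub>\<close>.  The quotient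
  \<open>D\<^sup>2 / \<int>\<^bsub>\<alpha>\<^esub>\<close> is identified with the disc \<open>D\<^sup>2\<close> through \<open>w \<mapsto> w\<^sup>\<alpha>\<close>; \<open>nbhd Y i\<close> is the resulting
  parametrisation \<open>S\<^sup>1 \<times> D\<^sup>2 \<rightarrow> N\<^sub>i\<close> (a homeomorphism), and the orbifold chart itself, i.e. the quotient
  map \<open>S\<^sup>1 \<times> D\<^sup>2 \<rightarrow> N\<^sub>i\<close>, is \<open>orb_chart Y i\<close>.
  The curve \<open>L\<^sub>i\<close> is oriented by the standard orientation of \<open>S\<^sup>1\<close>.
\<close>

record 'a orbifold3 =
  under :: "'a topology"
  orient :: "'a \<Rightarrow> 'a chain set"
  ncomp :: nat
  mult :: "nat \<Rightarrow> nat"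
  nbhd :: "nat \<Rightarrow> complex \<times> complex \<Rightarrow> 'a"

abbreviation comps :: "'a orbifold3 \<Rightarrow> nat set" where
  "comps Y \<equiv> {1..ncomp Y}"

definition orb_chart :: "'a orbifold3 \<Rightarrow> nat \<Rightarrow> complex \<times> complex \<Rightarrow> 'a" where
  "orb_chart Y i = (\<lambda>(z, w). nbhd Y i (z, w ^ mult Y i))"

definition sing_curve :: "'a orbifold3 \<Rightarrow> nat \<Rightarrow> 'a set" where
  "sing_curve Y i = nbhd Y i ` (circle \<times> {0})"

definition sing_set :: "'a orbifold3 \<Rightarrow> 'a set" where
  "sing_set Y = (\<Union>i\<in>comps Y. sing_curve Y i)"

definition link_orbifold3 :: "'a orbifold3 \<Rightarrow> bool" where
  "link_orbifold3 Y \<longleftrightarrow>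
     topspace (under Y) \<noteq> {} \<and>
     manifold_with_boundary 3 (under Y) \<and>
     manifold_orientation 3 (under Y) (orient Y) \<and>
     (\<forall>i\<in>comps Y.
        mult Y i \<ge> 2 \<and>
        embedding_map (top_of_set (circle \<times> disc)) (under Y) (nbhd Y i) \<and>
        nbhd Y i ` (circle \<times> disc) \<subseteq> manifold_interior 3 (under Y) \<and>
        openin (under Y) (nbhd Y i ` (circle \<times> open_disc))) \<and>
     disjoint_family_on (\<lambda>i. nbhd Y i ` (circle \<times> disc)) (comps Y)"

definition exterior :: "'a orbifold3 \<Rightarrow> 'a set" where
  "exterior Y = topspace (under Y) - (\<Union>i\<in>comps Y. nbhd Y i ` (circle \<times> open_disc))"

abbreviation exterior_space :: "'a orbifold3 \<Rightarrow> 'a topology" where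
  "exterior_space Y \<equiv> subtopology (under Y) (exterior Y)"


section \<open>First homology\<close>

text \<open>The class in \<open>H\<^sub>1(M)\<close> of a loop parametrised by \<open>[0,1]\<close>: the loop is regarded as a singular
  1-simplex through the barycentric coordinate \<open>x 1\<close> of the standard simplex.\<close>

definition loop_class :: "'a topology \<Rightarrow> (real \<Rightarrow> 'a) \<Rightarrow> 'a chain set" where
  "loop_class M \<gamma> =
     homologous_rel_set 1 M {} (frag_of (restrict (\<lambda>x. \<gamma> (x 1)) (standard_simplex 1)))"

text \<open>The orientation of the meridian does not affect the subgroup below, so that no compatibility
  between \<open>nbhd Y i\<close> and \<open>orient Y\<close> is needed.\<close>

definition meridian :: "'a orbifold3 \<Rightarrow> nat \<Rightarrow> real \<Rightarrow> 'a" where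
  "meridian Y i t = nbhd Y i (1, cis (2 * pi * t))"

definition parallel :: "'a orbifold3 \<Rightarrow> nat \<Rightarrow> real \<Rightarrow> 'a" where
  "parallel Y i t = nbhd Y i (cis (2 * pi * t), 1)"

definition meridian_subgroup :: "'a orbifold3 \<Rightarrow> 'a chain set set" where
  "meridian_subgroup Y =
     generate (homology_group 1 (exterior_space Y))
       ((\<lambda>i. loop_class (exterior_space Y) (meridian Y i)
               [^]\<^bsub>homology_group 1 (exterior_space Y)\<^esub> mult Y i) ` comps Y)"

definition H1_orb :: "'a orbifold3 \<Rightarrow> 'a chain set set monoid" where
  "H1_orb Y = homology_group 1 (exterior_space Y) Mod meridian_subgroup Y"

definition orb_loop_class :: "'a orbifold3 \<Rightarrow> (real \<Rightarrow> 'a) \<Rightarrow> 'a chain set set" where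
  "orb_loop_class Y \<gamma> =
     meridian_subgroup Y #>\<^bsub>homology_group 1 (exterior_space Y)\<^esub>
       loop_class (exterior_space Y) \<gamma>"

text \<open>The homomorphism \<open>H\<^sub>1\<^sup>o\<^sup>r\<^sup>b(Y) \<rightarrow> H\<^sub>1(|Y|)\<close> induced by the inclusion of the exterior.\<close>

definition H1_orb_to_H1 :: "'a orbifold3 \<Rightarrow> 'a chain set set \<Rightarrow> 'a chain set" where
  "H1_orb_to_H1 Y C =
     the_elem (hom_induced 1 (exterior_space Y) {} (under Y) {} id ` C)"


section \<open>Covers\<close>

definition covering :: "'b topology \<Rightarrow> 'a topology \<Rightarrow> ('b \<Rightarrow> 'a) \<Rightarrow> bool" where
  "covering P M p \<longleftrightarrow>
     continuous_map P M p \<and> p ` topspace P = topspace M \<and>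
     (\<forall>y\<in>topspace M. \<exists>U \<V>. openin M U \<and> y \<in> U \<and>
        \<Union>\<V> = {x \<in> topspace P. p x \<in> U} \<and> disjoint \<V> \<and>
        (\<forall>V\<in>\<V>. openin P V \<and> homeomorphic_map (subtopology P V) (subtopology M U) p))"

definition deck_action ::
  "('g, 'm) monoid_scheme \<Rightarrow> 'b topology \<Rightarrow> ('b \<Rightarrow> 'a) \<Rightarrow> ('g \<Rightarrow> 'b \<Rightarrow> 'b) \<Rightarrow> bool" where
  "deck_action G P p act \<longleftrightarrow>
     (\<forall>g\<in>carrier G. homeomorphic_map P P (act g) \<and> (\<forall>x\<in>topspace P. p (act g x) = p x)) \<and>
     (\<forall>x\<in>topspace P. act \<one>\<^bsub>G\<^esub> x = x) \<and>
     (\<forall>g\<in>carrier G. \<forall>h\<in>carrier G. \<forall>x\<in>topspace P. act (g \<otimes>\<^bsub>G\<^esub> h) x = act g (act h x))"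

text \<open>The connected regular cover of \<open>M\<close> with (abelian) deck group \<open>G\<close> belonging to the
  homomorphism from the fundamental group of \<open>M\<close> to \<open>G\<close> that sends a loop \<open>\<gamma>\<close> to \<open>cls \<gamma>\<close>: the last
  conjunct says that the deck transformation \<open>g\<close> moves the initial point of a lift of \<open>\<gamma>\<close> to its
  terminal point exactly for \<open>g = cls \<gamma>\<close>.  This determines the cover and the action up to
  equivariant homeomorphism over \<open>M\<close>.\<close>

definition regular_cover ::
  "('g, 'm) monoid_scheme \<Rightarrow> ((real \<Rightarrow> 'a) \<Rightarrow> 'g) \<Rightarrow> 'a topology \<Rightarrow>
   'b topology \<Rightarrow> ('b \<Rightarrow> 'a) \<Rightarrow> ('g \<Rightarrow> 'b \<Rightarrow> 'b) \<Rightarrow> bool" where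
  "regular_cover G cls M P p act \<longleftrightarrow>
     path_connected_space P \<and> covering P M p \<and> deck_action G P p act \<and>
     (\<forall>x\<in>topspace P. \<forall>y\<in>topspace P. p x = p y \<longrightarrow> (\<exists>!g. g \<in> carrier G \<and> act g x = y)) \<and>
     (\<forall>\<gamma>. \<forall>g\<in>carrier G. pathin P \<gamma> \<and> \<gamma> 1 = act g (\<gamma> 0) \<longrightarrow> cls (p \<circ> \<gamma>) = g)"

definition H1_cover ::
  "'a topology \<Rightarrow> 'b topology \<Rightarrow> ('b \<Rightarrow> 'a) \<Rightarrow> ('a chain set \<Rightarrow> 'b \<Rightarrow> 'b) \<Rightarrow> bool" where
  "H1_cover M P p act \<longleftrightarrow> regular_cover (homology_group 1 M) (loop_class M) M P p act"

text \<open>\<open>p\<close> is (on underlying spaces) an orbifold cover of \<open>N\<^sub>i\<close>: every point of \<open>L\<^sub>i\<close> has a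
  neighbourhood \<open>(A \<times> D\<^sup>2) / \<int>\<^bsub>\<alpha>\<^esub>\<close> whose inverse image is a disjoint union of open sets
  \<open>(A \<times> D\<^sup>2) / \<Gamma>\<close>, where \<open>\<Gamma>\<close> is a subgroup of \<open>\<int>\<^bsub>\<alpha>\<^esub>\<close> (the roots of unity of order \<open>\<alpha>\<close>), each
  projecting in the obvious way.\<close>

definition orbifold_covering_nbhd ::
  "'a orbifold3 \<Rightarrow> nat \<Rightarrow> 'b topology \<Rightarrow> ('b \<Rightarrow> 'a) \<Rightarrow> bool" where
  "orbifold_covering_nbhd Y i P p \<longleftrightarrow>
     (\<forall>a\<in>circle. \<exists>A \<V>. openin (top_of_set circle) A \<and> connected A \<and> a \<in> A \<and>
        \<Union>\<V> = {x \<in> topspace P. p x \<in> nbhd Y i ` (A \<times> disc)} \<and> disjoint \<V> \<and>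
        (\<forall>V\<in>\<V>. openin (subtopology P (\<Union>\<V>)) V \<and>
          (\<exists>\<Gamma> c. \<Gamma> \<subseteq> {\<zeta>. \<zeta> ^ mult Y i = 1} \<and> 1 \<in> \<Gamma> \<and> (\<forall>\<zeta>\<in>\<Gamma>. \<forall>\<xi>\<in>\<Gamma>. \<zeta> * \<xi> \<in> \<Gamma>) \<and>
             quotient_map (top_of_set (A \<times> disc)) (subtopology P V) c \<and>
             (\<forall>z\<in>A. \<forall>z'\<in>A. \<forall>w\<in>disc. \<forall>w'\<in>disc.
                c (z, w) = c (z', w') \<longleftrightarrow> z = z' \<and> (\<exists>\<zeta>\<in>\<Gamma>. w' = \<zeta> * w)) \<and>
             (\<forall>z\<in>A. \<forall>w\<in>disc. p (c (z, w)) = orb_chart Y i (z, w)))))"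

text \<open>The underlying space \<open>P\<close> of the orbifold cover with deck group \<open>H\<^sub>1\<^sup>o\<^sup>r\<^sup>b(Y)\<close>.\<close>

definition H1_orb_cover ::
  "'a orbifold3 \<Rightarrow> 'b topology \<Rightarrow> ('b \<Rightarrow> 'a) \<Rightarrow> ('a chain set set \<Rightarrow> 'b \<Rightarrow> 'b) \<Rightarrow> bool" where
  "H1_orb_cover Y P p act \<longleftrightarrow>
     continuous_map P (under Y) p \<and>
     deck_action (H1_orb Y) P p act \<and>
     regular_cover (H1_orb Y) (orb_loop_class Y) (exterior_space Y)
       (subtopology P {x. p x \<in> exterior Y}) p act \<and>
     (\<forall>i\<in>comps Y. orbifold_covering_nbhd Y i P p)"

text \<open>Identification of the orbifold cover \<open>P\<close> with the cover \<open>Q\<close> of the underlying manifold, the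
  deck groups being identified through the canonical homomorphism.\<close>

definition cover_identification ::
  "'a orbifold3 \<Rightarrow> 'b topology \<Rightarrow> ('b \<Rightarrow> 'a) \<Rightarrow> ('a chain set set \<Rightarrow> 'b \<Rightarrow> 'b) \<Rightarrow>
   'c topology \<Rightarrow> ('c \<Rightarrow> 'a) \<Rightarrow> ('a chain set \<Rightarrow> 'c \<Rightarrow> 'c) \<Rightarrow> ('b \<Rightarrow> 'c) \<Rightarrow> bool" where
  "cover_identification Y P p act Q q act' F \<longleftrightarrow>
     H1_orb_to_H1 Y \<in> iso (H1_orb Y) (homology_group 1 (under Y)) \<and>
     homeomorphic_map P Q F \<and>
     (\<forall>x\<in>topspace P. q (F x) = p x) \<and>
     (\<forall>g\<in>carrier (H1_orb Y). \<forall>x\<in>topspace P. F (act g x) = act' (H1_orb_to_H1 Y g) (F x))"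


section \<open>Cell decompositions\<close>

text \<open>A cell decomposition of a compact space is given by the finite set of its open cells and the
  dimension of each of them.\<close>

definition closed_cell :: "nat \<Rightarrow> (nat \<Rightarrow> real) topology" where
  "closed_cell n = subtopology (Euclidean_space n) {x. (\<Sum>j<n. (x j)\<^sup>2) \<le> 1}"

definition cell_decomposition :: "'a topology \<Rightarrow> 'a set set \<Rightarrow> ('a set \<Rightarrow> nat) \<Rightarrow> bool" where
  "cell_decomposition M \<C> d \<longleftrightarrow>
     finite \<C> \<and> disjoint \<C> \<and> \<Union>\<C> = topspace M \<and>
     (\<forall>e\<in>\<C>. \<exists>\<Phi>. continuous_map (closed_cell (d e)) M \<Phi> \<and>
        homeomorphic_map (subtopology (closed_cell (d e)) {x. (\<Sum>j<d e. (x j)\<^sup>2) < 1})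
          (subtopology M e) \<Phi> \<and>
        \<Phi> ` {x \<in> topspace (closed_cell (d e)). (\<Sum>j<d e. (x j)\<^sup>2) = 1} \<subseteq> \<Union>{c \<in> \<C>. d c < d e})"

text \<open>The open cells of \<open>S\<^sup>1 \<times> D\<^sup>2\<close> with their dimensions.  The open disc is cut along the radius
  \<open>[0,1)\<close>, whose points belong to lower-dimensional cells.\<close>

definition torus_cells :: "((complex \<times> complex) set \<times> nat) set" where
  "torus_cells =
    (let S = circle - {1}; I = of_real ` {0<..<1::real}; D = open_disc - of_real ` {0..<1::real} in
      {({1} \<times> {1}, 0), (S \<times> {1}, 1), ({1} \<times> S, 1), (S \<times> S, 2),
       ({1} \<times> {0}, 0), ({1} \<times> I, 1), (S \<times> {0}, 1), (S \<times> I, 2), ({1} \<times> D, 2), (S \<times> D, 3)})"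

definition sing_cell0 :: "'a orbifold3 \<Rightarrow> nat \<Rightarrow> 'a set" where
  "sing_cell0 Y i = nbhd Y i ` ({1} \<times> {0})"

definition sing_cell1 :: "'a orbifold3 \<Rightarrow> nat \<Rightarrow> 'a set" where
  "sing_cell1 Y i = nbhd Y i ` ((circle - {1}) \<times> {0})"

definition orbifold_cell_decomposition ::
  "'a orbifold3 \<Rightarrow> 'a set set \<Rightarrow> ('a set \<Rightarrow> nat) \<Rightarrow> bool" where
  "orbifold_cell_decomposition Y \<C> d \<longleftrightarrow>
     cell_decomposition (under Y) \<C> d \<and>
     (\<forall>i\<in>comps Y. \<forall>(c, n)\<in>torus_cells. nbhd Y i ` c \<in> \<C> \<and> d (nbhd Y i ` c) = n)"


section \<open>Euler structures\<close>

text \<open>The cells of \<open>P\<close> over an open cell \<open>e\<close> are the components of its inverse image.  A lift of a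
  cell decomposition is a function assigning to each cell a cell over it.\<close>

definition cells_over :: "'b topology \<Rightarrow> ('b \<Rightarrow> 'a) \<Rightarrow> 'a set \<Rightarrow> 'b set set" where
  "cells_over P p e = connected_components_of (subtopology P {x. p x \<in> e})"

definition cell_lifts :: "'b topology \<Rightarrow> ('b \<Rightarrow> 'a) \<Rightarrow> 'a set set \<Rightarrow> ('a set \<Rightarrow> 'b set) set" where
  "cell_lifts P p \<C> = (\<Pi>\<^sub>E e\<in>\<C>. cells_over P p e)"

text \<open>The boundary condition at \<open>L\<^sub>i\<close>: with \<open>h\<^sub>i\<close> the class of the parallel of \<open>L\<^sub>i\<close>, traversing
  the lifted 1-cell in the direction of \<open>L\<^sub>i\<close> leads from the lifted 0-cell \<open>x\<close> to \<open>h\<^sub>i x\<close>.  (The sign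
  in \<open>\<partial>e = \<plusminus>(h\<^sub>i - 1) x\<close> expresses whether \<open>e\<close> is given the orientation of \<open>L\<^sub>i\<close> or the opposite one.)\<close>

definition boundary_condition ::
  "'a orbifold3 \<Rightarrow> 'b topology \<Rightarrow> ('b \<Rightarrow> 'a) \<Rightarrow> ('a chain set set \<Rightarrow> 'b \<Rightarrow> 'b) \<Rightarrow> nat \<Rightarrow>
   ('a set \<Rightarrow> 'b set) \<Rightarrow> bool" where
  "boundary_condition Y P p act i e \<longleftrightarrow>
     (\<exists>\<gamma>. pathin P \<gamma> \<and> (\<forall>t\<in>{0..1}. p (\<gamma> t) = nbhd Y i (cis (2 * pi * t), 0)) \<and>
        e (sing_cell1 Y i) = \<gamma> ` {0<..<1} \<and>
        e (sing_cell0 Y i) = {\<gamma> 0} \<and>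
        act (orb_loop_class Y (parallel Y i)) ` e (sing_cell0 Y i) = {\<gamma> 1})"

definition orb_cell_lifts ::
  "'a orbifold3 \<Rightarrow> 'b topology \<Rightarrow> ('b \<Rightarrow> 'a) \<Rightarrow> ('a chain set set \<Rightarrow> 'b \<Rightarrow> 'b) \<Rightarrow> 'a set set \<Rightarrow>
   ('a set \<Rightarrow> 'b set) set" where
  "orb_cell_lifts Y P p act \<C> =
     {e \<in> cell_lifts P p \<C>. \<forall>i\<in>comps Y. boundary_condition Y P p act i e}"

text \<open>\<open>lift_quotient G act \<C> d f e\<close> is \<open>f/e\<close>, the product being taken over the cells in \<open>\<C>\<close>.\<close>

definition lift_quotient ::
  "('g, 'm) monoid_scheme \<Rightarrow> ('g \<Rightarrow> 'b \<Rightarrow> 'b) \<Rightarrow> 'a set set \<Rightarrow> ('a set \<Rightarrow> nat) \<Rightarrow>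
   ('a set \<Rightarrow> 'b set) \<Rightarrow> ('a set \<Rightarrow> 'b set) \<Rightarrow> 'g" where
  "lift_quotient G act \<C> d f e =
     finprod G (\<lambda>c. (THE g. g \<in> carrier G \<and> act g ` e c = f c) [^]\<^bsub>G\<^esub> ((-1) ^ d c :: int)) \<C>"

definition lift_equiv ::
  "('g, 'm) monoid_scheme \<Rightarrow> ('g \<Rightarrow> 'b \<Rightarrow> 'b) \<Rightarrow> 'a set set \<Rightarrow> ('a set \<Rightarrow> nat) \<Rightarrow>
   ('a set \<Rightarrow> 'b set) set \<Rightarrow> (('a set \<Rightarrow> 'b set) \<times> ('a set \<Rightarrow> 'b set)) set" where
  "lift_equiv G act \<C> d E =
     {(e, f). e \<in> E \<and> f \<in> E \<and> lift_quotient G act \<C> d f e = \<one>\<^bsub>G\<^esub>}"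

definition orb_lift_equiv ::
  "'a orbifold3 \<Rightarrow> 'b topology \<Rightarrow> ('b \<Rightarrow> 'a) \<Rightarrow> ('a chain set set \<Rightarrow> 'b \<Rightarrow> 'b) \<Rightarrow> 'a set set \<Rightarrow>
   ('a set \<Rightarrow> nat) \<Rightarrow> (('a set \<Rightarrow> 'b set) \<times> ('a set \<Rightarrow> 'b set)) set" where
  "orb_lift_equiv Y P p act \<C> d =
     lift_equiv (H1_orb Y) act {c \<in> \<C>. c \<inter> sing_set Y = {}} d (orb_cell_lifts Y P p act \<C>)"

definition Eul_orb ::
  "'a orbifold3 \<Rightarrow> 'b topology \<Rightarrow> ('b \<Rightarrow> 'a) \<Rightarrow> ('a chain set set \<Rightarrow> 'b \<Rightarrow> 'b) \<Rightarrow> 'a set set \<Rightarrow>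
   ('a set \<Rightarrow> nat) \<Rightarrow> ('a set \<Rightarrow> 'b set) set set" where
  "Eul_orb Y P p act \<C> d = orb_cell_lifts Y P p act \<C> // orb_lift_equiv Y P p act \<C> d"

definition mfd_lift_equiv ::
  "'a topology \<Rightarrow> 'b topology \<Rightarrow> ('b \<Rightarrow> 'a) \<Rightarrow> ('a chain set \<Rightarrow> 'b \<Rightarrow> 'b) \<Rightarrow> 'a set set \<Rightarrow>
   ('a set \<Rightarrow> nat) \<Rightarrow> (('a set \<Rightarrow> 'b set) \<times> ('a set \<Rightarrow> 'b set)) set" where
  "mfd_lift_equiv M Q q act \<C> d =
     lift_equiv (homology_group 1 M) act \<C> d (cell_lifts Q q \<C>)"

definition Eul ::
  "'a topology \<Rightarrow> 'b topology \<Rightarrow> ('b \<Rightarrow> 'a) \<Rightarrow> ('a chain set \<Rightarrow> 'b \<Rightarrow> 'b) \<Rightarrow> 'a set set \<Rightarrow>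
   ('a set \<Rightarrow> nat) \<Rightarrow> ('a set \<Rightarrow> 'b set) set set" where
  "Eul M Q q act \<C> d = cell_lifts Q q \<C> // mfd_lift_equiv M Q q act \<C> d"

end

theory Submission
  imports Defs
begin

text \<open>Let \<open>M\<close> be the underlying manifold, \<open>X\<close> the exterior of the tubes \<open>N\<^sub>i\<close>, \<open>G\<close> the orbifold homology group and
  \<open>H = H\<^sub>1(M)\<close>.  The proof compares the orbifold cover \<open>P\<close>, with deck group \<open>G\<close>, and the cover \<open>Q\<close> of \<open>M\<close>, with
  deck group \<open>H\<close>.

  The canonical homomorphism \<open>\<phi> : G \<rightarrow> H\<close> is onto.  Indeed the part of \<open>P\<close> over \<open>X\<close> maps to \<open>Q\<close> over \<open>M\<close>
  (\<open>exterior_lift\<close>); the image is open and closed in the part of \<open>Q\<close> over \<open>X\<close>, and that part is connected, since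
  a path through a tube can be pushed to the boundary along the meridian discs (\<open>exterior_cover_connected\<close>).  So the
  image is everything over \<open>X\<close>, and every element of \<open>H\<close> comes from \<open>G\<close> (\<open>phi_surj\<close>).  Moreover \<open>H\<close> is
  finitely generated, because it acts on the connected space \<open>Q\<close> with compact quotient (\<open>finitely_generated\<close>), and
  finitely generated abelian groups are Hopfian (\<open>finitely_generated_hopfian\<close>).  Hence if \<open>G\<close> and \<open>H\<close> are
  isomorphic at all, then \<open>\<phi>\<close> is an isomorphism (\<open>phi_iso\<close>).

  A meridian bounds a disc in \<open>M\<close>, so its class is \<open>1\<close> in \<open>H\<close> and therefore in \<open>G\<close>.  Thus the lifts of meridians to
  \<open>P\<close> are closed, which means that \<open>P\<close> is not branched along the singular curves: it is an ordinary covering of every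
  tube (\<open>local_group_full\<close>, \<open>P_tube_covering\<close>).  Now the map over \<open>X\<close> extends over the tubes, by sending lifts
  of meridian discs to lifts of meridian discs, and yields an equivariant homeomorphism from \<open>P\<close> to \<open>Q\<close>
  (\<open>identification_exists\<close>).

  Through any such homeomorphism the lifts of the cells to \<open>P\<close> correspond to those to \<open>Q\<close>.  Cells are simply
  connected, so the cells over a given one form a torsor under the deck group (\<open>cells_over_torsor\<close>).  For two lifts
  that satisfy the boundary condition at a singular curve, the same deck transformation relates the chosen 0-cells and
  the chosen 1-cells over this curve; their contributions to the quotient over all cells are inverse to each other
  (\<open>curve_condition_ratio\<close>, \<open>lift_quotient_singular_cancel\<close>).  So omitting the singular cells from the product does not
  change the quotient, and the map of classes is well defined and injective.  It is surjective: given any lift,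
  replace the 0-cell over each singular curve by the initial point of the lifted 1-cell, whose terminal point is then
  the translate by the class of the curve (\<open>curve_path_ends\<close>), and compensate the change of the class by moving a
  0-cell that is not singular (\<open>curve_condition_representative\<close>).\<close>

section \<open>Finitely generated abelian groups\<close>

lemma (in comm_group) generate_insert_form:
  assumes "S \<subseteq> carrier G" "g \<in> carrier G" "h \<in> generate G (insert g S)"
  obtains s k where "s \<in> generate G S" "h = s \<otimes> g [^] (k::int)"
proof -
  have sub: "generate G S \<subseteq> carrier G" using assms(1) generate_incl by blast
  have "\<exists>s\<in>generate G S. \<exists>k::int. h = s \<otimes> g [^] k"
    using assms(3)
  proof (induction rule: generate.induct)
    case one
    show ?case by (intro bexI[of _ \<one>] exI[of _ 0]) (auto simp: generate.one)
  next
    case (incl h)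
    show ?case
    proof (cases "h = g")
      case True
      then show ?thesis using assms(2) by (intro bexI[of _ \<one>] exI[of _ 1]) (auto simp: generate.one)
    next
      case False
      then have "h \<in> S" using incl by auto
      then show ?thesis using assms(1) by (intro bexI[of _ h] exI[of _ 0]) (auto simp: generate.incl)
    qed
  next
    case (inv h)
    show ?case
    proof (cases "h = g")
      case True
      then show ?thesis using assms(2)
        by (intro bexI[of _ \<one>] exI[of _ "-1"]) (auto simp: generate.one int_pow_neg)
    next
      case False
      then have "h \<in> S" using inv by auto
      then show ?thesis using assms(1) by (intro bexI[of _ "inv h"] exI[of _ 0]) (auto simp: generate.inv)
    qed
  next
    case (eng h1 h2)
    then obtain s1 k1 s2 k2 where *: "s1 \<in> generate G S" "h1 = s1 \<otimes> g [^] (k1::int)"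
       "s2 \<in> generate G S" "h2 = s2 \<otimes> g [^] (k2::int)" by blast
    then have "s1 \<in> carrier G" "s2 \<in> carrier G" using sub by auto
    then have "h1 \<otimes> h2 = (s1 \<otimes> s2) \<otimes> g [^] (k1 + k2)"
      using * assms(2) by (simp add: int_pow_mult m_ac)
    then show ?case using generate.eng[OF *(1,3)] by metis
  qed
  then show thesis using that by blast
qed

text \<open>The group of integers is a principal ideal domain: in the step from \<open>S\<close> to \<open>insert g S\<close> the exponents of \<open>g\<close> that
  occur in the subgroup are the multiples of one of them, so one generator more than for the part inside
  \<open>generate G S\<close> suffices.\<close>

lemma (in comm_group) subgroup_of_finitely_generated:
  assumes "finite S" "S \<subseteq> carrier G" "subgroup H G" "H \<subseteq> generate G S"
  shows "\<exists>T. finite T \<and> T \<subseteq> H \<and> generate G T = H"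
  using assms
proof (induction S arbitrary: H rule: finite_induct)
  case empty
  have "H = {\<one>}"
    using empty.prems subgroup.one_closed[OF empty.prems(2)] by (auto simp: generate_empty)
  then show ?case
    by (intro exI[of _ "{}"]) (simp add: generate_empty)
next
  case (insert g S H)
  have gS: "g \<in> carrier G" "S \<subseteq> carrier G" using insert.prems by auto
  interpret H: subgroup H G by fact
  interpret S: subgroup "generate G S" G using generate_is_subgroup gS(2) .
  have "subgroup (H \<inter> generate G S) G"
    using H.subgroup_axioms S.subgroup_axioms subgroups_Inter_pair by blast
  then obtain T where T: "finite T" "T \<subseteq> H \<inter> generate G S" "generate G T = H \<inter> generate G S"
    using insert.IH[OF gS(2), of "H \<inter> generate G S"] by blast
  \<comment> \<open>the exponents of \<open>g\<close> that occur in \<open>H\<close>\<close>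
  define I where "I = {k::int. \<exists>h\<in>H. \<exists>s\<in>generate G S. h = s \<otimes> g [^] k}"
  have form: "\<exists>s\<in>generate G S. \<exists>k\<in>I. h = s \<otimes> g [^] k" if "h \<in> H" for h
  proof -
    have "h \<in> generate G (insert g S)" using that insert.prems by blast
    then obtain s k where sk: "s \<in> generate G S" "h = s \<otimes> g [^] (k::int)"
      using generate_insert_form[OF gS(2,1)] by metis
    then have "k \<in> I" unfolding I_def using that by auto
    then show ?thesis using sk by auto
  qed
  have sub: "H \<subseteq> carrier G" "generate G S \<subseteq> carrier G" using H.subset S.subset by auto
  show ?case
  proof (cases "\<exists>k\<in>I. k \<noteq> 0")
    case False
    then have "h \<in> generate G S" if "h \<in> H" for h
      using form[OF that] sub by (metis int_pow_0 r_one subsetD)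
    then have "H \<inter> generate G S = H" by auto
    then show ?thesis using T by auto
  next
    case True
    have lin: "a - m * b \<in> I" if ab: "a \<in> I" "b \<in> I" for a b m
    proof -
      obtain h1 s1 h2 s2 where *: "h1 \<in> H" "s1 \<in> generate G S" "h1 = s1 \<otimes> g [^] a"
        "h2 \<in> H" "s2 \<in> generate G S" "h2 = s2 \<otimes> g [^] b" using ab by (auto simp: I_def)
      have c: "s1 \<in> carrier G" "s2 \<in> carrier G" using * sub by auto
      have "h1 \<otimes> h2 [^] (- m) = (s1 \<otimes> s2 [^] (- m)) \<otimes> g [^] (a - m * b)"
      proof -
        have "h2 [^] (- m) = s2 [^] (- m) \<otimes> g [^] (b * (- m))"
          using * c gS by (simp add: int_pow_distrib int_pow_pow)
        moreover have "g [^] a \<otimes> g [^] (b * (- m)) = g [^] (a - m * b)"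
          using gS by (simp add: int_pow_mult[symmetric] algebra_simps)
        moreover have "s1 \<otimes> g [^] a \<otimes> (s2 [^] (- m) \<otimes> g [^] (b * - m)) =
            s1 \<otimes> s2 [^] (- m) \<otimes> (g [^] a \<otimes> g [^] (b * - m))"
          using c gS by (simp add: m_ac)
        ultimately show ?thesis using * by simp
      qed
      moreover have "h1 \<otimes> h2 [^] (- m) \<in> H"
        using * by (simp add: H.subgroup_axioms subgroup_int_pow_closed)
      moreover have "s1 \<otimes> s2 [^] (- m) \<in> generate G S"
        using * by (simp add: S.subgroup_axioms subgroup_int_pow_closed)
      ultimately show ?thesis unfolding I_def by blast
    qed
    obtain k where k: "k \<in> I" "k \<noteq> 0" using True by blast
    have "- k \<in> I" using lin[OF k(1) k(1), of 2] by simp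
    then have "\<exists>n. int n \<in> I \<and> 0 < n"
      using k by (intro exI[of _ "nat \<bar>k\<bar>"]) (cases "k > 0", auto)
    then obtain n where n: "int n \<in> I" "0 < n" "\<And>m. m < n \<Longrightarrow> \<not> (int m \<in> I \<and> 0 < m)"
      using exists_least_iff[of "\<lambda>n. int n \<in> I \<and> 0 < n"] by blast
    obtain hn sn where hn: "hn \<in> H" "sn \<in> generate G S" "hn = sn \<otimes> g [^] int n" using n(1) by (auto simp: I_def)
    have "H \<subseteq> generate G (insert hn T)"
    proof
      fix h assume h: "h \<in> H"
      obtain s a where s: "s \<in> generate G S" "a \<in> I" "h = s \<otimes> g [^] a" using form[OF h] by blast
      have "a mod int n \<in> I"
        using lin[OF s(2) n(1), of "a div int n"] by (simp add: minus_div_mult_eq_mod)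
      then have "a mod int n = 0"
        using n(2) n(3)[of "nat (a mod int n)"] by (smt (verit) nat_less_iff of_nat_0_less_iff pos_mod_bound pos_mod_sign zero_less_nat_eq nat_0_le)
      then have a: "a = int n * (a div int n)" by (metis mult_div_mod_eq add.right_neutral)
      have c: "s \<in> carrier G" "sn \<in> carrier G" using s hn sub by auto
      have "h \<otimes> hn [^] (- (a div int n)) = s \<otimes> sn [^] (- (a div int n))"
      proof -
        have "hn [^] (- (a div int n)) = sn [^] (- (a div int n)) \<otimes> g [^] (- a)"
          using hn c gS by (subst (3) a) (simp add: int_pow_distrib int_pow_pow)
        then have "h \<otimes> hn [^] (- (a div int n)) = s \<otimes> sn [^] (- (a div int n)) \<otimes> (g [^] a \<otimes> g [^] (- a))"
          using s(3) c gS by (simp add: m_ac)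
        also have "g [^] a \<otimes> g [^] (- a) = \<one>" using gS by (simp add: int_pow_neg)
        finally show ?thesis using c by simp
      qed
      moreover have "s \<otimes> sn [^] (- (a div int n)) \<in> generate G S"
        using s hn by (simp add: S.subgroup_axioms subgroup_int_pow_closed)
      moreover have "h \<otimes> hn [^] (- (a div int n)) \<in> H"
        using h hn by (simp add: H.subgroup_axioms subgroup_int_pow_closed)
      ultimately have "h \<otimes> hn [^] (- (a div int n)) \<in> generate G T" using T(3) by auto
      then have 1: "h \<otimes> hn [^] (- (a div int n)) \<in> generate G (insert hn T)"
        using mono_generate[of T "insert hn T"] by auto
      have "insert hn T \<subseteq> carrier G" using T hn sub by auto
      then have "subgroup (generate G (insert hn T)) G" using generate_is_subgroup by blast
      moreover have "hn \<in> generate G (insert hn T)" by (simp add: generate.incl)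
      ultimately have "(h \<otimes> hn [^] (- (a div int n))) \<otimes> hn [^] (a div int n) \<in> generate G (insert hn T)"
        using 1 by (simp add: subgroup.m_closed subgroup_int_pow_closed)
      moreover have "(h \<otimes> hn [^] (- (a div int n))) \<otimes> hn [^] (a div int n) = h"
        using h hn(1) sub by (simp add: subset_iff m_assoc int_pow_neg)
      ultimately show "h \<in> generate G (insert hn T)" by simp
    qed
    moreover have "generate G (insert hn T) \<subseteq> H"
      using T hn by (intro generate_subgroup_incl H.subgroup_axioms) auto
    ultimately show ?thesis using T hn by (intro exI[of _ "insert hn T"]) auto
  qed
qed

text \<open>The kernels of the iterates of \<open>f\<close> form an ascending chain.  Its union is finitely generated, so the chain
  stops at some \<open>N\<close>; as the \<open>N\<close>-th iterate is onto, an element of the kernel of \<open>f\<close> has a preimage in the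
  kernel of the iterate number \<open>N + 1\<close>, which is the kernel of the \<open>N\<close>-th one.\<close>

lemma (in comm_group) finitely_generated_hopfian:
  assumes S: "finite S" "S \<subseteq> carrier G" "generate G S = carrier G"
    and f: "f \<in> hom G G" "f ` carrier G = carrier G"
  shows "inj_on f (carrier G)"
proof -
  have hom: "(f ^^ n) \<in> hom G G" for n
  proof (induction n)
    case 0
    show ?case by (simp add: hom_def)
  next
    case (Suc n)
    have "f \<circ> (f ^^ n) \<in> hom G G" using Suc.IH f(1) unfolding hom_def by (simp add: Pi_iff)
    then show ?case unfolding funpow.simps(2) .
  qed
  have surj: "(f ^^ n) ` carrier G = carrier G" for n
  proof (induction n)
    case (Suc n)
    have "(f ^^ Suc n) ` carrier G = f ` ((f ^^ n) ` carrier G)"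
      unfolding funpow.simps(2) by (rule image_comp[symmetric])
    also have "\<dots> = carrier G" unfolding Suc.IH by (rule f(2))
    finally show ?case .
  qed simp
  \<comment> \<open>the kernel of the \<open>n\<close>-th iterate\<close>
  define K where "K n = {x \<in> carrier G. (f ^^ n) x = \<one>}" for n
  have K: "subgroup (K n) G" for n
  proof -
    interpret h: group_hom G G "f ^^ n" using hom by unfold_locales
    show ?thesis using h.subgroup_kernel by (simp add: kernel_def K_def)
  qed
  have f1: "f \<one> = \<one>" using f(1) by (simp add: hom_one is_group)
  have step: "K n \<subseteq> K (Suc n)" for n by (auto simp: K_def f1)
  have mono: "K m \<subseteq> K n" if "m \<le> n" for m n using step that by (rule lift_Suc_mono_le)
  have "subgroup (\<Union>n. K n) G"
  proof (rule subgroupI)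
    show "(\<Union>n. K n) \<subseteq> carrier G" by (auto simp: K_def)
    show "(\<Union>n. K n) \<noteq> {}" using subgroup.one_closed[OF K] by blast
    show "inv a \<in> (\<Union>n. K n)" if "a \<in> (\<Union>n. K n)" for a
      using that subgroup.m_inv_closed[OF K] by blast
    show "a \<otimes> b \<in> (\<Union>n. K n)" if ab: "a \<in> (\<Union>n. K n)" "b \<in> (\<Union>n. K n)" for a b
    proof -
      obtain m n where "a \<in> K m" "b \<in> K n" using ab by blast
      then have "a \<in> K (max m n)" "b \<in> K (max m n)" using mono[of m "max m n"] mono[of n "max m n"] by auto
      then show ?thesis using subgroup.m_closed[OF K] by blast
    qed
  qed
  then obtain T where T: "finite T" "T \<subseteq> (\<Union>n. K n)" "generate G T = (\<Union>n. K n)"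
    using subgroup_of_finitely_generated[OF S(1,2), of "\<Union>n. K n"] S(3) by (auto simp: K_def)
  obtain N where N: "T \<subseteq> K N"
    using T(1,2)
  proof (induction T arbitrary: thesis rule: finite_induct)
    case empty
    then show ?case by blast
  next
    case (insert t T)
    obtain N where "T \<subseteq> K N" using insert by blast
    moreover obtain n where "t \<in> K n" using insert by blast
    ultimately have "insert t T \<subseteq> K (max N n)" using mono[of N "max N n"] mono[of n "max N n"] by auto
    then show ?case using insert by blast
  qed
  have UN: "(\<Union>n. K n) \<subseteq> K N"
    using generate_subgroup_incl[OF N K] T(3) by simp
  have "x = \<one>" if x: "x \<in> carrier G" "f x = \<one>" for x
  proof -
    obtain y where y: "y \<in> carrier G" "x = (f ^^ N) y" using surj[of N] x by (metis imageE)
    then have "y \<in> K (Suc N)" using x by (simp add: K_def)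
    then have "y \<in> K N" using UN by blast
    then show ?thesis using y by (simp add: K_def)
  qed
  then show ?thesis
    using f(1) is_group by (subst inj_on_one_iff') auto
qed

text \<open>This is how an abstract isomorphism makes a canonical surjection bijective: composing the surjection with the
  inverse of the isomorphism gives an endomorphism to which the Hopfian property applies.\<close>

lemma surjection_of_isomorphic_groups_iso:
  assumes "group A" "comm_group B" "finite S" "S \<subseteq> carrier B" "generate B S = carrier B" "A \<cong> B"
    and f: "f \<in> hom A B" "f ` carrier A = carrier B"
  shows "f \<in> iso A B"
proof -
  interpret B: comm_group B by fact
  obtain i where i: "i \<in> iso A B" using assms(6) by (auto simp: is_iso_def)
  have bij: "bij_betw i (carrier A) (carrier B)" using i by (auto simp: iso_def)
  let ?j = "inv_into (carrier A) i"
  have j: "?j \<in> iso B A" using group.iso_set_sym[OF assms(1) i] .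
  have jc: "?j ` carrier B = carrier A" using j by (auto simp: iso_def bij_betw_def)
  have "f \<circ> ?j \<in> hom B B" using j f(1) by (auto simp: iso_def hom_compose)
  moreover have "(f \<circ> ?j) ` carrier B = carrier B" using jc f(2) image_comp by metis
  ultimately have "inj_on (f \<circ> ?j) (carrier B)" using B.finitely_generated_hopfian[OF assms(3-5)] by blast
  then have "inj_on f (carrier A)" using jc by (metis inj_on_imageI)
  then show ?thesis using f by (simp add: iso_def bij_betw_def)
qed

section \<open>Homology classes of closed paths\<close>

lemma contractible_space_trivial_homology:
  assumes "contractible_space X" "p \<noteq> 0"
  shows "trivial_group (homology_group p X)"
  using trivial_reduced_homology_group_contractible_space[OF assms(1)] un_reduced_homology_group[OF assms(2)]
  by metis

text \<open>The two faces of the 1-simplex of a path are the end points, and they cancel if the path is closed.\<close>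

lemma closed_path_relcycle:
  assumes "pathin X \<gamma>" "\<gamma> 0 = \<gamma> 1"
  shows "singular_relcycle 1 X {} (frag_of (restrict (\<lambda>x. \<gamma> (x 1)) (standard_simplex 1)))"
proof -
  let ?s = "restrict (\<lambda>x. \<gamma> (x 1)) (standard_simplex 1)"
  have c: "continuous_map (subtopology (powertop_real UNIV) (standard_simplex 1))
      (subtopology euclideanreal {0..1}) (\<lambda>x. x 1)"
    by (auto simp: continuous_map_in_subtopology standard_simplex_def
        intro!: continuous_map_from_subtopology continuous_map_product_projection)
  have "continuous_map (subtopology (powertop_real UNIV) (standard_simplex 1)) X (\<lambda>x. \<gamma> (x 1))"
    using continuous_map_compose[OF c, of X \<gamma>] assms(1) by (simp add: pathin_def o_def)
  then have s: "singular_simplex 1 X ?s"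
    unfolding singular_simplex_def
    by (auto intro: continuous_map_eq)
  have face: "singular_face 1 k ?s = restrict (\<lambda>x. \<gamma> 0) (standard_simplex 0)" if "k \<le> 1" for k
  proof
    fix x
    have "x \<in> standard_simplex 0 \<Longrightarrow> simplical_face k x \<in> standard_simplex 1"
      using simplical_face_in_standard_simplex[of 1 k x] that by simp
    moreover have "x \<in> standard_simplex 0 \<Longrightarrow> \<gamma> (simplical_face k x 1) = \<gamma> 0"
      using that assms(2) by (cases "k = 0") (auto simp: simplical_face_def standard_simplex_0)
    ultimately show "singular_face 1 k ?s x = restrict (\<lambda>x. \<gamma> 0) (standard_simplex 0) x"
      by (auto simp: singular_face_def)
  qed
  have "chain_boundary 1 (frag_of ?s) = (\<Sum>k\<le>1. frag_cmul ((-1) ^ k) (frag_of (restrict (\<lambda>x. \<gamma> 0) (standard_simplex 0))))"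
    unfolding chain_boundary_of using face by (auto intro!: sum.cong)
  also have "\<dots> = 0"
    by (simp add: atMost_Suc)
  finally show ?thesis
    using s by (simp add: singular_cycle singular_chain_of)
qed

lemma loop_class_cong:
  assumes "\<And>t. t \<in> {0..1} \<Longrightarrow> \<gamma> t = \<gamma>' t"
  shows "loop_class X \<gamma> = loop_class X \<gamma>'"
proof -
  have "restrict (\<lambda>x. \<gamma> (x 1)) (standard_simplex 1) = restrict (\<lambda>x. \<gamma>' (x 1)) (standard_simplex 1)"
    using assms by (intro restrict_ext) (auto simp: standard_simplex_def)
  then show ?thesis
    by (simp add: loop_class_def)
qed

lemma loop_class_carrier:
  assumes "pathin X \<gamma>" "\<gamma> 0 = \<gamma> 1"
  shows "loop_class X \<gamma> \<in> carrier (homology_group 1 X)"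
  using closed_path_relcycle[OF assms] carrier_relative_homology_group[of 1 X "{}"]
  by (auto simp: loop_class_def)

lemma hom_induced_loop_class:
  assumes "pathin X \<gamma>" "\<gamma> 0 = \<gamma> 1" "continuous_map X Z f"
  shows "hom_induced 1 X {} Z {} f (loop_class X \<gamma>) = loop_class Z (f \<circ> \<gamma>)"
proof -
  have "hom_induced (int 1) X {} Z {} f (loop_class X \<gamma>) =
      homologous_rel_set 1 Z {} (chain_map 1 f (frag_of (restrict (\<lambda>x. \<gamma> (x 1)) (standard_simplex 1))))"
    unfolding loop_class_def
    using hom_induced_chain_map[OF assms(3), of "{}" "{}" 1] closed_path_relcycle[OF assms(1,2)] by simp
  also have "chain_map 1 f (frag_of (restrict (\<lambda>x. \<gamma> (x 1)) (standard_simplex 1)))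
      = frag_of (restrict (\<lambda>x. (f \<circ> \<gamma>) (x 1)) (standard_simplex 1))"
    by (simp add: chain_map_of simplex_map_def o_def restrict_compose_left cong: restrict_cong)
  finally show ?thesis
    by (simp add: loop_class_def)
qed

text \<open>The only source of trivial classes in what follows: cells, meridian discs and universal covers of tubes are
  contractible.\<close>

lemma loop_class_through_contractible:
  assumes "contractible_space X" "pathin X \<gamma>" "\<gamma> 0 = \<gamma> 1" "continuous_map X Z f"
  shows "loop_class Z (f \<circ> \<gamma>) = \<one>\<^bsub>homology_group 1 Z\<^esub>"
proof -
  interpret h: group_hom "homology_group 1 X" "homology_group 1 Z" "hom_induced 1 X {} Z {} f"
    by (simp add: group_hom.intro group_hom_axioms.intro hom_induced_empty_hom)
  have "loop_class X \<gamma> = \<one>\<^bsub>homology_group 1 X\<^esub>"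
    using loop_class_carrier[OF assms(2,3)] contractible_space_trivial_homology[OF assms(1), of 1]
    by (auto simp: trivial_group_def)
  then show ?thesis
    using hom_induced_loop_class[OF assms(2-4)] h.hom_one by simp
qed

section \<open>Coverings and lifts\<close>

lemma continuous_map_locally:
  assumes "\<And>x. x \<in> topspace X \<Longrightarrow>
    \<exists>N g. openin X N \<and> x \<in> N \<and> continuous_map (subtopology X N) Y g \<and> (\<forall>n\<in>N. F n = g n)"
  shows "continuous_map X Y F"
  unfolding continuous_map_def
proof (intro conjI allI impI)
  show "F \<in> topspace X \<rightarrow> topspace Y"
  proof
    fix x assume x: "x \<in> topspace X"
    obtain N g where "openin X N" "x \<in> N" "continuous_map (subtopology X N) Y g" "\<forall>n\<in>N. F n = g n"
      using assms[OF x] by blast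
    then show "F x \<in> topspace Y" using x by (auto simp: continuous_map_def Pi_iff)
  qed
  fix V assume V: "openin Y V"
  show "openin X {x \<in> topspace X. F x \<in> V}"
  proof (subst openin_subopen, intro ballI)
    fix x assume "x \<in> {x \<in> topspace X. F x \<in> V}"
    then have x: "x \<in> topspace X" "F x \<in> V" by auto
    obtain N g where N: "openin X N" "x \<in> N" "continuous_map (subtopology X N) Y g" "\<forall>n\<in>N. F n = g n"
      using assms[OF x(1)] by blast
    have "openin (subtopology X N) {n \<in> topspace (subtopology X N). g n \<in> V}"
      using N(3) V by (rule openin_continuous_map_preimage)
    then have "openin X {n \<in> topspace (subtopology X N). g n \<in> V}"
      using N(1) openin_trans_full by blast
    then show "\<exists>T. openin X T \<and> x \<in> T \<and> T \<subseteq> {x \<in> topspace X. F x \<in> V}"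
      using x N by (intro exI[of _ "{n \<in> topspace (subtopology X N). g n \<in> V}"]) auto
  qed
qed

lemma covering_continuous: "covering E B p \<Longrightarrow> continuous_map E B p"
  by (simp add: covering_def)

lemma covering_evenly_covered:
  assumes "covering E B p" "y \<in> topspace B"
  obtains U \<V> where "openin B U" "y \<in> U" "\<Union>\<V> = {x \<in> topspace E. p x \<in> U}" "disjoint \<V>"
    "\<forall>V\<in>\<V>. openin E V \<and> homeomorphic_map (subtopology E V) (subtopology B U) p"
  using assms unfolding covering_def by meson

text \<open>The form in which evenly covered neighbourhoods are used: \<open>V\<close> is the sheet through \<open>x\<close>, \<open>s\<close> is the section with
  image \<open>V\<close>, and the other sheets over \<open>U\<close> form an open set.\<close>

lemma covering_sheet_at:
  assumes "covering E B p" "x \<in> topspace E"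
  obtains U V s where "openin B U" "p x \<in> U" "openin E V" "x \<in> V" "homeomorphic_maps (subtopology E V) (subtopology B U) p s"
    "\<forall>z\<in>V. s (p z) = z" "V \<subseteq> {z \<in> topspace E. p z \<in> U}"
    "openin E ({z \<in> topspace E. p z \<in> U} - V)"
proof -
  have "p x \<in> topspace B" using assms by (auto simp: covering_def)
  then obtain U \<V> where U: "openin B U" "p x \<in> U" and V: "\<Union>\<V> = {x \<in> topspace E. p x \<in> U}" "disjoint \<V>"
    "\<forall>V\<in>\<V>. openin E V \<and> homeomorphic_map (subtopology E V) (subtopology B U) p"
    using assms(1) unfolding covering_def by meson
  obtain V where x: "V \<in> \<V>" "x \<in> V" using V(1) U(2) assms(2) by auto
  obtain s where s: "homeomorphic_maps (subtopology E V) (subtopology B U) p s"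
    using V(3) x(1) homeomorphic_map_maps by blast
  have "{z \<in> topspace E. p z \<in> U} - V = \<Union>(\<V> - {V})"
  proof -
    have "\<Union>\<V> - V = \<Union>(\<V> - {V})"
      using V(2) x(1) by (auto simp: disjoint_def)
    then show ?thesis using V(1) by simp
  qed
  then have "openin E ({z \<in> topspace E. p z \<in> U} - V)"
    using V(3) by auto
  moreover have "s (p z) = z" if "z \<in> V" for z
    using s that V(3) x(1) openin_subset[of E V] by (auto simp: homeomorphic_maps_def)
  moreover have "V \<subseteq> {z \<in> topspace E. p z \<in> U}" using V(1) x(1) by auto
  moreover have "openin E V" using V(3) x(1) by auto
  ultimately show thesis
    using that[of U V s] U x s by blast
qed

text \<open>Two lifts that agree at a point agree near it, because they stay in the same sheet; two lifts that differ at a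
  point differ near it, because they stay in different sheets.  All statements on uniqueness of lifts come
  from here, and so do those that say that the image of a section is open.\<close>

lemma lifts_agree_clopen:
  assumes cov: "covering E B p" and f: "continuous_map X E f" and g: "continuous_map X E g"
    and eq: "\<And>x. x \<in> topspace X \<Longrightarrow> p (f x) = p (g x)"
  shows "openin X {x \<in> topspace X. f x = g x}" "closedin X {x \<in> topspace X. f x = g x}"
proof -
  have fE: "f x \<in> topspace E" and gE: "g x \<in> topspace E" if "x \<in> topspace X" for x
    using f g that by (auto simp: continuous_map_def)
  show "openin X {x \<in> topspace X. f x = g x}"
  proof (subst openin_subopen, intro ballI)
    fix x assume "x \<in> {x \<in> topspace X. f x = g x}"
    then have x: "x \<in> topspace X" "f x = g x" by auto
    obtain U V s where *: "openin B U" "p (f x) \<in> U" "openin E V" "f x \<in> V"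
        "homeomorphic_maps (subtopology E V) (subtopology B U) p s"
        "\<forall>z\<in>V. s (p z) = z" "V \<subseteq> {z \<in> topspace E. p z \<in> U}"
        "openin E ({z \<in> topspace E. p z \<in> U} - V)"
      by (rule covering_sheet_at[OF cov fE[OF x(1)]])
    let ?T = "{z \<in> topspace X. f z \<in> V} \<inter> {z \<in> topspace X. g z \<in> V}"
    have "openin X ?T" by (intro openin_Int openin_continuous_map_preimage[OF f] openin_continuous_map_preimage[OF g] *)
    moreover have "f z = g z" if "z \<in> ?T" for z
      using *(6) eq[of z] that by (metis (mono_tags, lifting) IntD1 IntD2 mem_Collect_eq)
    moreover have "x \<in> ?T" using x * by auto
    ultimately show "\<exists>T. openin X T \<and> x \<in> T \<and> T \<subseteq> {x \<in> topspace X. f x = g x}" by blast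
  qed
  have "openin X (topspace X - {x \<in> topspace X. f x = g x})"
  proof (subst openin_subopen, intro ballI)
    fix x assume "x \<in> topspace X - {x \<in> topspace X. f x = g x}"
    then have x: "x \<in> topspace X" "f x \<noteq> g x" by auto
    obtain U V s where *: "openin B U" "p (f x) \<in> U" "openin E V" "f x \<in> V"
        "homeomorphic_maps (subtopology E V) (subtopology B U) p s"
        "\<forall>z\<in>V. s (p z) = z" "V \<subseteq> {z \<in> topspace E. p z \<in> U}"
        "openin E ({z \<in> topspace E. p z \<in> U} - V)"
      by (rule covering_sheet_at[OF cov fE[OF x(1)]])
    let ?T = "{z \<in> topspace X. f z \<in> V} \<inter> {z \<in> topspace X. g z \<in> {z \<in> topspace E. p z \<in> U} - V}"
    have "openin X ?T" by (intro openin_Int openin_continuous_map_preimage[OF f] openin_continuous_map_preimage[OF g] *)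
    moreover have "g x \<notin> V"
      using *(4,6) eq[of x] x by metis
    then have "x \<in> ?T" using x * eq[of x] gE by auto
    moreover have "?T \<subseteq> topspace X - {x \<in> topspace X. f x = g x}" by auto
    ultimately show "\<exists>T. openin X T \<and> x \<in> T \<and> T \<subseteq> topspace X - {x \<in> topspace X. f x = g x}" by meson
  qed
  then show "closedin X {x \<in> topspace X. f x = g x}"
    by (auto simp: closedin_def)
qed

lemma lifts_eq:
  assumes cov: "covering E B p" and f: "continuous_map X E f" and g: "continuous_map X E g"
    and eq: "\<And>x. x \<in> topspace X \<Longrightarrow> p (f x) = p (g x)"
    and con: "connected_space X" and x0: "x0 \<in> topspace X" "f x0 = g x0" and x: "x \<in> topspace X"
  shows "f x = g x"
proof -
  have "{x \<in> topspace X. f x = g x} = topspace X"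
    using lifts_agree_clopen[OF cov f g eq] con x0
    by (metis (mono_tags, lifting) connected_space_clopen_in empty_iff mem_Collect_eq)
  then show ?thesis using x by blast
qed

lemma lifts_eq_on:
  assumes cov: "covering E B p" and f: "continuous_map (subtopology X S) E f" and g: "continuous_map (subtopology X S) E g"
    and eq: "\<And>x. x \<in> S \<Longrightarrow> p (f x) = p (g x)"
    and con: "connectedin X S" and x0: "x0 \<in> S" "f x0 = g x0" and x: "x \<in> S"
  shows "f x = g x"
proof (rule lifts_eq[OF cov f g])
  have "topspace (subtopology X S) = S" using connectedin_subset_topspace[OF con] by auto
  then show "x0 \<in> topspace (subtopology X S)" "x \<in> topspace (subtopology X S)"
    and "\<And>x. x \<in> topspace (subtopology X S) \<Longrightarrow> p (f x) = p (g x)"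
    using x0 x eq by auto
  show "connected_space (subtopology X S)" using con by (simp add: connectedin_def)
qed fact

lemma covering_restrict:
  assumes "covering E B p"
  shows "covering (subtopology E {x. p x \<in> S}) (subtopology B S) p"
proof -
  have 1: "continuous_map (subtopology E {x. p x \<in> S}) (subtopology B S) p"
    using covering_continuous[OF assms] by (auto simp: continuous_map_in_subtopology continuous_map_from_subtopology)
  have "p ` topspace E = topspace B"
    using assms by (simp add: covering_def)
  then have 2: "p ` topspace (subtopology E {x. p x \<in> S}) = topspace (subtopology B S)"
    by auto
  have 3: "\<exists>U \<V>. openin (subtopology B S) U \<and> y \<in> U \<and>
        \<Union>\<V> = {x \<in> topspace (subtopology E {x. p x \<in> S}). p x \<in> U} \<and> disjoint \<V> \<and>
        (\<forall>V\<in>\<V>. openin (subtopology E {x. p x \<in> S}) V \<and>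
            homeomorphic_map (subtopology (subtopology E {x. p x \<in> S}) V) (subtopology (subtopology B S) U) p)"
    if y: "y \<in> topspace (subtopology B S)" for y
  proof -
    have "y \<in> topspace B" using y by auto
    then obtain U \<V> where U: "openin B U" "y \<in> U" and V0: "\<Union>\<V> = {x \<in> topspace E. p x \<in> U}" "disjoint \<V>"
      "\<forall>V\<in>\<V>. openin E V \<and> homeomorphic_map (subtopology E V) (subtopology B U) p"
      by (rule covering_evenly_covered[OF assms])
    note V = V0(1,2)
    have V3: "\<forall>V\<in>\<V>. openin E V \<and> homeomorphic_map (subtopology E V) (subtopology B U) p" using V0 by auto
    let ?W = "(\<lambda>V. V \<inter> {x. p x \<in> S}) ` \<V>"
    have h: "homeomorphic_map (subtopology (subtopology E {x. p x \<in> S}) (V \<inter> {x. p x \<in> S}))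
         (subtopology (subtopology B S) (U \<inter> S)) p" if "V \<in> \<V>" for V
    proof -
      have hm: "homeomorphic_map (subtopology E V) (subtopology B U) p" using V3 that by auto
      have "V \<subseteq> topspace E" using V3 that openin_subset by blast
      moreover have "U \<subseteq> topspace B" using U openin_subset by blast
      ultimately have im: "p ` V = U" using homeomorphic_imp_surjective_map[OF hm]
        by (simp add: Int_absorb1)
      have "homeomorphic_map (subtopology (subtopology E V) {x. p x \<in> S})
          (subtopology (subtopology B U) S) p"
        by (rule homeomorphic_map_subtopologies_alt[OF hm]) auto
      moreover have "subtopology (subtopology E V) {x. p x \<in> S} = subtopology (subtopology E {x. p x \<in> S}) (V \<inter> {x. p x \<in> S})"
        "subtopology (subtopology B U) S = subtopology (subtopology B S) (U \<inter> S)"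
        by (simp_all add: subtopology_subtopology ac_simps)
      ultimately show ?thesis by simp
    qed
    show ?thesis
    proof (intro exI[of _ "U \<inter> S"] exI[of _ ?W] conjI ballI)
      show "openin (subtopology B S) (U \<inter> S)" using U openin_subtopology by blast
      show "y \<in> U \<inter> S" using U y by auto
      show "\<Union>?W = {x \<in> topspace (subtopology E {x. p x \<in> S}). p x \<in> U \<inter> S}"
        using V(1) by auto
      show "disjoint ?W"
        using V(2) by (fastforce simp: disjoint_def)
      fix W assume "W \<in> ?W"
      then obtain V where "V \<in> \<V>" "W = V \<inter> {x. p x \<in> S}" by auto
      then show "openin (subtopology E {x. p x \<in> S}) W"
        "homeomorphic_map (subtopology (subtopology E {x. p x \<in> S}) W) (subtopology (subtopology B S) (U \<inter> S)) p"
        using V3 h openin_subtopology by blast+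
    qed
  qed
  show ?thesis unfolding covering_def using 1 2 3 by blast
qed

text \<open>The graph of the lift is the path component of \<open>(x0, e0)\<close> in the fibre product of \<open>X\<close> and \<open>E\<close> over \<open>B\<close>.  It
  projects onto \<open>X\<close>, since small path-connected sets lift, and injectively, since a path in the fibre product between two
  points over the same \<open>x\<close> consists of a closed path in \<open>X\<close> and a path in \<open>E\<close> over it, which is closed by the
  assumption on the monodromy.  In this form neither path lifting nor homotopy lifting has to be proved first.\<close>

lemma lift_exists:
  assumes cov: "covering E B p" and f: "continuous_map X B f"
    and con: "path_connected_space X" and loc: "locally_path_connected_space X"
    and mono: "\<And>\<gamma> \<sigma>. \<lbrakk>pathin X \<gamma>; \<gamma> 0 = \<gamma> 1; pathin E \<sigma>; \<And>t. t \<in> {0..1} \<Longrightarrow> p (\<sigma> t) = f (\<gamma> t)\<rbrakk> \<Longrightarrow> \<sigma> 0 = \<sigma> 1"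
    and x0: "x0 \<in> topspace X" and e0: "e0 \<in> topspace E" "p e0 = f x0"
  obtains F where "continuous_map X E F" "\<And>x. x \<in> topspace X \<Longrightarrow> p (F x) = f x" "F x0 = e0"
proof -
  define Z where "Z = subtopology (prod_topology X E) {(x, e). f x = p e}"
  define T where "T = {z. path_component_of Z (x0, e0) z}"
  have Zt: "topspace Z = {(x,e). x \<in> topspace X \<and> e \<in> topspace E \<and> f x = p e}"
    by (auto simp: Z_def)
  have TZ: "T \<subseteq> topspace Z"
    unfolding T_def using path_component_of_subset_topspace by fastforce
  have base: "(x0, e0) \<in> T"
    unfolding T_def using x0 e0 Zt by (simp add: path_component_of_refl)
  have uniq: "e = e'" if "(x, e) \<in> T" "(x, e') \<in> T" for x e e'
  proof -
    have "path_component_of Z (x,e) (x,e')"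
      using that path_component_of_trans[of Z "(x,e)" "(x0,e0)" "(x,e')"] path_component_of_sym[of Z "(x0,e0)" "(x,e)"]
      unfolding T_def by simp
    then obtain \<pi> where pi: "pathin Z \<pi>" "\<pi> 0 = (x,e)" "\<pi> 1 = (x,e')"
      by (auto simp: path_component_of_def)
    have piX: "pathin X (fst \<circ> \<pi>)" and piE: "pathin E (snd \<circ> \<pi>)"
      using pi(1) unfolding Z_def
      by (auto intro!: pathin_compose simp: pathin_subtopology continuous_map_fst continuous_map_snd)
    have "p ((snd \<circ> \<pi>) t) = f ((fst \<circ> \<pi>) t)" if "t \<in> {0..1}" for t
      using pi(1) that unfolding Z_def by (auto simp: pathin_subtopology case_prod_beta)
    then have "(snd \<circ> \<pi>) 0 = (snd \<circ> \<pi>) 1"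
      using mono[OF piX _ piE] pi by simp
    then show ?thesis using pi by simp
  qed
  have loc: "\<exists>N. openin X N \<and> x \<in> N \<and> (\<forall>x1\<in>N. \<forall>e1\<in>topspace E. p e1 = f x1 \<longrightarrow>
      (\<exists>s. continuous_map (subtopology X N) E s \<and> (\<forall>n\<in>N. p (s n) = f n) \<and> s x1 = e1 \<and>
        ((x1, e1) \<in> T \<longrightarrow> (\<forall>n\<in>N. (n, s n) \<in> T))))"
    if x: "x \<in> topspace X" for x
  proof -
    have "f x \<in> topspace B" using f x by (auto simp: continuous_map_def)
    then obtain U \<V> where U: "openin B U" "f x \<in> U" and V: "\<Union>\<V> = {x \<in> topspace E. p x \<in> U}"
      "\<forall>V\<in>\<V>. openin E V \<and> homeomorphic_map (subtopology E V) (subtopology B U) p"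
      using cov unfolding covering_def by meson
    have "openin X {x \<in> topspace X. f x \<in> U}" using f U(1) by (rule openin_continuous_map_preimage)
    then obtain N where N: "openin X N" "path_connectedin X N" "x \<in> N" "N \<subseteq> {x \<in> topspace X. f x \<in> U}"
      using loc x U(2) unfolding locally_path_connected_space by (metis (mono_tags, lifting) mem_Collect_eq)
    have "\<exists>s. continuous_map (subtopology X N) E s \<and> (\<forall>n\<in>N. p (s n) = f n) \<and> s x1 = e1 \<and>
        ((x1, e1) \<in> T \<longrightarrow> (\<forall>n\<in>N. (n, s n) \<in> T))"
      if x1: "x1 \<in> N" and e1: "e1 \<in> topspace E" "p e1 = f x1" for x1 e1
    proof -
      have "e1 \<in> {x \<in> topspace E. p x \<in> U}" using N(4) x1 e1 by auto
      then obtain V where e1V: "V \<in> \<V>" "e1 \<in> V" unfolding V(1)[symmetric] by blast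
      then have Vo: "openin E V" using V(2) by auto
      obtain s where s: "homeomorphic_maps (subtopology E V) (subtopology B U) p s"
        using V(2) e1V(1) homeomorphic_map_maps by blast
      have cs: "continuous_map (subtopology X N) E (s \<circ> f)"
      proof (rule continuous_map_compose)
        show "continuous_map (subtopology X N) (subtopology B U) f"
          using f N(4) by (auto simp: continuous_map_in_subtopology continuous_map_from_subtopology)
        show "continuous_map (subtopology B U) E s"
          using s by (auto simp: homeomorphic_maps_def continuous_map_in_subtopology)
      qed
      have ps: "p ((s \<circ> f) n) = f n" if "n \<in> N" for n
        using s that N(4) openin_subset[OF U(1)] by (auto simp: homeomorphic_maps_def)
      have "(s \<circ> f) x1 = e1"
      proof -
        have "s (p e1) = e1"
          using s e1V openin_subset[OF Vo] by (auto simp: homeomorphic_maps_def)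
        then show ?thesis using e1 by simp
      qed
      moreover have "(n, (s \<circ> f) n) \<in> T" if n: "n \<in> N" and e1T: "(x1, e1) \<in> T" for n
      proof -
        have "continuous_map (subtopology X N) Z (\<lambda>n. (n, (s \<circ> f) n))"
          unfolding Z_def continuous_map_in_subtopology
        proof
          show "continuous_map (subtopology X N) (prod_topology X E) (\<lambda>n. (n, (s \<circ> f) n))"
            by (rule continuous_map_pairedI[OF _ cs]) (simp add: continuous_map_from_subtopology)
          show "(\<lambda>n. (n, (s \<circ> f) n)) \<in> topspace (subtopology X N) \<rightarrow> {(x, e). f x = p e}"
            using ps by auto
        qed
        then have "path_connectedin Z ((\<lambda>n. (n, (s \<circ> f) n)) ` N)"
          using N(2) path_connectedin_absolute path_connectedin_continuous_map_image by blast
        then have "path_component_of Z (x1, (s \<circ> f) x1) (n, (s \<circ> f) n)"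
          using x1 n unfolding path_component_of by blast
        then show ?thesis
          using e1T calculation path_component_of_trans[of Z "(x0,e0)" "(x1,e1)"] unfolding T_def by simp
      qed
      ultimately show ?thesis using cs ps by blast
    qed
    then show ?thesis using N by blast
  qed
  define A where "A = {x. \<exists>e. (x, e) \<in> T}"
  have AX: "A \<subseteq> topspace X" using TZ Zt by (auto simp: A_def)
  have TE: "e \<in> topspace E \<and> p e = f x" if "(x, e) \<in> T" for x e using TZ Zt that by auto
  have "openin X A"
  proof (subst openin_subopen, intro ballI)
    fix x assume "x \<in> A"
    then obtain e where e: "(x, e) \<in> T" by (auto simp: A_def)
    then obtain N where "openin X N" "x \<in> N" "\<forall>n\<in>N. \<exists>e. (n, e) \<in> T"
      using loc[of x] TE[OF e] AX \<open>x \<in> A\<close> by (meson subsetD)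
    then show "\<exists>T. openin X T \<and> x \<in> T \<and> T \<subseteq> A" by (auto simp: A_def)
  qed
  moreover have "openin X (topspace X - A)"
  proof (subst openin_subopen, intro ballI)
    fix x assume x: "x \<in> topspace X - A"
    obtain N where N: "openin X N" "x \<in> N" "\<forall>x1\<in>N. \<forall>e1. (x1, e1) \<in> T \<longrightarrow> (\<forall>n\<in>N. \<exists>e. (n, e) \<in> T)"
      using loc[of x] TE x by (meson DiffD1)
    then have "N \<subseteq> topspace X - A"
      using x openin_subset[OF N(1)] by (auto simp: A_def)
    then show "\<exists>T. openin X T \<and> x \<in> T \<and> T \<subseteq> topspace X - A" using N by blast
  qed
  ultimately have "A = topspace X"
    using path_connected_imp_connected_space[OF con] AX base
    by (metis (mono_tags, lifting) A_def closedin_def connected_space_clopen_in empty_iff mem_Collect_eq)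
  then have ex: "\<exists>e. (x, e) \<in> T" if "x \<in> topspace X" for x using that by (auto simp: A_def)
  define F where "F x = (SOME e. (x, e) \<in> T)" for x
  have FT: "(x, F x) \<in> T" if "x \<in> topspace X" for x
    unfolding F_def using ex[OF that] by (rule someI_ex)
  have "continuous_map X E F"
  proof (rule continuous_map_locally)
    fix x assume x: "x \<in> topspace X"
    obtain N s where N: "openin X N" "x \<in> N" "continuous_map (subtopology X N) E s" "\<forall>n\<in>N. (n, s n) \<in> T"
      using loc[OF x] TE[OF FT[OF x]] FT[OF x] by meson
    have "F n = s n" if "n \<in> N" for n
      using uniq FT N(4) that openin_subset[OF N(1)] by blast
    then show "\<exists>N g. openin X N \<and> x \<in> N \<and> continuous_map (subtopology X N) E g \<and> (\<forall>n\<in>N. F n = g n)"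
      using N by blast
  qed
  moreover have "F x0 = e0" using uniq[OF FT[OF x0] base] .
  ultimately show thesis using that FT TE by blast
qed

text \<open>Near \<open>F x\<close> the image of \<open>F\<close> contains the set where \<open>F \<circ> s \<circ> p'\<close> agrees with the identity, \<open>s\<close> being the
  section of \<open>p\<close> through \<open>x\<close>.\<close>

lemma lift_between_coverings_open:
  assumes cov: "covering E B p" and cov': "covering E' B p'"
    and F: "continuous_map E E' F" "\<forall>x\<in>topspace E. p' (F x) = p x"
  shows "open_map E E' F"
  unfolding open_map_def
proof (intro allI impI)
  fix V assume V: "openin E V"
  show "openin E' (F ` V)"
  proof (subst openin_subopen, intro ballI)
    fix y assume "y \<in> F ` V"
    then obtain x where x: "x \<in> V" "y = F x" by blast
    have xE: "x \<in> topspace E" using x(1) openin_subset[OF V] by blast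
    have yE: "y \<in> topspace E'" using F(1) xE x(2) by (auto simp: continuous_map_def Pi_iff)
    have py: "p' y = p x" using F(2) xE x(2) by simp
    obtain U W s where *: "openin B U" "p x \<in> U" "openin E W" "x \<in> W"
        "homeomorphic_maps (subtopology E W) (subtopology B U) p s"
        "\<forall>z\<in>W. s (p z) = z" "W \<subseteq> {z \<in> topspace E. p z \<in> U}"
        "openin E ({z \<in> topspace E. p z \<in> U} - W)"
      by (rule covering_sheet_at[OF cov xE])
    have UB: "U \<subseteq> topspace B" using *(1) by (rule openin_subset)
    have sE: "continuous_map (subtopology B U) E s" and ps: "\<forall>y\<in>topspace (subtopology B U). p (s y) = y"
      using *(5) by (auto simp: homeomorphic_maps_def continuous_map_in_subtopology)
    have "openin (subtopology B U) {b \<in> topspace (subtopology B U). s b \<in> V}"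
      using sE V by (rule openin_continuous_map_preimage)
    then have U'o: "openin B {b \<in> topspace (subtopology B U). s b \<in> V}" (is "openin B ?U'")
      using *(1) by (rule openin_trans_full)
    have U': "b \<in> U" "s b \<in> V" "p (s b) = b" if "b \<in> ?U'" for b using that ps by auto
    define O' where "O' = {z \<in> topspace E'. p' z \<in> ?U'}"
    have O': "openin E' O'" unfolding O'_def using covering_continuous[OF cov'] U'o by (rule openin_continuous_map_preimage)
    have "continuous_map (subtopology E' O') (subtopology B U) p'"
      using covering_continuous[OF cov'] by (auto simp: continuous_map_in_subtopology continuous_map_from_subtopology O'_def)
    from continuous_map_compose[OF continuous_map_compose[OF this sE] F(1)]
    have c: "continuous_map (subtopology E' O') E' (F \<circ> (s \<circ> p'))" .
    have c2: "continuous_map (subtopology E' O') E' id" by (simp add: continuous_map_from_subtopology)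
    let ?A = "{z \<in> topspace (subtopology E' O'). (F \<circ> (s \<circ> p')) z = id z}"
    have "openin (subtopology E' O') ?A"
    proof (rule lifts_agree_clopen(1)[OF cov' c c2])
      fix z assume "z \<in> topspace (subtopology E' O')"
      then have "p' z \<in> ?U'" by (simp add: O'_def)
      then have "s (p' z) \<in> V" "p (s (p' z)) = p' z" by (rule U'(2), rule U'(3))
      then have "s (p' z) \<in> topspace E" "p (s (p' z)) = p' z" using openin_subset[OF V] by blast+
      then show "p' ((F \<circ> (s \<circ> p')) z) = p' (id z)" using F(2) by simp
    qed
    then have "openin E' ?A" using O' by (rule openin_trans_full)
    moreover have "y \<in> ?A"
      using x *(2,4,6) UB yE py by (auto simp: O'_def)
    moreover have "?A \<subseteq> F ` V"
    proof
      fix z assume z: "z \<in> ?A"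
      then have "p' z \<in> ?U'" by (simp add: O'_def)
      then have "s (p' z) \<in> V" by (rule U'(2))
      moreover have "z = F (s (p' z))" using z by simp
      ultimately show "z \<in> F ` V" by (rule rev_image_eqI)
    qed
    ultimately show "\<exists>T. openin E' T \<and> y \<in> T \<and> T \<subseteq> F ` V" by meson
  qed
qed

lemma covering_locally_path_connected:
  assumes cov: "covering E B p" and B: "locally_path_connected_space B"
  shows "locally_path_connected_space E"
  unfolding locally_path_connected_space
proof (intro allI impI)
  fix V x assume V: "openin E V \<and> x \<in> V"
  then have xE: "x \<in> topspace E" using openin_subset by blast
  obtain U W s where *: "openin B U" "p x \<in> U" "openin E W" "x \<in> W"
        "homeomorphic_maps (subtopology E W) (subtopology B U) p s"
        "\<forall>z\<in>W. s (p z) = z" "W \<subseteq> {z \<in> topspace E. p z \<in> U}"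
        "openin E ({z \<in> topspace E. p z \<in> U} - W)"
    by (rule covering_sheet_at[OF cov xE])
  have WE: "W \<subseteq> topspace E" and UB: "U \<subseteq> topspace B" using *(1,3) openin_subset by blast+
  have ps: "p (s y) = y" if "y \<in> U" for y
    using *(5) that UB by (auto simp: homeomorphic_maps_def)
  have sc: "continuous_map (subtopology B U) (subtopology E W) s"
    using *(5) by (auto simp: homeomorphic_maps_def)
  have sW: "s y \<in> W" if "y \<in> U" for y using sc that UB WE by (auto simp: continuous_map_def Pi_iff)
  have scE: "continuous_map (subtopology B U) E s" using sc by (simp add: continuous_map_in_subtopology)
  have "openin (subtopology B U) {y \<in> topspace (subtopology B U). s y \<in> V}"
    using V by (intro openin_continuous_map_preimage[OF scE]) simp
  then have o: "openin B {y \<in> topspace (subtopology B U). s y \<in> V}" using *(1) by (rule openin_trans_full)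
  have px: "p x \<in> {y \<in> topspace (subtopology B U). s y \<in> V}" using *(2,4,6) V UB by auto
  obtain N where N: "openin B N" "path_connectedin B N" "p x \<in> N" "N \<subseteq> {y \<in> topspace (subtopology B U). s y \<in> V}"
    using B o px unfolding locally_path_connected_space by meson
  have NU: "N \<subseteq> U" using N(4) by auto
  have im: "s ` N = {z \<in> topspace E. p z \<in> N} \<inter> W"
  proof (intro equalityI subsetI)
    fix z assume "z \<in> s ` N"
    then obtain y where y: "y \<in> N" "z = s y" by blast
    then have "y \<in> U" using NU by blast
    then show "z \<in> {z \<in> topspace E. p z \<in> N} \<inter> W" using y ps sW WE by auto
  next
    fix z assume "z \<in> {z \<in> topspace E. p z \<in> N} \<inter> W"
    then have "z = s (p z)" "p z \<in> N" using *(6) by auto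
    then show "z \<in> s ` N" by (rule image_eqI)
  qed
  show "\<exists>U. openin E U \<and> path_connectedin E U \<and> x \<in> U \<and> U \<subseteq> V"
  proof (intro exI[of _ "s ` N"] conjI)
    show "openin E (s ` N)"
      unfolding im using *(3) N(1) covering_continuous[OF cov] by (intro openin_Int openin_continuous_map_preimage)
    have "path_connectedin (subtopology B U) N" using N(2) NU by (simp add: path_connectedin_subtopology)
    then show "path_connectedin E (s ` N)" by (rule path_connectedin_continuous_map_image[OF scE])
    show "x \<in> s ` N" using * N(3) by force
    show "s ` N \<subseteq> V" using N(4) by auto
  qed
qed

section \<open>Coverings with a deck group\<close>

text \<open>The regular covers of the problem, over the exterior and over the manifold, differ in the group and in the way in
  which closed paths represent its elements.\<close>

locale deck_cover = group G for G :: "('g, 'm) monoid_scheme" (structure) +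
  fixes cls :: "(real \<Rightarrow> 'a) \<Rightarrow> 'g" and B :: "'a topology" and E :: "'b topology" and p act
  assumes regular_cover: "regular_cover G cls B E p act"
begin

lemma covering: "covering E B p"
  and path_connected: "path_connected_space E"
  and path_class: "\<lbrakk>g \<in> carrier G; pathin E \<gamma>; \<gamma> 1 = act g (\<gamma> 0)\<rbrakk> \<Longrightarrow> cls (p \<circ> \<gamma>) = g"
  using regular_cover unfolding regular_cover_def by auto

lemma p_surj: "p ` topspace E = topspace B"
  using covering by (simp add: covering_def)

lemma p_closed: "x \<in> topspace E \<Longrightarrow> p x \<in> topspace B"
  using p_surj by auto

lemma p_cont: "continuous_map E B p"
  using covering by (rule covering_continuous)

lemma act_homeo: "g \<in> carrier G \<Longrightarrow> homeomorphic_map E E (act g)"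
  and p_act: "\<lbrakk>g \<in> carrier G; x \<in> topspace E\<rbrakk> \<Longrightarrow> p (act g x) = p x"
  and act_one: "x \<in> topspace E \<Longrightarrow> act \<one> x = x"
  and act_mult: "\<lbrakk>g \<in> carrier G; h \<in> carrier G; x \<in> topspace E\<rbrakk> \<Longrightarrow> act (g \<otimes> h) x = act g (act h x)"
  using regular_cover unfolding regular_cover_def deck_action_def by auto

lemma act_cont: "g \<in> carrier G \<Longrightarrow> continuous_map E E (act g)"
  using act_homeo homeomorphic_imp_continuous_map by blast

lemma act_closed: "\<lbrakk>g \<in> carrier G; x \<in> topspace E\<rbrakk> \<Longrightarrow> act g x \<in> topspace E"
  using act_cont by (auto simp: continuous_map_def)

lemma act_ex1: "\<lbrakk>x \<in> topspace E; y \<in> topspace E; p x = p y\<rbrakk> \<Longrightarrow> \<exists>!g. g \<in> carrier G \<and> act g x = y"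
  using regular_cover unfolding regular_cover_def by auto

lemma act_trans:
  assumes "x \<in> topspace E" "y \<in> topspace E" "p x = p y"
  obtains g where "g \<in> carrier G" "act g x = y"
  using act_ex1[OF assms] by blast

lemma act_inj: "\<lbrakk>g \<in> carrier G; h \<in> carrier G; x \<in> topspace E; act g x = act h x\<rbrakk> \<Longrightarrow> g = h"
  using act_ex1[of x "act h x"] act_closed[of h x] p_act[of h x] by auto

lemma act_free: "\<lbrakk>g \<in> carrier G; x \<in> topspace E; act g x = x\<rbrakk> \<Longrightarrow> g = \<one>"
  using act_inj[of g \<one> x] act_one[of x] by simp

lemma act_inv: "\<lbrakk>g \<in> carrier G; x \<in> topspace E\<rbrakk> \<Longrightarrow> act (inv g) (act g x) = x"
  using act_mult[of "inv g" g x] act_one[of x] by simp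

text \<open>The projection is injective on a sheet, so distinct translates of a sheet are disjoint.\<close>

lemma translates_of_sheet_disjoint:
  assumes "g \<in> carrier G" "h \<in> carrier G" "V \<subseteq> topspace E" "\<forall>z\<in>V. s (p z) = z"
    and "v \<in> V" "w \<in> V" "act g v = act h w"
  shows "g = h"
proof -
  have "p v = p w" using assms p_act[of g v] p_act[of h w] by (metis subsetD)
  then have "v = w" using assms(4-6) by metis
  then show ?thesis using act_inj[of g h v] assms by blast
qed

text \<open>Cover the base by finitely many open sets \<open>W x\<close> with closures in evenly covered sets.  Their copies in chosen
  sheets have a compact union, which meets only finitely many of its translates.  Let \<open>S\<close> be the set of these
  translations.  The translates of the copies by the subgroup generated by \<open>S\<close>, and those by its complement,
  are disjoint open sets that cover \<open>E\<close>; so the complement is empty.\<close>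

lemma finitely_generated:
  assumes "compact_space B" "Hausdorff_space B" "topspace B \<noteq> {}"
  shows "\<exists>S. finite S \<and> S \<subseteq> carrier G \<and> generate G S = carrier G"
proof -
  have reg: "neighbourhood_base_of (closedin B) B"
    using assms compact_Hausdorff_or_regular_imp_normal_space compact_Hausdorff_imp_regular_space
    by (simp add: neighbourhood_base_of_closedin)
  \<comment> \<open>\<open>V\<close> is a sheet through \<open>x\<close> over \<open>U\<close> with section \<open>s\<close>, and \<open>W \<subseteq> C \<subseteq> U\<close> is a smaller neighbourhood with a closed set in between\<close>
  define good where "good x U V s W C \<longleftrightarrow> openin B U \<and> openin E V \<and> x \<in> V \<and> continuous_map (subtopology B U) E s \<and> s ` U \<subseteq> V \<and> 
      (\<forall>z\<in>V. s (p z) = z) \<and> (\<forall>y\<in>U. p (s y) = y) \<and> V \<subseteq> {z \<in> topspace E. p z \<in> U} \<and> openin B W \<and> closedin B C \<and> p x \<in> W \<and> W \<subseteq> C \<and> C \<subseteq> U"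
    for x U V s W C
  have "\<forall>x\<in>topspace E. \<exists>U V s W C. good x U V s W C"
  proof
    fix x assume x: "x \<in> topspace E"
    obtain U V s where *: "openin B U" "p x \<in> U" "openin E V" "x \<in> V"
        "homeomorphic_maps (subtopology E V) (subtopology B U) p s"
        "\<forall>z\<in>V. s (p z) = z" "V \<subseteq> {z \<in> topspace E. p z \<in> U}"
        "openin E ({z \<in> topspace E. p z \<in> U} - V)"
      by (rule covering_sheet_at[OF covering x])
    obtain W C where WC: "openin B W" "closedin B C" "p x \<in> W" "W \<subseteq> C" "C \<subseteq> U"
      using reg *(1,2) unfolding neighbourhood_base_of by meson
    have c: "continuous_map (subtopology B U) (subtopology E V) s" and ps: "\<forall>y\<in>topspace (subtopology B U). p (s y) = y"
      using *(5) by (auto simp: homeomorphic_maps_def)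
    have t: "topspace (subtopology B U) = U" using openin_subset[OF *(1)] by auto
    have "s ` U \<subseteq> V" using c t by (auto simp: continuous_map_def Pi_iff)
    then have "good x U V s W C"
      unfolding good_def
      using * WC c ps t continuous_map_in_subtopology[of "subtopology B U" E V s]
      by simp
    then show "\<exists>U V s W C. good x U V s W C" by blast
  qed
  then obtain U V s W C where good: "\<And>x. x \<in> topspace E \<Longrightarrow> good x (U x) (V x) (s x) (W x) (C x)"
    by metis
  have *: "openin B (U x) \<and> openin E (V x) \<and> x \<in> V x
      \<and> continuous_map (subtopology B (U x)) E (s x) \<and> s x ` U x \<subseteq> V x \<and> (\<forall>z\<in>V x. s x (p z) = z) \<and> (\<forall>y\<in>U x. p (s x y) = y) \<and> V x \<subseteq> {z \<in> topspace E. p z \<in> U x}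
      \<and> openin B (W x) \<and> closedin B (C x) \<and> p x \<in> W x \<and> W x \<subseteq> C x \<and> C x \<subseteq> U x" if "x \<in> topspace E" for x
    using good[OF that] unfolding good_def .
  have Vo: "openin E (V x)" and xV: "x \<in> V x" and sc: "continuous_map (subtopology B (U x)) E (s x)"
    and Wo: "openin B (W x)" and Cc: "closedin B (C x)" and pW: "p x \<in> W x" and WC: "W x \<subseteq> C x" and CU: "C x \<subseteq> U x"
    and sp: "\<forall>z\<in>V x. s x (p z) = z"
    if "x \<in> topspace E" for x
    using *[OF that] by auto
  have sV: "s x y \<in> V x" and ps: "p (s x y) = y" if "x \<in> topspace E" "y \<in> U x" for x y
    using *[OF that(1)] that(2) by auto
  have VE: "V x \<subseteq> topspace E" if "x \<in> topspace E" for x using Vo[OF that] by (rule openin_subset)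
  have cover: "topspace B \<subseteq> \<Union>(W ` topspace E)"
    unfolding p_surj[symmetric] using pW by blast
  obtain D where D: "finite D" "D \<subseteq> topspace E" "topspace B \<subseteq> \<Union>(W ` D)"
  proof -
    obtain \<F> where "finite \<F>" "\<F> \<subseteq> W ` topspace E" "topspace B \<subseteq> \<Union>\<F>"
      using assms(1)[unfolded compact_space_alt, rule_format, of "W ` topspace E"] cover Wo by blast
    then show thesis using that by (metis finite_subset_image)
  qed
  define K where "K x = s x ` C x" for x
  have K: "K x \<subseteq> V x" "\<And>z. z \<in> K x \<Longrightarrow> p z \<in> C x" if "x \<in> D" for x
  proof -
    have xE: "x \<in> topspace E" using that D(2) by auto
    show "K x \<subseteq> V x" using sV[OF xE] CU[OF xE] unfolding K_def by blast
    show "p z \<in> C x" if "z \<in> K x" for z using ps[OF xE] CU[OF xE] that unfolding K_def by (metis imageE subsetD)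
  qed
  have comK: "compactin E (K x)" if "x \<in> D" for x
  proof -
    have xE: "x \<in> topspace E" using that D(2) by auto
    have "compactin B (C x)" using Cc[OF xE] assms(1) by (simp add: closedin_compact_space)
    then have "compactin (subtopology B (U x)) (C x)" using CU[OF xE] by (simp add: compactin_subtopology)
    then show ?thesis unfolding K_def using sc[OF xE] by (rule image_compactin)
  qed
  \<comment> \<open>each point has a neighbourhood that meets finitely many translates of the compact copies: for every \<open>x\<close> take either the sheet through \<open>z\<close> or the complement of the preimage of \<open>C x\<close>\<close>
  have nbhd: "\<exists>O'. openin E O' \<and> z \<in> O' \<and> finite {g \<in> carrier G. \<exists>x\<in>D. act g ` K x \<inter> O' \<noteq> {}}" 
    if z: "z \<in> topspace E" for z
  proof -
    have "\<exists>O'. openin E O' \<and> z \<in> O' \<and> (\<exists>g0. {g \<in> carrier G. act g ` K x \<inter> O' \<noteq> {}} \<subseteq> {g0})" if x: "x \<in> D" for x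
    proof (cases "p z \<in> C x")
      case True
      have xE: "x \<in> topspace E" using x D(2) by auto
      have "p z \<in> U x" using True CU[OF xE] by blast
      then have "s x (p z) \<in> V x" "p (s x (p z)) = p z" using sV[OF xE] ps[OF xE] by auto
      then obtain g0 where g0: "g0 \<in> carrier G" "act g0 (s x (p z)) = z"
        using act_trans[of "s x (p z)" z] VE[OF xE] z by blast
      have "openin E (act g0 ` V x)" using homeomorphic_map_openness_eq[OF act_homeo[OF g0(1)]] Vo[OF xE] VE[OF xE] by blast
      moreover have "z \<in> act g0 ` V x" using g0 \<open>s x (p z) \<in> V x\<close> by force
      moreover have "{g \<in> carrier G. act g ` K x \<inter> act g0 ` V x \<noteq> {}} \<subseteq> {g0}"
      proof
        fix g assume "g \<in> {g \<in> carrier G. act g ` K x \<inter> act g0 ` V x \<noteq> {}}"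
        then obtain k v where g: "g \<in> carrier G" and k: "k \<in> K x" "v \<in> V x" "act g k = act g0 v" by blast
        show "g \<in> {g0}" 
          using translates_of_sheet_disjoint[OF g g0(1) VE[OF xE] sp[OF xE], of k v] K(1)[OF x] k by blast
      qed
      ultimately show ?thesis by blast
    next
      case False
      have xE: "x \<in> topspace E" using x D(2) by auto
      let ?O = "{y \<in> topspace E. p y \<in> topspace B - C x}"
      have "openin E ?O" using Cc[OF xE] by (intro openin_continuous_map_preimage[OF p_cont]) auto
      moreover have "z \<in> ?O" using z False p_closed by auto
      moreover have "{g \<in> carrier G. act g ` K x \<inter> ?O \<noteq> {}} \<subseteq> {\<one>}"
      proof -
        have "act g k \<notin> ?O" if "g \<in> carrier G" "k \<in> K x" for g k
          using K[OF x] VE[OF xE] p_act[of g k] that by auto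
        then show ?thesis by blast
      qed
      ultimately show ?thesis by (intro exI[of _ ?O] conjI exI[of _ "\<one>"])
    qed
    then have "\<forall>x\<in>D. \<exists>O'. openin E O' \<and> z \<in> O' \<and> (\<exists>g0. {g \<in> carrier G. act g ` K x \<inter> O' \<noteq> {}} \<subseteq> {g0})"
      by (rule ballI)
    from bchoice[OF this] obtain O' where O'all:
      "\<forall>x\<in>D. openin E (O' x) \<and> z \<in> O' x \<and> (\<exists>g0. {g \<in> carrier G. act g ` K x \<inter> O' x \<noteq> {}} \<subseteq> {g0})"
      by (rule exE)
    have O'1: "openin E (O' x)" "z \<in> O' x" and O'2: "\<exists>g0. {g \<in> carrier G. act g ` K x \<inter> O' x \<noteq> {}} \<subseteq> {g0}"
      if "x \<in> D" for x
      by (rule bspec[OF O'all that, THEN conjunct1] bspec[OF O'all that, THEN conjunct2, THEN conjunct1]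
          bspec[OF O'all that, THEN conjunct2, THEN conjunct2])+
    have "\<forall>x\<in>D. \<exists>g0. {g \<in> carrier G. act g ` K x \<inter> O' x \<noteq> {}} \<subseteq> {g0}"
      by (rule ballI) (rule O'2)
    from bchoice[OF this] obtain g0 where g0:
      "\<forall>x\<in>D. {g \<in> carrier G. act g ` K x \<inter> O' x \<noteq> {}} \<subseteq> {g0 x}"
      by (rule exE)
    note O' = O'1 bspec[OF g0]
    let ?O = "topspace E \<inter> \<Inter>(O' ` D)"
    have "openin E ?O" using O'(1) D(1) 
      by (cases "D = {}") (auto intro!: openin_Int openin_Inter)
    moreover have "z \<in> ?O" using O' z by auto
    moreover have "finite {g \<in> carrier G. \<exists>x\<in>D. act g ` K x \<inter> ?O \<noteq> {}}"
    proof (rule finite_subset[OF _ finite_imageI[OF D(1)]])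
    show "{g \<in> carrier G. \<exists>x\<in>D. act g ` K x \<inter> ?O \<noteq> {}} \<subseteq> g0 ` D"
    proof
      fix g assume "g \<in> {g \<in> carrier G. \<exists>x\<in>D. act g ` K x \<inter> ?O \<noteq> {}}"
      then obtain x k where "g \<in> carrier G" "x \<in> D" "k \<in> K x" "act g k \<in> \<Inter>(O' ` D)" by blast
      then have "g \<in> {g \<in> carrier G. act g ` K x \<inter> O' x \<noteq> {}}" by blast
      then show "g \<in> g0 ` D" using O'(3)[OF \<open>x \<in> D\<close>] \<open>x \<in> D\<close> by blast
    qed
    qed
    ultimately show ?thesis by (intro exI[of _ ?O] conjI)
  qed
  define S where "S = {g \<in> carrier G. \<exists>x\<in>D. \<exists>x'\<in>D. act g ` K x \<inter> K x' \<noteq> {}}"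
  have "finite S"
  proof -
    from bchoice[OF ballI[OF nbhd]] obtain O' where O'all:
      "\<forall>z\<in>topspace E. openin E (O' z) \<and> z \<in> O' z \<and> finite {g \<in> carrier G. \<exists>x\<in>D. act g ` K x \<inter> O' z \<noteq> {}}"
      by (rule exE)
    have O': "openin E (O' z)" "z \<in> O' z" "finite {g \<in> carrier G. \<exists>x\<in>D. act g ` K x \<inter> O' z \<noteq> {}}"
      if "z \<in> topspace E" for z
      by (rule bspec[OF O'all that, THEN conjunct1] bspec[OF O'all that, THEN conjunct2, THEN conjunct1]
          bspec[OF O'all that, THEN conjunct2, THEN conjunct2])+
    have "compactin E (\<Union>(K ` D))" using D(1) comK by (intro compactin_Union) auto
    moreover have "\<Union>(K ` D) \<subseteq> \<Union>(O' ` topspace E)"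
    proof
      fix z assume "z \<in> \<Union>(K ` D)"
      then have "z \<in> topspace E" using K(1) VE D(2) by blast
      then show "z \<in> \<Union>(O' ` topspace E)" using O'(2) by blast
    qed
    ultimately obtain \<F> where "finite \<F>" "\<F> \<subseteq> O' ` topspace E" "\<Union>(K ` D) \<subseteq> \<Union>\<F>"
      using O'(1) unfolding compactin_def by (smt (verit, best) imageE)
    then obtain Z where Z: "finite Z" "Z \<subseteq> topspace E" "\<Union>(K ` D) \<subseteq> \<Union>(O' ` Z)"
      by (metis finite_subset_image)
    have "S \<subseteq> (\<Union>z\<in>Z. {g \<in> carrier G. \<exists>x\<in>D. act g ` K x \<inter> O' z \<noteq> {}})"
    proof
      fix g assume "g \<in> S"
      then obtain x x' y where *: "g \<in> carrier G" "x \<in> D" "x' \<in> D" "y \<in> act g ` K x" "y \<in> K x'" by (auto simp: S_def)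
      then obtain z where "z \<in> Z" "y \<in> O' z" using Z(3) by blast
      then show "g \<in> (\<Union>z\<in>Z. {g \<in> carrier G. \<exists>x\<in>D. act g ` K x \<inter> O' z \<noteq> {}})" using * by blast
    qed
    moreover have "finite (\<Union>z\<in>Z. {g \<in> carrier G. \<exists>x\<in>D. act g ` K x \<inter> O' z \<noteq> {}})"
      using Z O'(3) by (intro finite_UN_I) auto
    ultimately show ?thesis by (rule finite_subset)
  qed
  moreover have Sc: "S \<subseteq> carrier G" by (auto simp: S_def)
  moreover have "generate G S = carrier G"
  proof (rule ccontr)
    assume neq: "generate G S \<noteq> carrier G"
    have H: "subgroup (generate G S) G" using generate_is_subgroup[OF Sc] .
    then obtain g0 where g0: "g0 \<in> carrier G - generate G S" using neq subgroup.subset by blast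
    \<comment> \<open>the open copies of the sets \<open>W x\<close> in the chosen sheets, and the union \<open>T H\<close> of their translates\<close>
    define W' where "W' x = {z \<in> V x. p z \<in> W x}" for x
    have W'o: "openin E (W' x)" if "x \<in> D" for x
    proof -
      have "openin E {z \<in> topspace E. p z \<in> W x}"
        using Wo D(2) that by (intro openin_continuous_map_preimage[OF p_cont]) auto
      then have "openin E (V x \<inter> {z \<in> topspace E. p z \<in> W x})" using Vo D(2) that by blast
      moreover have "V x \<inter> {z \<in> topspace E. p z \<in> W x} = W' x" using VE D(2) that by (auto simp: W'_def)
      ultimately show ?thesis by simp
    qed
    have W'K: "W' x \<subseteq> K x" if "x \<in> D" for x
    proof
      fix z assume "z \<in> W' x"
      then have z: "z \<in> V x" "p z \<in> C x" using WC[of x] D(2) that by (auto simp: W'_def)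
      then have "z = s x (p z)" using sp[of x] D(2) that by auto
      then show "z \<in> K x" using z(2) unfolding K_def by (rule image_eqI)
    qed
    define T where "T H = (\<Union>g\<in>H. \<Union>x\<in>D. act g ` W' x)" for H
    have W'E: "W' x \<subseteq> topspace E" if "x \<in> D" for x using W'o[OF that] by (rule openin_subset)
    have aW: "openin E (act g ` W' x)" if "g \<in> carrier G" "x \<in> D" for g x
      using homeomorphic_map_openness_eq[OF act_homeo[OF that(1)]] W'o[OF that(2)] W'E[OF that(2)] by blast
    have To: "openin E (T H)" if "H \<subseteq> carrier G" for H
      unfolding T_def using aW that by blast
    have "topspace E \<subseteq> T (generate G S) \<union> T (carrier G - generate G S)"
    proof
      fix z assume z: "z \<in> topspace E"
      then obtain x where x: "x \<in> D" "p z \<in> W x" using D(3) p_closed by blast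
      have xE: "x \<in> topspace E" using x D(2) by auto
      have "p z \<in> U x" using x WC[OF xE] CU[OF xE] by blast
      then have sx: "s x (p z) \<in> V x" "p (s x (p z)) = p z" using sV[OF xE] ps[OF xE] by auto
      then obtain g where g: "g \<in> carrier G" "act g (s x (p z)) = z"
        using act_trans[of "s x (p z)" z] VE[OF xE] z by blast
      have "s x (p z) \<in> W' x" using sx x by (simp add: W'_def)
      then have "z \<in> act g ` W' x" using g by force
      then show "z \<in> T (generate G S) \<union> T (carrier G - generate G S)"
        using g x unfolding T_def by blast
    qed
    moreover have "T (generate G S) \<inter> T (carrier G - generate G S) = {}"
    proof (rule ccontr)
      assume "T (generate G S) \<inter> T (carrier G - generate G S) \<noteq> {}"
      then obtain h g x x' w w' where h: "h \<in> generate G S" "g \<in> carrier G" "g \<notin> generate G S" "x \<in> D" "x' \<in> D"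
          "w \<in> W' x" "w' \<in> W' x'" "act h w = act g w'"
        unfolding T_def by blast
      have hc: "h \<in> carrier G" using h(1) H subgroup.subset by blast
      have wE: "w \<in> topspace E" "w' \<in> topspace E" using W'E h by auto
      have "act (inv h \<otimes> g) w' = act (inv h) (act h w)"
        using act_mult[of "inv h" g w'] hc h wE by simp
      also have "\<dots> = w" using act_inv hc wE by simp
      finally have e: "w = act (inv h \<otimes> g) w'" by (rule sym)
      have "w \<in> act (inv h \<otimes> g) ` K x'" using W'K[OF h(5)] h(7)
        by (intro image_eqI[where x = w'] e) blast
      then have "w \<in> act (inv h \<otimes> g) ` K x' \<inter> K x" using W'K[OF h(4)] h(6) by blast
      then have "inv h \<otimes> g \<in> S"
        using h(2,4,5) hc unfolding S_def by blast
      then have "inv h \<otimes> g \<in> generate G S" by (rule generate.incl)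
      then have "h \<otimes> (inv h \<otimes> g) \<in> generate G S" using h(1) by (simp add: generate.eng)
      moreover have "h \<otimes> (inv h \<otimes> g) = g" using hc h(2) by (simp add: m_assoc[symmetric])
      ultimately show False using h(3) by simp
    qed
    moreover have ne: "T H \<noteq> {}" if "g \<in> H" for g H
    proof -
      obtain x where x: "x \<in> D" using D(3) assms(3) by blast
      then have "x \<in> W' x" using xV[of x] pW[of x] D(2) unfolding W'_def by blast
      then show ?thesis using x that unfolding T_def by blast
    qed
    ultimately have "\<exists>E1 E2. openin E E1 \<and> openin E E2 \<and> topspace E \<subseteq> E1 \<union> E2 \<and> E1 \<inter> E2 = {} \<and> E1 \<noteq> {} \<and> E2 \<noteq> {}"
      by (intro exI[of _ "T (generate G S)"] exI[of _ "T (carrier G - generate G S)"] conjI To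
          generate_incl[OF Sc] Diff_subset ne[OF generate.one] ne[OF g0])
    then show False
      using path_connected_imp_connected_space[OF path_connected] by (simp add: connected_space_def)
  qed
  ultimately show ?thesis by blast
qed

end

section \<open>Cells and local path-connectedness\<close>

lemma convex_locally_path_connected_space:
  fixes S :: "'a::real_normed_vector set"
  assumes "convex S"
  shows "locally_path_connected_space (top_of_set S)"
  unfolding locally_path_connected_space
proof (intro allI impI)
  fix V x assume V: "openin (top_of_set S) V \<and> x \<in> V"
  then obtain e where e: "e > 0" "ball x e \<inter> S \<subseteq> V" and xS: "x \<in> S"
    by (metis openin_contains_ball openin_imp_subset subsetD)
  show "\<exists>U. openin (top_of_set S) U \<and> path_connectedin (top_of_set S) U \<and> x \<in> U \<and> U \<subseteq> V"
  proof (intro exI[of _ "S \<inter> ball x e"] conjI)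
    show "openin (top_of_set S) (S \<inter> ball x e)" by (simp add: openin_open_Int)
    show "path_connectedin (top_of_set S) (S \<inter> ball x e)"
      using assms by (simp add: path_connectedin_subtopology convex_Int convex_imp_path_connected)
  qed (use e xS in auto)
qed

text \<open>The space is a quotient of the disjoint union of the compact spaces \<open>K i\<close>.\<close>

lemma locally_path_connected_finite_union:
  assumes fin: "finite I" and f: "\<And>i. i \<in> I \<Longrightarrow> continuous_map (K i) X (f i)"
    and K: "\<And>i. i \<in> I \<Longrightarrow> compact_space (K i)" "\<And>i. i \<in> I \<Longrightarrow> locally_path_connected_space (K i)"
    and X: "Hausdorff_space X" "topspace X = (\<Union>i\<in>I. f i ` topspace (K i))"
  shows "locally_path_connected_space X"
proof (rule locally_path_connected_space_quotient_map_image)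
  show "locally_path_connected_space (sum_topology K I)"
    using K(2) by (simp add: locally_path_connected_space_sum_topology)
  show "quotient_map (sum_topology K I) X (\<lambda>(i, x). f i x)"
    unfolding quotient_map_closedin
  proof (intro conjI allI impI)
    show "(\<lambda>(i, x). f i x) ` topspace (sum_topology K I) = topspace X"
      using X(2) by force
    fix U assume U: "U \<subseteq> topspace X"
    have pre: "{x. (i, x) \<in> {x \<in> topspace (sum_topology K I). (case x of (i, x) \<Rightarrow> f i x) \<in> U}} = {x \<in> topspace (K i). f i x \<in> U}"
      if "i \<in> I" for i using that by auto
    have *: "closedin (sum_topology K I) {x \<in> topspace (sum_topology K I). (case x of (i, x) \<Rightarrow> f i x) \<in> U}
        \<longleftrightarrow> (\<forall>i\<in>I. closedin (K i) {x \<in> topspace (K i). f i x \<in> U})"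
      unfolding closedin_sum_topology using pre by auto
    show "closedin (sum_topology K I) {x \<in> topspace (sum_topology K I). (case x of (i, x) \<Rightarrow> f i x) \<in> U} = closedin X U"
      unfolding *
    proof
      assume c: "\<forall>i\<in>I. closedin (K i) {x \<in> topspace (K i). f i x \<in> U}"
      have "closedin X (f i ` {x \<in> topspace (K i). f i x \<in> U})" if i: "i \<in> I" for i
      proof (rule compactin_imp_closedin[OF X(1)])
        have "compactin (K i) {x \<in> topspace (K i). f i x \<in> U}"
          using c i K(1)[OF i] by (simp add: closedin_compact_space)
        then show "compactin X (f i ` {x \<in> topspace (K i). f i x \<in> U})" using f[OF i] by (rule image_compactin)
      qed
      then have "closedin X (\<Union>i\<in>I. f i ` {x \<in> topspace (K i). f i x \<in> U})"
        using fin by (intro closedin_Union) auto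
      moreover have "(\<Union>i\<in>I. f i ` {x \<in> topspace (K i). f i x \<in> U}) = U"
      proof (intro equalityI subsetI)
        fix u assume "u \<in> U"
        then have "u \<in> (\<Union>i\<in>I. f i ` topspace (K i))" using U X(2) by (metis subsetD)
        then obtain i x where "i \<in> I" "x \<in> topspace (K i)" "u = f i x" by auto
        then show "u \<in> (\<Union>i\<in>I. f i ` {x \<in> topspace (K i). f i x \<in> U})" using \<open>u \<in> U\<close> by auto
      qed auto
      ultimately show "closedin X U" by simp
    next
      assume "closedin X U"
      then show "\<forall>i\<in>I. closedin (K i) {x \<in> topspace (K i). f i x \<in> U}"
        using f closedin_continuous_map_preimage by blast
    qed
  qed
qed

definition sqnorm :: "nat \<Rightarrow> (nat \<Rightarrow> real) \<Rightarrow> real" where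
  "sqnorm n x = (\<Sum>j<n. (x j)\<^sup>2)"

lemma sqnorm_scale: "sqnorm n (\<lambda>i. t * x i) = t\<^sup>2 * sqnorm n x"
  by (simp add: sqnorm_def power_mult_distrib sum_distrib_left)

lemma sqnorm_nonneg: "0 \<le> sqnorm n x"
  by (simp add: sqnorm_def sum_nonneg)

lemma coord_cont: "continuous_map (Euclidean_space n) euclideanreal (\<lambda>x. x i)"
  unfolding Euclidean_space_def by (intro continuous_map_from_subtopology continuous_map_product_projection) simp

lemma sqnorm_cont: "continuous_map (Euclidean_space n) euclideanreal (sqnorm n)"
  unfolding sqnorm_def by (intro continuous_map_sum continuous_map_real_pow coord_cont) auto

lemma closed_cell_alt: "closed_cell n = subtopology (Euclidean_space n) {x. sqnorm n x \<le> 1}"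
  by (simp add: closed_cell_def sqnorm_def)

lemma topspace_closed_cell: "topspace (closed_cell n) = {x. (\<forall>i\<ge>n. x i = 0) \<and> sqnorm n x \<le> 1}"
  by (auto simp: closed_cell_alt topspace_Euclidean_space)

lemma scale_Euclidean_cont:
  assumes "continuous_map X euclideanreal t" "continuous_map X (Euclidean_space n) f"
  shows "continuous_map X (Euclidean_space n) (\<lambda>x i. t x * f x i)"
proof -
  have "continuous_map X (Euclidean_space n) (\<lambda>x i. if i < n then t x * f x i else 0)"
    unfolding continuous_map_componentwise_Euclidean_space
    using assms continuous_map_compose[OF assms(2) coord_cont]
    by (auto simp: o_def intro!: continuous_map_real_mult)
  moreover have "(if i < n then t x * f x i else 0) = t x * f x i" if "x \<in> topspace X" for x i
  proof -
    have "f x \<in> topspace (Euclidean_space n)" using assms(2) that by (auto simp: continuous_map_def)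
    then show ?thesis by (auto simp: topspace_Euclidean_space)
  qed
  ultimately show ?thesis by (auto intro: continuous_map_eq)
qed

lemma closed_cell_compact: "compact_space (closed_cell n)"
proof -
  have "compactin (powertop_real UNIV) {x. (\<forall>i\<ge>n. x i = 0) \<and> sqnorm n x \<le> 1}"
  proof (rule closed_compactin)
    show "compactin (powertop_real UNIV) (UNIV \<rightarrow>\<^sub>E {-1..1::real})"
      by (simp add: compactin_PiE)
    show "{x. (\<forall>i\<ge>n. x i = 0) \<and> sqnorm n x \<le> 1} \<subseteq> UNIV \<rightarrow>\<^sub>E {-1..1}"
    proof
      fix x assume x: "x \<in> {x. (\<forall>i\<ge>n. x i = 0) \<and> sqnorm n x \<le> 1}"
      have "x i \<in> {-1..1}" for i
      proof (cases "i < n")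
        case True
        have "(x i)\<^sup>2 \<le> sqnorm n x"
          unfolding sqnorm_def using True by (intro member_le_sum) auto
        then have "(x i)\<^sup>2 \<le> 1" using x by auto
        then show ?thesis by (simp add: abs_square_le_1 abs_le_iff)
      next
        case False
        then show ?thesis using x by auto
      qed
      then show "x \<in> UNIV \<rightarrow>\<^sub>E {-1..1}" by auto
    qed
    have "closedin (Euclidean_space n) {x \<in> topspace (Euclidean_space n). sqnorm n x \<in> {..1}}"
      by (rule closedin_continuous_map_preimage[OF sqnorm_cont]) simp
    then have "closedin (Euclidean_space n) {x. (\<forall>i\<ge>n. x i = 0) \<and> sqnorm n x \<le> 1}"
      by (simp add: topspace_Euclidean_space)
    then show "closedin (powertop_real UNIV) {x. (\<forall>i\<ge>n. x i = 0) \<and> sqnorm n x \<le> 1}"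
      unfolding euclidean_product_topology closed_closedin[symmetric] by (rule closedin_Euclidean_imp_closed)
  qed
  then show ?thesis
    unfolding closed_cell_alt Euclidean_space_def subtopology_subtopology
    by (simp add: compact_space_subtopology Collect_conj_eq)
qed

text \<open>The ball is a retract of Euclidean space by radial projection.\<close>

lemma closed_cell_locally_path_connected: "locally_path_connected_space (closed_cell n)"
proof (rule locally_path_connected_space_retraction_map_image[OF _ locally_path_connected_Euclidean_space])
  let ?r = "\<lambda>x i. inverse (max 1 (sqrt (sqnorm n x))) * x i"
  have c: "continuous_map (Euclidean_space n) euclideanreal (\<lambda>x. inverse (max 1 (sqrt (sqnorm n x))))"
    using sqnorm_cont[of n] by (auto intro!: continuous_map_real_inverse continuous_map_real_max continuous_map_sqrt)
  have "sqnorm n (?r x) \<le> 1" for x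
  proof -
    let ?m = "max 1 (sqrt (sqnorm n x))"
    have m: "?m > 0" by simp
    have "sqnorm n x \<le> ?m\<^sup>2" using sqnorm_nonneg[of n x]
      by (metis max.cobounded2 real_sqrt_ge_zero real_sqrt_pow2 power_mono)
    then have "(inverse ?m)\<^sup>2 * sqnorm n x \<le> (inverse ?m)\<^sup>2 * ?m\<^sup>2" by (intro mult_left_mono) auto
    also have "\<dots> = 1" using m by (simp add: power_mult_distrib[symmetric])
    finally show ?thesis by (simp only: sqnorm_scale)
  qed
  then have "continuous_map (Euclidean_space n) (closed_cell n) ?r"
    unfolding closed_cell_alt continuous_map_in_subtopology
    using scale_Euclidean_cont[OF c continuous_map_id[unfolded id_def]] by auto
  moreover have "continuous_map (closed_cell n) (Euclidean_space n) id"
    by (simp add: closed_cell_alt continuous_map_from_subtopology)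
  moreover have "?r x = x" if "x \<in> topspace (closed_cell n)" for x
  proof -
    have "sqrt (sqnorm n x) \<le> 1" using that by (simp add: topspace_closed_cell)
    then show ?thesis by (simp add: max_absorb1)
  qed
  ultimately show "retraction_map (Euclidean_space n) (closed_cell n) ?r"
    unfolding retraction_map_def retraction_maps_def by (metis id_apply)
qed

abbreviation open_cell :: "nat \<Rightarrow> (nat \<Rightarrow> real) topology" where
  "open_cell n \<equiv> subtopology (closed_cell n) {x. (\<Sum>j<n. (x j)\<^sup>2) < 1}"

lemma open_cell_alt: "open_cell n = subtopology (Euclidean_space n) {x. sqnorm n x < 1}"
proof -
  have "{x. sqnorm n x \<le> 1} \<inter> {x. sqnorm n x < 1} = {x. sqnorm n x < 1}" by auto
  then show ?thesis
    by (simp add: closed_cell_alt sqnorm_def[symmetric] subtopology_subtopology)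
qed

lemma open_cell_locally_path_connected: "locally_path_connected_space (open_cell n)"
proof -
  have "openin (Euclidean_space n) {x \<in> topspace (Euclidean_space n). sqnorm n x \<in> {..<1}}"
    by (rule openin_continuous_map_preimage[OF sqnorm_cont]) simp
  from locally_path_connected_space_open_subset[OF locally_path_connected_Euclidean_space this]
  have "locally_path_connected_space (subtopology (Euclidean_space n) (topspace (Euclidean_space n) \<inter> {x. sqnorm n x < 1}))"
    by (simp add: Collect_conj_eq)
  then show ?thesis unfolding open_cell_alt by (simp only: subtopology_restrict)
qed

lemma open_cell_contractible: "contractible_space (open_cell n)"
  unfolding contractible_space_def homotopic_with_def
proof (intro exI conjI allI ballI)
  let ?I = "top_of_set {0..1::real}" and ?X = "open_cell n"
  let ?h = "\<lambda>c::real \<times> (nat \<Rightarrow> real). \<lambda>i. (1 - fst c) * snd c i"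
  have "continuous_map (prod_topology ?I ?X) euclideanreal (\<lambda>c. fst c)"
    using continuous_map_fst[of ?I ?X] by (simp add: continuous_map_in_subtopology)
  then have t: "continuous_map (prod_topology ?I ?X) euclideanreal (\<lambda>c. 1 - fst c)"
    by (intro continuous_map_diff) auto
  have "continuous_map (prod_topology ?I ?X) (Euclidean_space n) snd"
    using continuous_map_snd[of ?I ?X] by (simp add: open_cell_alt continuous_map_in_subtopology)
  from scale_Euclidean_cont[OF t this]
  have "continuous_map (prod_topology ?I ?X) (Euclidean_space n) ?h" .
  moreover have "sqnorm n (?h c) < 1" if "c \<in> topspace (prod_topology ?I ?X)" for c
  proof -
    have 1: "0 \<le> fst c" "fst c \<le> 1" "sqnorm n (snd c) < 1" using that by (auto simp: open_cell_alt)
    then have "(1 - fst c)\<^sup>2 * sqnorm n (snd c) \<le> 1 * sqnorm n (snd c)"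
      by (intro mult_right_mono sqnorm_nonneg) (simp add: power_le_one)
    then show ?thesis using 1 by (simp add: sqnorm_scale)
  qed
  ultimately show "continuous_map (prod_topology ?I ?X) ?X ?h"
    unfolding open_cell_alt continuous_map_in_subtopology by auto
  show "?h (0, x) = id x" for x by simp
  show "?h (1, x) = (\<lambda>i. 0)" for x by simp
qed auto

text \<open>The boundary points of the ball are limits of interior points along radii.\<close>

lemma closed_cell_into_closed:
  assumes Phi: "continuous_map (closed_cell n) M \<Phi>" and T: "closedin M T"
    and int: "\<And>x. x \<in> topspace (open_cell n) \<Longrightarrow> \<Phi> x \<in> T" and x: "x \<in> topspace (closed_cell n)"
  shows "\<Phi> x \<in> T"
proof -
  let ?I = "top_of_set {0..1::real}"
  define r where "r t = (\<lambda>i. t * x i)" for t :: real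
  have xE: "x \<in> topspace (Euclidean_space n)" using x by (simp add: closed_cell_alt)
  have c: "continuous_map ?I (Euclidean_space n) r"
    unfolding r_def using xE by (intro scale_Euclidean_cont) (auto intro: continuous_intros)
  have sq: "sqnorm n (r t) = t\<^sup>2 * sqnorm n x" for t unfolding r_def by (rule sqnorm_scale)
  have x1: "sqnorm n x \<le> 1" using x by (simp add: closed_cell_alt)
  have t2: "t\<^sup>2 * sqnorm n x \<le> t\<^sup>2" for t using x1 by (simp add: mult_left_le)
  have le: "sqnorm n (r t) \<le> 1" if "t \<in> {0..1}" for t
    using t2[of t] that power_le_one[of t 2] by (simp add: sq)
  have lt: "sqnorm n (r t) < 1" if "t \<in> {0..<1}" for t
  proof -
    have "t\<^sup>2 < 1" using that by (simp add: abs_square_less_1)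
    then show ?thesis using t2[of t] sq[of t] by linarith
  qed
  have cc: "continuous_map ?I (closed_cell n) r"
    unfolding closed_cell_alt continuous_map_in_subtopology using c le by auto
  have "closedin ?I {t \<in> topspace ?I. (\<Phi> \<circ> r) t \<in> T}"
    using continuous_map_compose[OF cc Phi] T by (rule closedin_continuous_map_preimage)
  then have cl: "closed {t \<in> {0..1}. \<Phi> (r t) \<in> T}"
    using closedin_closed_trans[OF _ closed_atLeastAtMost] by simp
  have rE: "r t \<in> topspace (Euclidean_space n)" if "t \<in> {0..1}" for t using c that by (auto simp: continuous_map_def Pi_iff)
  have "{0..<1} \<subseteq> {t \<in> {0..1}. \<Phi> (r t) \<in> T}"
  proof
    fix t :: real assume t: "t \<in> {0..<1}"
    then have "r t \<in> topspace (open_cell n)" unfolding open_cell_alt using lt rE by auto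
    then show "t \<in> {t \<in> {0..1}. \<Phi> (r t) \<in> T}" using int t by auto
  qed
  then have "closure {0..<1} \<subseteq> {t \<in> {0..1}. \<Phi> (r t) \<in> T}" using cl by (rule closure_minimal)
  moreover have "1 \<in> closure {0..<1::real}" by simp
  ultimately have "\<Phi> (r 1) \<in> T" by blast
  then show ?thesis by (simp add: r_def)
qed

section \<open>Tubes and their meridian discs\<close>

abbreviation tube :: "'a orbifold3 \<Rightarrow> nat \<Rightarrow> 'a set" where
  "tube Y i \<equiv> nbhd Y i ` (circle \<times> disc)"

definition tube_coords :: "'a orbifold3 \<Rightarrow> nat \<Rightarrow> 'a \<Rightarrow> complex \<times> complex" where
  "tube_coords Y i = inv_into (circle \<times> disc) (nbhd Y i)"

locale link_orbifold =
  fixes Y :: "'a orbifold3"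
  assumes link: "link_orbifold3 Y"
begin

abbreviation M :: "'a topology" where "M \<equiv> under Y"

lemma Hausdorff: "Hausdorff_space M"
  using link by (simp add: link_orbifold3_def manifold_with_boundary_def)

lemma nonempty: "topspace M \<noteq> {}"
  using link by (simp add: link_orbifold3_def)

lemma open_tube: "i \<in> comps Y \<Longrightarrow> openin M (nbhd Y i ` (circle \<times> open_disc))"
  using link by (simp add: link_orbifold3_def)

lemma tubes_disjoint: "\<lbrakk>i \<in> comps Y; j \<in> comps Y; i \<noteq> j\<rbrakk> \<Longrightarrow> tube Y i \<inter> tube Y j = {}"
  using link unfolding link_orbifold3_def disjoint_family_on_def by blast

lemma mult_ge: "i \<in> comps Y \<Longrightarrow> mult Y i \<ge> 2"
  using link by (simp add: link_orbifold3_def)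

lemma nbhd_homeo: "i \<in> comps Y \<Longrightarrow> homeomorphic_map (top_of_set (circle \<times> disc)) (subtopology M (tube Y i)) (nbhd Y i)"
  using link by (simp add: link_orbifold3_def embedding_map_def)

lemma nbhd_cont: "i \<in> comps Y \<Longrightarrow> continuous_map (top_of_set (circle \<times> disc)) M (nbhd Y i)"
  using homeomorphic_imp_continuous_map[OF nbhd_homeo] by (simp add: continuous_map_in_subtopology)

lemma nbhd_inj: "i \<in> comps Y \<Longrightarrow> inj_on (nbhd Y i) (circle \<times> disc)"
  using homeomorphic_imp_injective_map[OF nbhd_homeo] by simp

lemma tube_subset: "i \<in> comps Y \<Longrightarrow> tube Y i \<subseteq> topspace M"
  using nbhd_cont[of i] by (auto simp: continuous_map_def Pi_iff)

lemma coords_nbhd [simp]: "\<lbrakk>i \<in> comps Y; c \<in> circle \<times> disc\<rbrakk> \<Longrightarrow> tube_coords Y i (nbhd Y i c) = c"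
  unfolding tube_coords_def by (rule inv_into_f_f[OF nbhd_inj])

lemma nbhd_coords: "x \<in> tube Y i \<Longrightarrow> nbhd Y i (tube_coords Y i x) = x"
  unfolding tube_coords_def by (rule f_inv_into_f)

lemma coords_in: "x \<in> tube Y i \<Longrightarrow> tube_coords Y i x \<in> circle \<times> disc"
  unfolding tube_coords_def by (rule inv_into_into)

lemma coords_cont:
  assumes "i \<in> comps Y"
  shows "continuous_map (subtopology M (tube Y i)) (top_of_set (circle \<times> disc)) (tube_coords Y i)"
proof -
  obtain g where g: "homeomorphic_maps (top_of_set (circle \<times> disc)) (subtopology M (tube Y i)) (nbhd Y i) g"
    using nbhd_homeo[OF assms] homeomorphic_map_maps by blast
  have gc: "continuous_map (subtopology M (tube Y i)) (top_of_set (circle \<times> disc)) g"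
    using g by (simp add: homeomorphic_maps_def)
  have "g x = tube_coords Y i x" if x: "x \<in> topspace (subtopology M (tube Y i))" for x
  proof -
    have "nbhd Y i (g x) = x" using g x unfolding homeomorphic_maps_def by blast
    moreover have "g x \<in> circle \<times> disc" using gc x by (auto simp: continuous_map_def Pi_iff)
    ultimately show ?thesis using coords_nbhd[OF assms] by metis
  qed
  then show ?thesis using continuous_map_eq[OF gc] by blast
qed

lemma tube_compact: "i \<in> comps Y \<Longrightarrow> compactin M (tube Y i)"
  by (rule image_compactin[OF _ nbhd_cont]) (simp_all add: compactin_subtopology compact_Times)

lemma tube_closed: "i \<in> comps Y \<Longrightarrow> closedin M (tube Y i)"
  using tube_compact Hausdorff by (rule compactin_imp_closedin[rotated])

lemma exterior_closed: "closedin M (exterior Y)"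
  unfolding exterior_def using open_tube by (intro closedin_diff openin_Union) auto

lemma tubes_exterior_cover: "topspace M = exterior Y \<union> (\<Union>i\<in>comps Y. tube Y i)"
proof -
  have "nbhd Y i ` (circle \<times> open_disc) \<subseteq> tube Y i" for i by (intro image_mono Sigma_mono) auto
  then have "topspace M \<subseteq> exterior Y \<union> (\<Union>i\<in>comps Y. tube Y i)"
    unfolding exterior_def by fast
  moreover have "exterior Y \<subseteq> topspace M" by (simp add: exterior_def)
  moreover have "(\<Union>i\<in>comps Y. tube Y i) \<subseteq> topspace M" using tube_subset by (rule UN_least)
  ultimately show ?thesis by (intro equalityI Un_least)
qed

lemma nbhd_exterior:
  assumes "i \<in> comps Y" "z \<in> circle" "w \<in> disc"
  shows "nbhd Y i (z, w) \<in> exterior Y \<longleftrightarrow> w \<in> circle"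
proof -
  have in_t: "nbhd Y i (z, w) \<in> tube Y i" using assms by auto
  have "nbhd Y i (z, w) \<in> nbhd Y j ` (circle \<times> open_disc) \<longleftrightarrow> j = i \<and> w \<in> open_disc" if "j \<in> comps Y" for j
  proof
    assume *: "nbhd Y i (z, w) \<in> nbhd Y j ` (circle \<times> open_disc)"
    then have "nbhd Y i (z, w) \<in> tube Y j" by auto
    then have ji: "j = i" using tubes_disjoint[OF assms(1) that] in_t by blast
    obtain c where c: "c \<in> circle \<times> open_disc" "nbhd Y i (z, w) = nbhd Y i c" using * ji by auto
    then have "(z, w) = c" using nbhd_inj[OF assms(1)] assms(2,3) by (intro inj_onD[OF nbhd_inj[OF assms(1)]]) auto
    then show "j = i \<and> w \<in> open_disc" using c(1) ji by auto
  qed (use assms in auto)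
  then have "nbhd Y i (z, w) \<in> exterior Y \<longleftrightarrow> w \<notin> open_disc"
    using tube_subset[OF assms(1)] in_t assms(1) unfolding exterior_def by blast
  then show ?thesis using assms(3) by auto
qed

end

text \<open>A disc slice is a lift of the meridian disc over the point \<open>z\<close> of the core circle.\<close>

definition disc_slice :: "'a orbifold3 \<Rightarrow> nat \<Rightarrow> 'b topology \<Rightarrow> ('b \<Rightarrow> 'a) \<Rightarrow> complex \<Rightarrow> (complex \<Rightarrow> 'b) \<Rightarrow> bool" where
  "disc_slice Y i E p z u \<longleftrightarrow> z \<in> circle \<and> continuous_map (top_of_set disc) E u \<and> (\<forall>w\<in>disc. p (u w) = nbhd Y i (z, w))"

text \<open>A space that covers the tube number \<open>i\<close>, for example the cover of the manifold or, as will turn out, the orbifold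
  cover.  The last assumption provides local product structures: lifts \<open>s\<close> of \<open>A \<times> D\<^sup>2\<close> through any point, for small
  arcs \<open>A\<close>, called plaques below.\<close>

locale tube_covering = link_orbifold Y for Y :: "'a orbifold3" +
  fixes i :: nat and E :: "'b topology" and p :: "'b \<Rightarrow> 'a"
  assumes i: "i \<in> comps Y"
    and p_cont: "continuous_map E (under Y) p"
    and tube_cov: "covering (subtopology E {x. p x \<in> tube Y i}) (subtopology (under Y) (tube Y i)) p"
    and plaques: "\<lbrakk>x \<in> topspace E; c \<in> circle \<times> disc; p x = nbhd Y i c\<rbrakk> \<Longrightarrow>
      \<exists>A s. openin (top_of_set circle) A \<and> fst c \<in> A \<and> continuous_map (top_of_set (A \<times> disc)) E s \<and>
        (\<forall>a\<in>A \<times> disc. p (s a) = nbhd Y i a) \<and> s c = x"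
begin

abbreviation EN :: "'b topology" where "EN \<equiv> subtopology E {x. p x \<in> tube Y i}"

abbreviation coords :: "'b \<Rightarrow> complex \<times> complex" where "coords x \<equiv> tube_coords Y i (p x)"

lemma coords_p_cont: "continuous_map EN (top_of_set (circle \<times> disc)) coords"
proof -
  have "continuous_map EN (subtopology M (tube Y i)) p"
    using tube_cov by (rule covering_continuous)
  from continuous_map_compose[OF this coords_cont[OF i]] show ?thesis by (simp add: o_def)
qed

lemma slice_unique:
  assumes "disc_slice Y i E p z u" "disc_slice Y i E p z u'" "w \<in> disc" "u w = u' w" "w' \<in> disc"
  shows "u w' = u' w'"
proof (rule lifts_eq_on[OF tube_cov, where X = euclidean and S = disc])
  show "continuous_map (top_of_set disc) EN u" "continuous_map (top_of_set disc) EN u'"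
    using assms(1,2) by (auto simp: disc_slice_def continuous_map_in_subtopology)
  show "\<And>x. x \<in> disc \<Longrightarrow> p (u x) = p (u' x)"
    using assms(1,2) by (auto simp: disc_slice_def)
  show "connectedin euclidean disc" by simp
qed (use assms in auto)

lemma plaque_slice:
  assumes "openin (top_of_set circle) A" "continuous_map (top_of_set (A \<times> disc)) E s"
    "\<forall>a\<in>A \<times> disc. p (s a) = nbhd Y i a" "z \<in> A"
  shows "disc_slice Y i E p z (\<lambda>w. s (z, w))"
  unfolding disc_slice_def
proof (intro conjI ballI)
  show "z \<in> circle" using assms(1,4) openin_imp_subset by blast
  have "continuous_map (top_of_set disc) (top_of_set (A \<times> disc)) (\<lambda>w. (z, w))"
    using assms(4) by (auto simp: continuous_map_in_subtopology intro!: continuous_intros)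
  from continuous_map_compose[OF this assms(2)] show "continuous_map (top_of_set disc) E (\<lambda>w. s (z, w))"
    by (simp add: o_def)
qed (use assms in auto)

lemma slice_exists:
  assumes "x \<in> topspace E" "z \<in> circle" "w \<in> disc" "p x = nbhd Y i (z, w)"
  obtains u where "disc_slice Y i E p z u" "u w = x"
proof -
  obtain A s where "openin (top_of_set circle) A" "z \<in> A" "continuous_map (top_of_set (A \<times> disc)) E s"
    "\<forall>a\<in>A \<times> disc. p (s a) = nbhd Y i a" "s (z, w) = x"
    using plaques[OF assms(1), of "(z, w)"] assms by auto
  then show thesis using plaque_slice that by blast
qed

lemma slice_coords:
  assumes "disc_slice Y i E p z u" "w \<in> disc"
  shows "u w \<in> topspace EN" "p (u w) = nbhd Y i (z, w)" "coords (u w) = (z, w)"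
proof -
  show p: "p (u w) = nbhd Y i (z, w)" using assms by (simp add: disc_slice_def)
  have z: "z \<in> circle" "u w \<in> topspace E" using assms by (auto simp: disc_slice_def continuous_map_def Pi_iff)
  then show "u w \<in> topspace EN" using p assms(2) by auto
  show "coords (u w) = (z, w)" using p z coords_nbhd[OF i, of "(z, w)"] assms(2) by simp
qed

lemma slice_through:
  assumes "x \<in> topspace EN"
  obtains z w u where "disc_slice Y i E p z u" "w \<in> disc" "x = u w" "coords x = (z, w)"
proof -
  have x: "x \<in> topspace E" "p x \<in> tube Y i" using assms by auto
  obtain z w where zw: "coords x = (z, w)" by fastforce
  then have c: "z \<in> circle" "w \<in> disc" using coords_in[OF x(2)] by auto
  have "p x = nbhd Y i (z, w)" using nbhd_coords[OF x(2)] zw by simp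
  then obtain u where "disc_slice Y i E p z u" "u w = x" using slice_exists[OF x(1) c] by blast
  then show thesis using that c zw by blast
qed

text \<open>\<open>slide\<close> moves a point along its slice to the point over \<open>1\<close>, and \<open>extend\<close> is the way back from that point to the one
  over \<open>w\<close>.\<close>

definition slide :: "'b \<Rightarrow> 'b" where
  "slide x = (SOME b. \<exists>z w u. disc_slice Y i E p z u \<and> w \<in> disc \<and> u w = x \<and> u 1 = b)"

definition extend :: "'b \<Rightarrow> complex \<Rightarrow> 'b" where
  "extend b w = (SOME x. \<exists>z u. disc_slice Y i E p z u \<and> u 1 = b \<and> u w = x)"

lemma slide_slice:
  assumes "disc_slice Y i E p z u" "w \<in> disc"
  shows "slide (u w) = u 1"
  unfolding slide_def
proof (rule some_equality)
  show "\<exists>z w' u'. disc_slice Y i E p z u' \<and> w' \<in> disc \<and> u' w' = u w \<and> u' 1 = u 1"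
    using assms by blast
  fix b assume "\<exists>z w' u'. disc_slice Y i E p z u' \<and> w' \<in> disc \<and> u' w' = u w \<and> u' 1 = b"
  then obtain z' w' u' where *: "disc_slice Y i E p z' u'" "w' \<in> disc" "u' w' = u w" "u' 1 = b" by blast
  have "(z', w') = (z, w)" using slice_coords(3)[OF *(1,2)] slice_coords(3)[OF assms] *(3) by simp
  then show "b = u 1" using slice_unique[OF *(1), of u w 1] * assms by simp
qed

lemma extend_slice:
  assumes "disc_slice Y i E p z u" "w \<in> disc"
  shows "extend (u 1) w = u w"
  unfolding extend_def
proof (rule some_equality)
  show "\<exists>z u'. disc_slice Y i E p z u' \<and> u' 1 = u 1 \<and> u' w = u w"
    using assms by blast
  fix b assume "\<exists>z u'. disc_slice Y i E p z u' \<and> u' 1 = u 1 \<and> u' w = b"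
  then obtain z' u' where *: "disc_slice Y i E p z' u'" "u' 1 = u 1" "u' w = b" by blast
  have "(z', 1) = (z, 1::complex)" using slice_coords(3)[OF *(1), of 1] slice_coords(3)[OF assms(1), of 1] *(2) by simp
  then show "b = u w" using slice_unique[OF *(1), of u 1 w] * assms by simp
qed

text \<open>A plaque is a section over an open subset of the tube, and sections of coverings have open images.\<close>

lemma plaque_neighbourhood:
  assumes x: "x \<in> topspace EN"
  obtains A s O' where "openin (top_of_set circle) A" "continuous_map (top_of_set (A \<times> disc)) E s"
    "\<forall>a\<in>A \<times> disc. p (s a) = nbhd Y i a" "openin EN O'" "x \<in> O'"
    "\<forall>y\<in>O'. fst (coords y) \<in> A \<and> s (coords y) = y"
proof -
  have xE: "x \<in> topspace E" "p x \<in> tube Y i" using x by auto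
  obtain A s where As: "openin (top_of_set circle) A" "fst (coords x) \<in> A" "continuous_map (top_of_set (A \<times> disc)) E s"
    "\<forall>a\<in>A \<times> disc. p (s a) = nbhd Y i a" "s (coords x) = x"
    using plaques[OF xE(1) coords_in[OF xE(2)] nbhd_coords[OF xE(2), symmetric]] by auto
  define O1 where "O1 = {y \<in> topspace EN. fst (coords y) \<in> A}"
  have "continuous_map EN (top_of_set circle) (\<lambda>y. fst (coords y))"
  proof -
    have "continuous_map (top_of_set (circle \<times> disc)) (top_of_set circle) fst"
      by (auto simp: continuous_map_in_subtopology intro!: continuous_intros)
    from continuous_map_compose[OF coords_p_cont this] show ?thesis by (simp add: o_def)
  qed
  then have O1: "openin EN O1" unfolding O1_def using As(1) by (rule openin_continuous_map_preimage)
  have cA: "coords y \<in> A \<times> disc" if "y \<in> O1" for y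
    using that coords_in[of "p y" i] by (auto simp: O1_def mem_Times_iff)
  have "continuous_map (subtopology EN O1) (top_of_set (A \<times> disc)) coords"
    using continuous_map_from_subtopology[OF coords_p_cont, of O1] cA
    by (auto simp: continuous_map_in_subtopology)
  from continuous_map_compose[OF this As(3)]
  have 1: "continuous_map (subtopology EN O1) E (\<lambda>y. s (coords y))" by (simp add: o_def)
  have ps: "p (s (coords y)) = p y" if "y \<in> O1" for y
    using As(4) cA[OF that] nbhd_coords[of "p y" i] that by (auto simp: O1_def)
  have 2: "continuous_map (subtopology EN O1) EN (\<lambda>y. s (coords y))"
    using 1 ps by (auto simp: continuous_map_in_subtopology O1_def)
  have "openin (subtopology EN O1) {y \<in> topspace (subtopology EN O1). s (coords y) = y}"
    using ps by (intro lifts_agree_clopen[OF tube_cov 2]) (auto simp: continuous_map_from_subtopology)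
  then have "openin EN {y \<in> topspace (subtopology EN O1). s (coords y) = y}"
    using O1 by (rule openin_trans_full)
  moreover have "x \<in> {y \<in> topspace (subtopology EN O1). s (coords y) = y}"
    using x As by (auto simp: O1_def)
  ultimately show thesis
    using that[OF As(1,3,4)] by (auto simp: O1_def)
qed

text \<open>On a plaque, \<open>slide\<close> is the map that replaces the second coordinate by \<open>1\<close>.\<close>

lemma slide_cont: "continuous_map EN E slide"
proof (rule continuous_map_locally)
  fix x assume "x \<in> topspace EN"
  then obtain A s O' where *: "openin (top_of_set circle) A" "continuous_map (top_of_set (A \<times> disc)) E s"
    "\<forall>a\<in>A \<times> disc. p (s a) = nbhd Y i a" "openin EN O'" "x \<in> O'"
    "\<forall>y\<in>O'. fst (coords y) \<in> A \<and> s (coords y) = y" by (rule plaque_neighbourhood)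
  have O': "O' \<subseteq> topspace EN" using *(4) by (rule openin_subset)
  have "continuous_map (subtopology EN O') (top_of_set (A \<times> disc)) (\<lambda>y. (fst (coords y), 1))"
  proof -
    have "continuous_map (top_of_set (circle \<times> disc)) euclidean (\<lambda>c. (fst c, 1::complex))"
      by (auto intro!: continuous_intros)
    from continuous_map_compose[OF coords_p_cont this]
    have "continuous_map EN euclidean (\<lambda>y. (fst (coords y), 1::complex))" by (simp add: o_def)
    then show ?thesis using *(6) by (auto simp: continuous_map_in_subtopology continuous_map_from_subtopology)
  qed
  from continuous_map_compose[OF this *(2)]
  have "continuous_map (subtopology EN O') E (\<lambda>y. s (fst (coords y), 1))" by (simp add: o_def)
  moreover have "slide y = s (fst (coords y), 1)" if y: "y \<in> O'" for y
  proof -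
    have "snd (coords y) \<in> disc" using coords_in[of "p y" i] y O' by (auto simp: mem_Times_iff)
    then show ?thesis
      using slide_slice[OF plaque_slice[OF *(1-3), of "fst (coords y)"], of "snd (coords y)"] *(6) y by simp
  qed
  ultimately show "\<exists>N g. openin EN N \<and> x \<in> N \<and> continuous_map (subtopology EN N) E g \<and> (\<forall>n\<in>N. slide n = g n)"
    using *(4,5) by blast
qed

lemma extend_cont:
  "continuous_map (subtopology (prod_topology E (top_of_set disc)) {(b, w). p b \<in> nbhd Y i ` (circle \<times> {1})}) E (\<lambda>(b, w). extend b w)"
    (is "continuous_map ?X E _")
proof (rule continuous_map_locally)
  fix bw assume bw: "bw \<in> topspace ?X"
  then obtain b w where b: "bw = (b, w)" "b \<in> topspace E" "w \<in> disc" "p b \<in> nbhd Y i ` (circle \<times> {1})" by auto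
  then have "b \<in> topspace EN" by auto
  then obtain A s O' where *: "openin (top_of_set circle) A" "continuous_map (top_of_set (A \<times> disc)) E s"
    "\<forall>a\<in>A \<times> disc. p (s a) = nbhd Y i a" "openin EN O'" "b \<in> O'"
    "\<forall>y\<in>O'. fst (coords y) \<in> A \<and> s (coords y) = y" by (rule plaque_neighbourhood)
  have O': "O' \<subseteq> topspace EN" using *(4) by (rule openin_subset)
  define N where "N = {c \<in> topspace ?X. fst c \<in> O'}"
  have fstc: "continuous_map ?X EN fst"
    by (auto simp: continuous_map_in_subtopology continuous_map_from_subtopology continuous_map_fst)
  have N: "openin ?X N" unfolding N_def using fstc *(4) by (rule openin_continuous_map_preimage)
  have "continuous_map (subtopology ?X N) (top_of_set (A \<times> disc)) (\<lambda>c. (fst (coords (fst c)), snd c))"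
  proof -
    have "continuous_map (top_of_set (circle \<times> disc)) euclidean (\<lambda>c. fst c)"
      by (auto intro!: continuous_intros)
    from continuous_map_compose[OF continuous_map_compose[OF fstc coords_p_cont] this]
    have 1: "continuous_map ?X euclidean (\<lambda>c. fst (coords (fst c)))" by (simp add: o_def)
    have "continuous_map ?X (top_of_set disc) snd"
      by (auto simp: continuous_map_from_subtopology continuous_map_snd)
    then have 2: "continuous_map ?X euclidean snd" by (simp add: continuous_map_in_subtopology)
    have "continuous_map ?X (prod_topology euclidean euclidean) (\<lambda>c. (fst (coords (fst c)), snd c))"
      using 1 2 by (rule continuous_map_pairedI)
    then have "continuous_map ?X euclidean (\<lambda>c. (fst (coords (fst c)), snd c))" by simp
    then show ?thesis using *(6) by (auto simp: N_def continuous_map_in_subtopology continuous_map_from_subtopology)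
  qed
  from continuous_map_compose[OF this *(2)]
  have "continuous_map (subtopology ?X N) E (\<lambda>c. s (fst (coords (fst c)), snd c))" by (simp add: o_def)
  moreover have "(\<lambda>(b, w). extend b w) c = s (fst (coords (fst c)), snd c)" if c: "c \<in> N" for c
  proof -
    obtain b' w' z where c': "c = (b', w')" "b' \<in> O'" "w' \<in> disc" "z \<in> circle" "p b' = nbhd Y i (z, 1)"
      using c by (auto simp: N_def)
    have "coords b' = (z, 1)" using c' coords_nbhd[OF i, of "(z, 1)"] by simp
    then have "s (z, 1) = b'" "z \<in> A" using *(6) c' by force+
    then show ?thesis
      using extend_slice[OF plaque_slice[OF *(1-3), of z], of w'] c' \<open>coords b' = (z, 1)\<close> by simp
  qed
  ultimately show "\<exists>N g. openin ?X N \<and> bw \<in> N \<and> continuous_map (subtopology ?X N) E g \<and> (\<forall>n\<in>N. (\<lambda>(b, w). extend b w) n = g n)"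
    using N bw b *(5) by (intro exI[of _ N] exI[of _ "\<lambda>c. s (fst (coords (fst c)), snd c)"]) (auto simp: N_def)
qed

end

section \<open>The cover belonging to the first homology group\<close>

lemma closedin_preimage_trans:
  assumes "closedin (subtopology X {x. P x}) T" "closedin X {x \<in> topspace X. P x}"
  shows "closedin X T"
proof -
  have "subtopology X {x. P x} = subtopology X {x \<in> topspace X. P x}"
    by (simp add: Collect_conj_eq subtopology_restrict)
  then show ?thesis using assms closedin_trans_full by metis
qed

locale H1_covering =
  fixes B :: "'a topology" and E :: "'b topology" and p act
  assumes H1_cover: "H1_cover B E p act"
begin

sublocale deck_cover "homology_group 1 B" "loop_class B" B E p act
  using H1_cover by (auto simp: deck_cover_def deck_cover_axioms_def H1_cover_def)

text \<open>A path in \<open>E\<close> over a closed path of trivial class has end points related by the neutral element.\<close>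

lemma lift_if_loops_trivial:
  assumes f: "continuous_map X B f" and X: "path_connected_space X" "locally_path_connected_space X"
    and triv: "\<And>\<gamma>. \<lbrakk>pathin X \<gamma>; \<gamma> 0 = \<gamma> 1\<rbrakk> \<Longrightarrow> loop_class B (f \<circ> \<gamma>) = \<one>\<^bsub>homology_group 1 B\<^esub>"
    and x0: "x0 \<in> topspace X" and e0: "e0 \<in> topspace E" "p e0 = f x0"
  obtains F where "continuous_map X E F" "\<And>x. x \<in> topspace X \<Longrightarrow> p (F x) = f x" "F x0 = e0"
proof (rule lift_exists[OF covering f X _ x0 e0])
  fix \<gamma> \<sigma>
  assume *: "pathin X \<gamma>" "\<gamma> 0 = \<gamma> 1" "pathin E \<sigma>" "\<And>t. t \<in> {0..1} \<Longrightarrow> p (\<sigma> t) = f (\<gamma> t)"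
  have s: "\<sigma> 0 \<in> topspace E" "\<sigma> 1 \<in> topspace E"
    using path_start_in_topspace[OF *(3)] path_finish_in_topspace[OF *(3)] .
  moreover have "p (\<sigma> 0) = p (\<sigma> 1)" using *(2) *(4)[of 0] *(4)[of 1] by simp
  ultimately obtain g where g: "g \<in> carrier (homology_group 1 B)" "act g (\<sigma> 0) = \<sigma> 1" by (rule act_trans)
  have "g = loop_class B (p \<circ> \<sigma>)" using path_class[OF g(1) *(3)] g(2) by simp
  also have "\<dots> = loop_class B (f \<circ> \<gamma>)" using *(4) by (intro loop_class_cong) simp
  also have "\<dots> = \<one>\<^bsub>homology_group 1 B\<^esub>" using *(1,2) by (rule triv)
  finally show "\<sigma> 0 = \<sigma> 1" using g(2) act_one[OF s(1)] by simp
qed (use that in blast)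

lemma contractible_lift:
  assumes f: "continuous_map X B f" and X: "contractible_space X" "locally_path_connected_space X"
    and x0: "x0 \<in> topspace X" and e0: "e0 \<in> topspace E" "p e0 = f x0"
  obtains F where "continuous_map X E F" "\<And>x. x \<in> topspace X \<Longrightarrow> p (F x) = f x" "F x0 = e0"
  using lift_if_loops_trivial[OF f contractible_imp_path_connected_space[OF X(1)] X(2) _ x0 e0]
    loop_class_through_contractible[OF X(1) _ _ f] that by metis

end

text \<open>The inverse of \<open>cis\<close> on the right half circle, which gives continuous angles on half circles.\<close>

lemma cis_arcsin:
  assumes "cmod a = 1" "Re a > 0"
  shows "cis (arcsin (Im a)) = a"
proof -
  have "\<bar>Im a\<bar> \<le> 1" using abs_Im_le_cmod[of a] assms(1) by simp
  then have im: "-1 \<le> Im a" "Im a \<le> 1" by auto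
  have "(Re a)\<^sup>2 + (Im a)\<^sup>2 = 1" using assms(1) by (simp add: cmod_def)
  then have "sqrt (1 - (Im a)\<^sup>2) = Re a" using assms(2) by (metis add_diff_cancel_right' less_imp_le real_sqrt_abs abs_of_nonneg)
  then show ?thesis using im by (simp add: complex_eq_iff cos_arcsin)
qed

locale orbifold_H1_cover = link_orbifold Y + H1_covering "under Y" Q q act'
  for Y :: "'a orbifold3" and Q :: "'c topology" and q :: "'c \<Rightarrow> 'a" and act'
begin

text \<open>The universal cover \<open>\<real> \<times> D\<^sup>2\<close> of a tube is contractible, so it lifts to \<open>Q\<close>.  Such lifts are called strips.\<close>

lemma strip_lift:
  assumes i: "i \<in> comps Y" and y: "y \<in> topspace Q" "w \<in> disc" "q y = nbhd Y i (cis \<theta>, w)"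
  obtains l where "continuous_map (top_of_set (UNIV \<times> disc)) Q l"
    "\<And>t v. v \<in> disc \<Longrightarrow> q (l (t, v)) = nbhd Y i (cis t, v)" "l (\<theta>, w) = y"
proof -
  let ?X = "top_of_set (UNIV \<times> disc) :: (real \<times> complex) topology"
  have cv: "convex (UNIV \<times> disc :: (real \<times> complex) set)" by (intro convex_Times) auto
  have "continuous_map ?X (top_of_set (circle \<times> disc)) (\<lambda>c. (cis (fst c), snd c))"
    by (auto simp: continuous_map_in_subtopology intro!: continuous_intros)
  from continuous_map_compose[OF this nbhd_cont[OF i]]
  have f: "continuous_map ?X M (\<lambda>c. nbhd Y i (cis (fst c), snd c))" by (simp add: o_def)
  obtain F where F: "continuous_map ?X Q F" "\<And>x. x \<in> topspace ?X \<Longrightarrow> q (F x) = nbhd Y i (cis (fst x), snd x)" "F (\<theta>, w) = y"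
  proof (rule contractible_lift[OF f, of "(\<theta>, w)" y])
    show "contractible_space ?X" using cv by (simp add: convex_imp_contractible)
    show "locally_path_connected_space ?X" using cv by (rule convex_locally_path_connected_space)
  qed (use y in auto)
  then show thesis using that[of F] by simp
qed

lemma strip_unique:
  assumes i: "i \<in> comps Y"
    and L: "continuous_map (top_of_set (UNIV \<times> disc)) Q l" "\<And>t v. v \<in> disc \<Longrightarrow> q (l (t, v)) = nbhd Y i (cis t, v)"
    and L': "continuous_map (top_of_set (UNIV \<times> disc)) Q l'" "\<And>t v. v \<in> disc \<Longrightarrow> q (l' (t, v)) = nbhd Y i (cis t, v)"
    and eq: "w \<in> disc" "l (t, w) = l' (t, w)" and v: "v \<in> disc"
  shows "l (s, v) = l' (s, v)"
proof (rule lifts_eq_on[OF covering L(1) L'(1)])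
  show "connectedin euclidean (UNIV \<times> disc :: (real \<times> complex) set)"
    by (simp add: connected_Times)
qed (use L(2) L'(2) eq v in auto)

text \<open>Plaques are obtained from strips with the help of a continuous angle on a half circle.\<close>

lemma tube_covering: "i \<in> comps Y \<Longrightarrow> tube_covering Y i Q q"
proof unfold_locales
  assume i: "i \<in> comps Y"
  show "continuous_map Q M q" by (rule p_cont)
  show "covering (subtopology Q {x. q x \<in> tube Y i}) (subtopology M (tube Y i)) q"
    by (rule covering_restrict[OF covering])
  fix x c assume x: "x \<in> topspace Q" and c: "c \<in> circle \<times> disc" "q x = nbhd Y i c"
  obtain z w where zw: "c = (z, w)" "cmod z = 1" "w \<in> disc" using c(1) by auto
  define \<theta> where "\<theta> = Arg z"
  have z: "cis \<theta> = z" using zw(2) unfolding \<theta>_def by (metis cis_Arg norm_zero sgn_div_norm scaleR_one inverse_1 zero_neq_one)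
  have zz: "z * cnj z = 1" using zw(2) by (simp add: complex_mult_cnj cmod_def flip: power2_eq_square)
  obtain l where l: "continuous_map (top_of_set (UNIV \<times> disc)) Q l"
    "\<And>t v. v \<in> disc \<Longrightarrow> q (l (t, v)) = nbhd Y i (cis t, v)" "l (\<theta>, w) = x"
    using strip_lift[OF i x, of w \<theta>] c zw z by metis
  \<comment> \<open>a continuous angle on the half circle around \<open>z\<close>, with value \<open>\<theta>\<close> at \<open>z\<close>\<close>
  define \<beta> where "\<beta> a = \<theta> + arcsin (Im (a * cnj z))" for a
  define A where "A = circle \<inter> {a. Re (a * cnj z) > 0}"
  have Aa: "cmod (a * cnj z) = 1" "Re (a * cnj z) > 0" if "a \<in> A" for a
    using that zw(2) by (auto simp: A_def norm_mult)
  have b: "cis (\<beta> a) = a" if "a \<in> A" for a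
  proof -
    have "cis (\<beta> a) = z * (a * cnj z)"
      using cis_arcsin[OF Aa[OF that]] z unfolding \<beta>_def by (simp add: cis_mult[symmetric])
    also have "\<dots> = a * (z * cnj z)" by (simp add: ac_simps)
    finally show ?thesis using zz by simp
  qed
  have "open {a. Re (a * cnj z) > 0}" by (intro open_Collect_less continuous_intros)
  then have "openin (top_of_set circle) A" unfolding A_def by (simp add: openin_open_Int)
  moreover have "Re (z * cnj z) > 0" unfolding zz by simp
  then have "fst c \<in> A" using zw by (simp add: A_def)
  moreover have "continuous_map (top_of_set (A \<times> disc)) Q (\<lambda>a. l (\<beta> (fst a), snd a))"
  proof -
    have "-1 \<le> Im (a * cnj z) \<and> Im (a * cnj z) \<le> 1" if "a \<in> A" for a
      using abs_Im_le_cmod[of "a * cnj z"] Aa[OF that] by linarith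
    then have "continuous_on (A \<times> disc) (\<lambda>a. (\<beta> (fst a), snd a))"
      unfolding \<beta>_def by (intro continuous_intros) auto
    then have "continuous_map (top_of_set (A \<times> disc)) (top_of_set (UNIV \<times> disc)) (\<lambda>a. (\<beta> (fst a), snd a))"
      by (auto simp: continuous_map_in_subtopology)
    from continuous_map_compose[OF this l(1)] show ?thesis by (simp add: o_def)
  qed
  moreover have "\<forall>a\<in>A \<times> disc. q (l (\<beta> (fst a), snd a)) = nbhd Y i a" using l(2) b by auto
  moreover have "l (\<beta> (fst c), snd c) = x" 
  proof -
    have "\<beta> z = \<theta>" unfolding \<beta>_def zz by simp
    then show ?thesis using zw l(3) by simp
  qed
  ultimately show "\<exists>A s. openin (top_of_set circle) A \<and> fst c \<in> A \<and> continuous_map (top_of_set (A \<times> disc)) Q s \<and>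
        (\<forall>a\<in>A \<times> disc. q (s a) = nbhd Y i a) \<and> s c = x" by blast
qed auto

lemma meridian_class:
  assumes i: "i \<in> comps Y" and z: "z \<in> circle"
  shows "loop_class M (\<lambda>t. nbhd Y i (z, cis (2 * pi * t))) = \<one>\<^bsub>homology_group 1 M\<^esub>"
proof -
  have "continuous_map (top_of_set disc) (top_of_set (circle \<times> disc)) (\<lambda>w. (z, w))"
    using z by (auto simp: continuous_map_in_subtopology intro!: continuous_intros)
  from continuous_map_compose[OF this nbhd_cont[OF i]]
  have f: "continuous_map (top_of_set disc) M (\<lambda>w. nbhd Y i (z, w))" by (simp add: o_def)
  have "loop_class M ((\<lambda>w. nbhd Y i (z, w)) \<circ> (\<lambda>t. cis (2 * pi * t))) = \<one>\<^bsub>homology_group 1 M\<^esub>"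
  proof (rule loop_class_through_contractible[OF _ _ _ f])
    show "contractible_space (top_of_set disc)" by (simp add: convex_imp_contractible)
    show "pathin (top_of_set disc) (\<lambda>t. cis (2 * pi * t))"
      by (auto simp: pathin_def continuous_map_in_subtopology intro!: continuous_intros)
  qed (simp add: cis_2pi)
  then show ?thesis by (simp add: o_def)
qed

text \<open>The boundary circle of a slice is connected and lies over the exterior.\<close>

lemma slice_boundary_mem:
  assumes i: "i \<in> comps Y" and S: "openin (subtopology Q {x. q x \<in> exterior Y}) S" "closedin (subtopology Q {x. q x \<in> exterior Y}) S"
    and u: "disc_slice Y i Q q z u" and w: "w \<in> circle"
  shows "u w \<in> S \<longleftrightarrow> u 1 \<in> S"
proof -
  let ?QX = "subtopology Q {x. q x \<in> exterior Y}"
  have z: "z \<in> circle" and qu: "\<And>v. v \<in> disc \<Longrightarrow> q (u v) = nbhd Y i (z, v)" and uc: "continuous_map (top_of_set disc) Q u"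
    using u by (auto simp: disc_slice_def)
  have sub: "circle \<subseteq> disc" by auto
  have "continuous_map (top_of_set circle) Q u"
    using continuous_map_from_subtopology[OF uc, of circle] sub by (simp add: subtopology_subtopology inf.absorb2)
  moreover have "u v \<in> {x. q x \<in> exterior Y}" if "v \<in> circle" for v
    using nbhd_exterior[OF i z, of v] qu[of v] that sub by auto
  ultimately have "continuous_map (top_of_set circle) ?QX u"
    by (auto simp: continuous_map_in_subtopology)
  moreover have "connected circle" by (rule connected_sphere) simp
  then have "connectedin (top_of_set circle) circle" by (simp add: connectedin_subtopology)
  ultimately have con: "connectedin ?QX (u ` circle)" by (rule connectedin_continuous_map_image)
  have "u ` circle \<subseteq> S \<or> u ` circle \<inter> S = {}"
    using con S by (metis connectedin_clopen_cases disjnt_def)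
  moreover have "u w \<in> u ` circle" "u 1 \<in> u ` circle" using w by auto
  ultimately show ?thesis by blast
qed

text \<open>A set that is open and closed over the exterior extends to a set that is open and closed in \<open>Q\<close>, by adding those
  points over the tubes that slide into it.\<close>

lemma exterior_cover_connected: "connected_space (subtopology Q {x. q x \<in> exterior Y})"
proof (rule ccontr)
  let ?QX = "subtopology Q {x. q x \<in> exterior Y}"
  assume "\<not> connected_space ?QX"
  then obtain S where S: "openin ?QX S" "closedin ?QX S" "S \<noteq> {}" "S \<noteq> topspace ?QX"
    unfolding connected_space_clopen_in by blast
  have QXc: "closedin Q {x \<in> topspace Q. q x \<in> exterior Y}"
    using exterior_closed by (rule closedin_continuous_map_preimage[OF p_cont])
  \<comment> \<open>the extension of \<open>T\<close> over the tubes; it is closed if \<open>T\<close> is, and this is applied to a clopen set and its complement\<close>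
  define ext where "ext T = T \<union> (\<Union>i\<in>comps Y. {y \<in> topspace Q. q y \<in> tube Y i \<and> tube_covering.slide Y i Q q y \<in> T})" for T
  have closed: "closedin Q (ext T)" if T: "closedin ?QX T" for T
  proof -
    have cT: "closedin Q T"
      using T QXc by (rule closedin_preimage_trans)
    have "closedin Q {y \<in> topspace Q. q y \<in> tube Y i \<and> tube_covering.slide Y i Q q y \<in> T}" if i: "i \<in> comps Y" for i
    proof -
      interpret t: tube_covering Y i Q q using tube_covering[OF i] .
      have "closedin t.EN {y \<in> topspace t.EN. t.slide y \<in> T}"
        by (rule closedin_continuous_map_preimage[OF t.slide_cont cT])
      moreover have "closedin Q {x \<in> topspace Q. q x \<in> tube Y i}"
        using tube_closed[OF i] by (rule closedin_continuous_map_preimage[OF p_cont])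
      ultimately have "closedin Q {y \<in> topspace t.EN. t.slide y \<in> T}"
        by (rule closedin_preimage_trans)
      moreover have "{y \<in> topspace t.EN. t.slide y \<in> T} = {y \<in> topspace Q. q y \<in> tube Y i \<and> t.slide y \<in> T}" by auto
      ultimately show ?thesis by simp
    qed
    then show ?thesis unfolding ext_def using cT by (intro closedin_Un closedin_Union) auto
  qed
  let ?S' = "topspace ?QX - S"
  have S': "openin ?QX ?S'" "closedin ?QX ?S'"
    by (rule openin_diff[OF openin_topspace S(2)], rule closedin_diff[OF closedin_topspace S(1)])
  have ST: "S \<subseteq> topspace ?QX" using S(1) by (rule openin_subset)
  have slideX: "tube_covering.slide Y i Q q y \<in> topspace ?QX" and
    slide_iff: "\<And>T. \<lbrakk>openin ?QX T; closedin ?QX T; y \<in> topspace ?QX\<rbrakk> \<Longrightarrow> tube_covering.slide Y i Q q y \<in> T \<longleftrightarrow> y \<in> T"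
    if i: "i \<in> comps Y" and y: "y \<in> topspace Q" "q y \<in> tube Y i" for i y
  proof -
    interpret t: tube_covering Y i Q q using tube_covering[OF i] .
    have "y \<in> topspace t.EN" using y by auto
    then obtain z w u where u: "disc_slice Y i Q q z u" "w \<in> disc" "y = u w" "t.coords y = (z, w)"
      by (rule t.slice_through)
    have z: "z \<in> circle" using u(1) by (simp add: disc_slice_def)
    have s: "t.slide y = u 1" using t.slide_slice[OF u(1,2)] u(3) by simp
    show "t.slide y \<in> topspace ?QX"
      using t.slice_coords[OF u(1), of 1] nbhd_exterior[OF i z, of 1] s by simp
    show "t.slide y \<in> T \<longleftrightarrow> y \<in> T" if "openin ?QX T" "closedin ?QX T" "y \<in> topspace ?QX" for T
    proof -
      have "w \<in> circle" using that(3) nbhd_exterior[OF i z u(2)] t.slice_coords[OF u(1,2)] u(3) by simp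
      then have "u w \<in> T \<longleftrightarrow> u 1 \<in> T" by (rule slice_boundary_mem[OF i that(1,2) u(1)])
      then show ?thesis using s u(3) by metis
    qed
  qed
  have "topspace Q \<subseteq> ext S \<union> ext ?S'"
  proof
    fix y assume y: "y \<in> topspace Q"
    show "y \<in> ext S \<union> ext ?S'"
    proof (cases "q y \<in> exterior Y")
      case True
      then show ?thesis using y by (auto simp: ext_def)
    next
      case False
      then obtain i where i: "i \<in> comps Y" "q y \<in> tube Y i"
        using p_closed[OF y] tubes_exterior_cover by auto
      then have "tube_covering.slide Y i Q q y \<in> S \<union> ?S'" using slideX[OF i(1) y i(2)] by blast
      then show ?thesis using i y unfolding ext_def by blast
    qed
  qed
  moreover have "ext S \<inter> ext ?S' = {}"
  proof -
    have char: "y \<in> T" if T: "openin ?QX T" "closedin ?QX T" "T \<subseteq> topspace ?QX" and y: "y \<in> ext T" "y \<in> topspace ?QX" for T y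
      using y slide_iff[OF _ _ _ T(1,2)] unfolding ext_def by auto
    have char2: "tube_covering.slide Y i Q q y \<in> T" if T: "openin ?QX T" "closedin ?QX T" "T \<subseteq> topspace ?QX"
      and y: "y \<in> ext T" "y \<in> topspace Q" and i: "i \<in> comps Y" "q y \<in> tube Y i" for T y i
    proof -
      consider "y \<in> T" | j where "j \<in> comps Y" "q y \<in> tube Y j" "tube_covering.slide Y j Q q y \<in> T"
        using y(1) unfolding ext_def by blast
      then show ?thesis
      proof cases
        case 1
        then show ?thesis using slide_iff[OF i(1) y(2) i(2) T(1,2)] T(3) by blast
      next
        case 2
        then have "j = i" using tubes_disjoint[OF i(1) 2(1)] i(2) by blast
        then show ?thesis using 2(3) by simp
      qed
    qed
    have "y \<notin> ext S \<inter> ext ?S'" for y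
    proof
      assume y: "y \<in> ext S \<inter> ext ?S'"
      then have yQ: "y \<in> topspace Q" using closedin_subset[OF closed[OF S(2)]] by blast
      show False
      proof (cases "q y \<in> exterior Y")
        case True
        then have "y \<in> S" "y \<in> ?S'" using char[OF S(1,2) ST] char[OF S' Diff_subset] y yQ by auto
        then show False by simp
      next
        case False
        then obtain i where i: "i \<in> comps Y" "q y \<in> tube Y i"
          using p_closed[OF yQ] tubes_exterior_cover by auto
        then show False
          using char2[OF S(1,2) ST _ yQ i] char2[OF S' Diff_subset _ yQ i] y by blast
      qed
    qed
    then show ?thesis by blast
  qed
  moreover have "ext S \<noteq> {}" "ext ?S' \<noteq> {}" using S ST by (auto simp: ext_def)
  ultimately show False
    using closed[OF S(2)] closed[OF S'(2)] path_connected_imp_connected_space[OF path_connected]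
    unfolding connected_space_closedin by meson
qed

end

section \<open>The orbifold cover over the exterior\<close>

text \<open>The cells of the solid torus that lie in its interior cover it.\<close>

lemma interior_torus_cell:
  assumes "z \<in> circle" "w \<in> open_disc"
  obtains c n where "(c, n) \<in> torus_cells" "(z, w) \<in> c" "c \<subseteq> circle \<times> open_disc"
proof -
  let ?S = "circle - {1}" and ?I = "of_real ` {0<..<1::real} :: complex set" and ?D = "open_disc - of_real ` {0..<1::real} :: complex set"
  have I: "?I \<subseteq> open_disc" and I0: "{0} \<subseteq> open_disc" and z1: "{1} \<subseteq> circle" by auto
  have w: "w = 0 \<or> w \<in> ?I \<or> w \<in> ?D"
  proof (cases "w \<in> of_real ` {0..<1::real}")
    case True
    then obtain t :: real where "w = of_real t" "0 \<le> t" "t < 1" by auto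
    then show ?thesis by (cases "t = 0") auto
  qed (use assms in auto)
  have z: "z = 1 \<or> z \<in> ?S" using assms by auto
  have t: "({1} \<times> {0}, 0) \<in> torus_cells" "({1} \<times> ?I, 1) \<in> torus_cells" "(?S \<times> {0}, 1) \<in> torus_cells"
     "(?S \<times> ?I, 2) \<in> torus_cells" "({1} \<times> ?D, 2) \<in> torus_cells" "(?S \<times> ?D, 3) \<in> torus_cells"
    unfolding torus_cells_def Let_def by simp_all
  consider "z = 1" "w = 0" | "z = 1" "w \<in> ?I" | "z = 1" "w \<in> ?D" | "z \<in> ?S" "w = 0" | "z \<in> ?S" "w \<in> ?I" | "z \<in> ?S" "w \<in> ?D"
    using w z by blast
  then show thesis
  proof cases
    case 1 show thesis by (rule that[OF t(1) _ Sigma_mono[OF z1 I0]]) (use 1 in simp)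
  next case 2 show thesis by (rule that[OF t(2) _ Sigma_mono[OF z1 I]]) (use 2 in blast)
  next case 3 show thesis by (rule that[OF t(5) _ Sigma_mono[OF z1 Diff_subset]]) (use 3 in blast)
  next case 4 show thesis by (rule that[OF t(3) _ Sigma_mono[OF Diff_subset I0]]) (use 4 in blast)
  next case 5 show thesis by (rule that[OF t(4) _ Sigma_mono[OF Diff_subset I]]) (use 5 in blast)
  next case 6 show thesis by (rule that[OF t(6) _ Sigma_mono[OF Diff_subset Diff_subset]]) (use 6 in blast)
  qed
qed

locale celled_orbifold = link_orbifold Y for Y :: "'a orbifold3" +
  fixes \<C> :: "'a set set" and d :: "'a set \<Rightarrow> nat"
  assumes cells: "orbifold_cell_decomposition Y \<C> d"
begin

lemma cells_finite: "finite \<C>" and cells_disjoint: "disjoint \<C>" and cells_cover: "\<Union>\<C> = topspace M"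
  using cells by (auto simp: orbifold_cell_decomposition_def cell_decomposition_def)

lemma cell_map:
  assumes "e \<in> \<C>"
  obtains \<Phi> where "continuous_map (closed_cell (d e)) M \<Phi>" "homeomorphic_map (open_cell (d e)) (subtopology M e) \<Phi>"
  using cells assms unfolding orbifold_cell_decomposition_def cell_decomposition_def by blast

lemma tube_cell: "\<lbrakk>i \<in> comps Y; (c, n) \<in> torus_cells\<rbrakk> \<Longrightarrow> nbhd Y i ` c \<in> \<C> \<and> d (nbhd Y i ` c) = n"
  using cells unfolding orbifold_cell_decomposition_def by fastforce

lemma cells_eq: "\<lbrakk>e \<in> \<C>; e' \<in> \<C>; x \<in> e; x \<in> e'\<rbrakk> \<Longrightarrow> e = e'"
  using cells_disjoint unfolding disjoint_def by blast

text \<open>The open tubes are unions of cells, so a cell that meets the exterior is contained in it.\<close>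

lemma cell_exterior:
  assumes "e \<in> \<C>" "x \<in> e" "x \<in> exterior Y"
  shows "e \<subseteq> exterior Y"
proof (rule ccontr)
  assume "\<not> e \<subseteq> exterior Y"
  then obtain y where y: "y \<in> e" "y \<notin> exterior Y" by blast
  have "y \<in> topspace M" using y(1) assms(1) cells_cover by blast
  then obtain i where i: "i \<in> comps Y" "y \<in> nbhd Y i ` (circle \<times> open_disc)"
    using y(2) unfolding exterior_def by blast
  then obtain z w where zw: "z \<in> circle" "w \<in> open_disc" "y = nbhd Y i (z, w)" by blast
  obtain c n where c: "(c, n) \<in> torus_cells" "(z, w) \<in> c" "c \<subseteq> circle \<times> open_disc"
    using zw(1,2) by (rule interior_torus_cell)
  have "e = nbhd Y i ` c"
    by (rule cells_eq[OF assms(1) _ y(1)]) (use tube_cell[OF i(1) c(1)] c(2) zw(3) in auto)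
  then have "x \<in> nbhd Y i ` (circle \<times> open_disc)" using assms(2) c(3) by (metis image_mono subsetD)
  then show False using assms(3) i(1) unfolding exterior_def by blast
qed

text \<open>The exterior is the union of finitely many closed cells.  This is where the cell decomposition enters the
  construction of the lifts: the boundary of a tube may be wildly embedded as seen from the exterior, so that local
  path-connectedness of the manifold alone would not be enough.\<close>

lemma exterior_locally_path_connected: "locally_path_connected_space (exterior_space Y)"
proof -
  define I where "I = {e \<in> \<C>. e \<subseteq> exterior Y}"
  have "\<forall>e\<in>I. \<exists>\<Phi>. continuous_map (closed_cell (d e)) M \<Phi> \<and> homeomorphic_map (open_cell (d e)) (subtopology M e) \<Phi>"
    using cell_map unfolding I_def by (metis (no_types, lifting) mem_Collect_eq)
  from bchoice[OF this] obtain \<Phi> where Phi: "\<forall>e\<in>I. continuous_map (closed_cell (d e)) M (\<Phi> e) \<and> homeomorphic_map (open_cell (d e)) (subtopology M e) (\<Phi> e)"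
    by (rule exE)
  have eM: "e \<subseteq> topspace M" if "e \<in> I" for e using that cells_cover by (auto simp: I_def)
  have im: "\<Phi> e ` topspace (open_cell (d e)) = e" if "e \<in> I" for e
    using homeomorphic_imp_surjective_map[of "open_cell (d e)" "subtopology M e" "\<Phi> e"] Phi that eM[OF that]
    by (simp add: Int_absorb1)
  have ext: "\<Phi> e x \<in> exterior Y" if e: "e \<in> I" and x: "x \<in> topspace (closed_cell (d e))" for e x
  proof (rule closed_cell_into_closed[OF _ exterior_closed _ x])
    show "continuous_map (closed_cell (d e)) M (\<Phi> e)" using Phi e by blast
    show "\<Phi> e y \<in> exterior Y" if "y \<in> topspace (open_cell (d e))" for y
      using im[OF e] that e unfolding I_def by blast
  qed
  have extM: "exterior Y \<subseteq> topspace M" by (auto simp: exterior_def)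
  show ?thesis
  proof (rule locally_path_connected_finite_union)
    show "finite I" using cells_finite by (simp add: I_def)
    show "continuous_map (closed_cell (d e)) (exterior_space Y) (\<Phi> e)" if "e \<in> I" for e
      using Phi that ext[OF that] by (auto simp: continuous_map_in_subtopology)
    show "compact_space (closed_cell (d e))" "locally_path_connected_space (closed_cell (d e))" for e :: "'a set"
      by (rule closed_cell_compact closed_cell_locally_path_connected)+
    show "Hausdorff_space (exterior_space Y)" using Hausdorff by (rule Hausdorff_space_subtopology)
    have "exterior Y \<subseteq> (\<Union>e\<in>I. \<Phi> e ` topspace (closed_cell (d e)))"
    proof
      fix x assume x: "x \<in> exterior Y"
      then obtain e where e: "e \<in> \<C>" "x \<in> e" using cells_cover extM by blast
      then have eI: "e \<in> I" using cell_exterior[OF e x] by (simp add: I_def)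
      then have "x \<in> \<Phi> e ` topspace (open_cell (d e))" using im e(2) by simp
      then show "x \<in> (\<Union>e\<in>I. \<Phi> e ` topspace (closed_cell (d e)))" using eI by auto
    qed
    moreover have "(\<Union>e\<in>I. \<Phi> e ` topspace (closed_cell (d e))) \<subseteq> exterior Y" using ext by blast
    ultimately show "topspace (exterior_space Y) = (\<Union>e\<in>I. \<Phi> e ` topspace (closed_cell (d e)))"
      using extM by auto
  qed
qed

end

context link_orbifold
begin

abbreviation X where "X \<equiv> exterior_space Y"
abbreviation HX where "HX \<equiv> homology_group 1 (exterior_space Y)"
abbreviation H where "H \<equiv> homology_group 1 (under Y)"
abbreviation incl where "incl \<equiv> hom_induced 1 (exterior_space Y) {} (under Y) {} id"

lemma incl_cont: "continuous_map X M id"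
  by (simp add: continuous_map_from_subtopology)

lemma incl_group_hom: "group_hom HX H incl"
  by (simp add: group_hom_def group_hom_axioms_def hom_induced_empty_hom)

lemma incl_loop: "\<lbrakk>pathin X \<gamma>; \<gamma> 0 = \<gamma> 1\<rbrakk> \<Longrightarrow> incl (loop_class X \<gamma>) = loop_class M \<gamma>"
  using hom_induced_loop_class[OF _ _ incl_cont, of \<gamma>] by simp

lemma circle_path_cont:
  assumes i: "i \<in> comps Y" and f: "continuous_on {0..1::real} f" "\<And>t. t \<in> {0..1} \<Longrightarrow> f t \<in> circle \<times> circle"
  shows "pathin X (\<lambda>t. nbhd Y i (f t))"
proof -
  have sub: "circle \<times> circle \<subseteq> circle \<times> disc" by auto
  have "continuous_map (top_of_set {0..1}) (top_of_set (circle \<times> disc)) f"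
    using f sub by (auto simp: continuous_map_in_subtopology Pi_iff)
  from continuous_map_compose[OF this nbhd_cont[OF i]]
  have "continuous_map (top_of_set {0..1}) M (\<lambda>t. nbhd Y i (f t))" by (simp add: o_def)
  moreover have "nbhd Y i (f t) \<in> exterior Y" if t: "t \<in> {0..1}" for t
  proof -
    obtain z w where zw: "f t = (z, w)" "z \<in> circle" "w \<in> circle" using f(2)[OF t] by blast
    have "w \<in> disc" using zw(3) by auto
    then show ?thesis using nbhd_exterior[OF i zw(2)] zw by simp
  qed
  ultimately show ?thesis by (simp add: pathin_def continuous_map_in_subtopology)
qed

lemma meridian_path:
  assumes "i \<in> comps Y" "z \<in> circle"
  shows "pathin X (\<lambda>t. nbhd Y i (z, cis (2 * pi * t)))"
  using assms by (intro circle_path_cont) (auto intro!: continuous_intros)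

lemma parallel_path:
  assumes "i \<in> comps Y"
  shows "pathin X (\<lambda>t. nbhd Y i (cis (2 * pi * t), 1))"
  using assms by (intro circle_path_cont) (auto intro!: continuous_intros)

end

locale orbifold_covers = orbifold_H1_cover Y Q q act' + celled_orbifold Y \<C> d
  for Y :: "'a orbifold3" and Q :: "'c topology" and q :: "'c \<Rightarrow> 'a" and act' \<C> d +
  fixes P :: "'b topology" and p :: "'b \<Rightarrow> 'a" and act
  assumes orb_cover: "H1_orb_cover Y P p act"
    and compact: "compact_space (under Y)"
begin

abbreviation G where "G \<equiv> H1_orb Y"
abbreviation \<phi> where "\<phi> \<equiv> H1_orb_to_H1 Y"
abbreviation PX where "PX \<equiv> subtopology P {x. p x \<in> exterior Y}"
abbreviation QX where "QX \<equiv> subtopology Q {x. q x \<in> exterior Y}"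

sublocale incl: group_hom HX H incl by (rule incl_group_hom)

lemma meridian_power:
  assumes i: "i \<in> comps Y"
  shows "loop_class X (meridian Y i) [^]\<^bsub>HX\<^esub> mult Y i \<in> carrier HX"
    "incl (loop_class X (meridian Y i) [^]\<^bsub>HX\<^esub> mult Y i) = \<one>\<^bsub>H\<^esub>"
proof -
  have m: "meridian Y i = (\<lambda>t. nbhd Y i (1, cis (2 * pi * t)))" by (rule ext) (simp add: meridian_def)
  have path: "pathin X (meridian Y i)" "meridian Y i 0 = meridian Y i 1"
    unfolding m using meridian_path[OF i, of 1] by (simp_all add: cis_2pi)
  have c: "loop_class X (meridian Y i) \<in> carrier HX" using path by (rule loop_class_carrier)
  then show "loop_class X (meridian Y i) [^]\<^bsub>HX\<^esub> mult Y i \<in> carrier HX" by simp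
  have "incl (loop_class X (meridian Y i)) = loop_class M (meridian Y i)" using path by (rule incl_loop)
  also have "\<dots> = \<one>\<^bsub>H\<^esub>" unfolding m using meridian_class[OF i, of 1] by simp
  finally show "incl (loop_class X (meridian Y i) [^]\<^bsub>HX\<^esub> mult Y i) = \<one>\<^bsub>H\<^esub>"
    using c by (simp add: incl.hom_nat_pow)
qed

lemma meridian_subgroup_normal: "meridian_subgroup Y \<lhd> HX"
proof -
  have "subgroup (meridian_subgroup Y) HX"
    unfolding meridian_subgroup_def using meridian_power(1) by (intro group.generate_is_subgroup) auto
  then show ?thesis by (simp add: comm_group.normal_iff_subgroup)
qed

sublocale ms: normal "meridian_subgroup Y" HX by (rule meridian_subgroup_normal)

text \<open>Meridians are trivial in the manifold, so the map \<open>H1_orb_to_H1\<close> is well defined on cosets.\<close>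

lemma incl_meridian_subgroup: "x \<in> meridian_subgroup Y \<Longrightarrow> incl x = \<one>\<^bsub>H\<^esub>"
proof -
  have "meridian_subgroup Y \<subseteq> kernel HX H incl"
    unfolding meridian_subgroup_def using meridian_power
    by (intro group.generate_subgroup_incl incl.subgroup_kernel) (auto simp: kernel_def)
  then show "x \<in> meridian_subgroup Y \<Longrightarrow> incl x = \<one>\<^bsub>H\<^esub>" by (auto simp: kernel_def)
qed

sublocale G: comm_group G
  unfolding H1_orb_def using ms.subgroup_axioms by (intro comm_group.abelian_FactGroup) simp_all

lemma carrier_G: "carrier G = {meridian_subgroup Y #>\<^bsub>HX\<^esub> x |x. x \<in> carrier HX}"
  unfolding H1_orb_def FactGroup_def RCOSETS_def by auto

lemma phi_coset:
  assumes x: "x \<in> carrier HX"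
  shows "\<phi> (meridian_subgroup Y #>\<^bsub>HX\<^esub> x) = incl x"
proof -
  have "incl ` (meridian_subgroup Y #>\<^bsub>HX\<^esub> x) = {incl x}"
  proof -
    have "incl (m \<otimes>\<^bsub>HX\<^esub> x) = incl x" if "m \<in> meridian_subgroup Y" for m
      using incl_meridian_subgroup[OF that] ms.mem_carrier[OF that] x by simp
    moreover have "meridian_subgroup Y \<noteq> {}" using ms.one_closed by blast
    ultimately show ?thesis unfolding r_coset_def by auto
  qed
  then show ?thesis by (simp add: H1_orb_to_H1_def)
qed

lemma phi_hom: "\<phi> \<in> hom G H"
proof (rule homI)
  fix C assume "C \<in> carrier G"
  then show "\<phi> C \<in> carrier H" using phi_coset by (auto simp: carrier_G)
next
  fix C C' assume "C \<in> carrier G" "C' \<in> carrier G"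
  then obtain x y where xy: "x \<in> carrier HX" "y \<in> carrier HX" "C = meridian_subgroup Y #>\<^bsub>HX\<^esub> x" "C' = meridian_subgroup Y #>\<^bsub>HX\<^esub> y"
    unfolding carrier_G by blast
  have "C \<otimes>\<^bsub>G\<^esub> C' = meridian_subgroup Y #>\<^bsub>HX\<^esub> (x \<otimes>\<^bsub>HX\<^esub> y)"
    using xy ms.rcos_sum by (simp add: H1_orb_def FactGroup_def)
  then show "\<phi> (C \<otimes>\<^bsub>G\<^esub> C') = \<phi> C \<otimes>\<^bsub>H\<^esub> \<phi> C'" using xy phi_coset by simp
qed

sublocale phi: group_hom G H \<phi>
  using phi_hom by unfold_locales

lemma orb_loop_class:
  assumes "pathin X \<gamma>" "\<gamma> 0 = \<gamma> 1"
  shows "orb_loop_class Y \<gamma> \<in> carrier G" "\<phi> (orb_loop_class Y \<gamma>) = loop_class M \<gamma>"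
proof -
  have c: "loop_class X \<gamma> \<in> carrier HX" using assms by (rule loop_class_carrier)
  then show "orb_loop_class Y \<gamma> \<in> carrier G" unfolding orb_loop_class_def carrier_G by blast
  show "\<phi> (orb_loop_class Y \<gamma>) = loop_class M \<gamma>"
    unfolding orb_loop_class_def using phi_coset[OF c] incl_loop[OF assms] by simp
qed

lemma P_cont: "continuous_map P M p"
  and P_deck: "deck_action G P p act"
  and P_regular: "regular_cover G (orb_loop_class Y) X PX p act"
  and P_tubes: "i \<in> comps Y \<Longrightarrow> orbifold_covering_nbhd Y i P p"
  using orb_cover unfolding H1_orb_cover_def by auto

sublocale PX: deck_cover G "orb_loop_class Y" X PX p act
  using P_regular by unfold_locales

lemma exterior_nonempty: "topspace X \<noteq> {}"
proof -
  obtain x where x: "x \<in> topspace M" using nonempty by blast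
  have eM: "exterior Y \<subseteq> topspace M" by (auto simp: exterior_def)
  show ?thesis
  proof (cases "x \<in> exterior Y")
    case True
    then show ?thesis using x by auto
  next
    case False
    then obtain i where i: "i \<in> comps Y" using x tubes_exterior_cover by auto
    then have "nbhd Y i (1, 1) \<in> exterior Y" using nbhd_exterior[OF i, of 1 1] by simp
    then show ?thesis using eM by auto
  qed
qed

text \<open>A closed path of \<open>P\<close> over the exterior has class \<open>1\<close> in the orbifold homology, hence in the homology of \<open>M\<close>.\<close>

lemma exterior_lift:
  obtains F where "continuous_map PX Q F" "\<forall>x\<in>topspace PX. q (F x) = p x"
proof -
  obtain b where b: "b \<in> topspace X" using exterior_nonempty by blast
  then obtain x0 where x0: "x0 \<in> topspace PX" using PX.p_surj by blast
  then have "p x0 \<in> topspace M" using PX.p_closed[OF x0] by simp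
  then obtain e0 where e0: "e0 \<in> topspace Q" "q e0 = p x0" using p_surj by (metis imageE)
  have f: "continuous_map PX M p" using P_cont by (rule continuous_map_from_subtopology)
  show thesis
  proof (rule lift_if_loops_trivial[OF f PX.path_connected _ _ x0 e0])
    show "locally_path_connected_space PX"
      using PX.covering exterior_locally_path_connected by (rule covering_locally_path_connected)
    fix \<gamma> assume g: "pathin PX \<gamma>" "\<gamma> 0 = \<gamma> 1"
    have "\<gamma> 1 = act \<one>\<^bsub>G\<^esub> (\<gamma> 0)" using PX.act_one[OF path_start_in_topspace[OF g(1)]] g(2) by simp
    then have 1: "orb_loop_class Y (p \<circ> \<gamma>) = \<one>\<^bsub>G\<^esub>" by (rule PX.path_class[OF G.one_closed g(1)])
    have "pathin X (p \<circ> \<gamma>)" using g(1) PX.p_cont by (rule pathin_compose)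
    from orb_loop_class(2)[OF this] 1 g(2) show "loop_class M (p \<circ> \<gamma>) = \<one>\<^bsub>H\<^esub>" by simp
  qed (use that in blast)
qed

text \<open>Join \<open>x\<close> to its translate by a path.  The class of its projection determines \<open>g\<close> through \<open>P\<close>, and the
  element of \<open>H\<close> that relates the images through \<open>Q\<close>.\<close>

lemma exterior_lift_equivariant:
  assumes F: "continuous_map PX Q F" "\<forall>x\<in>topspace PX. q (F x) = p x"
    and x: "x \<in> topspace PX" and g: "g \<in> carrier G"
  shows "F (act g x) = act' (\<phi> g) (F x)"
proof -
  have gx: "act g x \<in> topspace PX" using PX.act_closed[OF g x] .
  then obtain \<gamma> where \<gamma>: "pathin PX \<gamma>" "\<gamma> 0 = x" "\<gamma> 1 = act g x"
    using PX.path_connected x unfolding path_connected_space_def by blast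
  have cl: "(p \<circ> \<gamma>) 0 = (p \<circ> \<gamma>) 1" using \<gamma> PX.p_act[OF g x] by simp
  have og: "orb_loop_class Y (p \<circ> \<gamma>) = g" using PX.path_class[OF g \<gamma>(1)] \<gamma> by simp
  have pX: "pathin X (p \<circ> \<gamma>)" using \<gamma>(1) PX.p_cont by (rule pathin_compose)
  have 1: "loop_class M (p \<circ> \<gamma>) = \<phi> g" unfolding og[symmetric] by (rule orb_loop_class(2)[OF pX cl, symmetric])
  have Fx: "F x \<in> topspace Q" "F (act g x) \<in> topspace Q" using F(1) x gx by (auto simp: continuous_map_def Pi_iff)
  moreover have "q (F x) = q (F (act g x))" using F(2) x gx PX.p_act[OF g x] by simp
  ultimately obtain h where h: "h \<in> carrier H" "act' h (F x) = F (act g x)" by (rule act_trans)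
  have Fg: "pathin Q (F \<circ> \<gamma>)" using \<gamma>(1) F(1) by (rule pathin_compose)
  have "(F \<circ> \<gamma>) 1 = act' h ((F \<circ> \<gamma>) 0)" using \<gamma> h(2) by simp
  then have "loop_class M (q \<circ> (F \<circ> \<gamma>)) = h" by (rule path_class[OF h(1) Fg])
  moreover have "loop_class M (q \<circ> (F \<circ> \<gamma>)) = loop_class M (p \<circ> \<gamma>)"
  proof (rule loop_class_cong)
    fix t :: real assume "t \<in> {0..1}"
    then have "\<gamma> t \<in> topspace PX" using \<gamma>(1) by (auto simp: pathin_def continuous_map_def Pi_iff)
    then show "(q \<circ> (F \<circ> \<gamma>)) t = (p \<circ> \<gamma>) t" using F(2) by simp
  qed
  ultimately show ?thesis using 1 h(2) by simp
qed

text \<open>The image of the lift over the exterior is open; its translates by elements outside \<open>\<phi> ` carrier G\<close> are open as well,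
  disjoint from it, and form the rest of \<open>QX\<close>.  Since \<open>QX\<close> is connected, there are none.\<close>

lemma phi_surj: "\<phi> ` carrier G = carrier H"
proof -
  obtain F where F: "continuous_map PX Q F" "\<forall>x\<in>topspace PX. q (F x) = p x" by (rule exterior_lift)
  have Fx: "F x \<in> topspace Q" if "x \<in> topspace PX" for x using F(1) that by (auto simp: continuous_map_def Pi_iff)
  have FX: "F x \<in> topspace QX" if "x \<in> topspace PX" for x using Fx[OF that] bspec[OF F(2) that] that by simp
  define K where "K = F ` topspace PX"
  have KQ: "K \<subseteq> topspace QX" using FX unfolding K_def by blast
  have Qact: "act' g y \<in> topspace QX" if "g \<in> carrier H" "y \<in> topspace QX" for g y
    using that act_closed[of g y] p_act[of g y] by simp
  have translate: "\<exists>g\<in>carrier H. \<exists>x\<in>topspace PX. y = act' g (F x)" if y: "y \<in> topspace QX" for y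
  proof -
    have "q y \<in> topspace X" using y p_closed by simp
    then obtain x where x: "x \<in> topspace PX" "q y = p x" using PX.p_surj by (metis imageE)
    then have "q (F x) = q y" using F(2) by simp
    then obtain g where "g \<in> carrier H" "act' g (F x) = y" using act_trans[OF Fx[OF x(1)], of y] y by auto
    then show ?thesis using x(1) by blast
  qed
  have same: "g \<in> \<phi> ` carrier G" if g: "g \<in> carrier H" and x: "x \<in> topspace PX" "x' \<in> topspace PX" and eq: "act' g (F x) = F x'" for g x x'
  proof -
    have "p x = p x'" using F(2) x eq p_act[OF g Fx[OF x(1)]] by metis
    then obtain h where h: "h \<in> carrier G" "act h x = x'" using PX.act_trans[OF x] by blast
    then have "act' (\<phi> h) (F x) = act' g (F x)" using exterior_lift_equivariant[OF F x(1) h(1)] eq by simp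
    then have "\<phi> h = g" using act_inj[OF _ g Fx[OF x(1)], of "\<phi> h"] h(1) by simp
    then show ?thesis using h(1) by blast
  qed
  have FQX: "continuous_map PX QX F"
    unfolding continuous_map_in_subtopology using F(1) FX by auto
  have "open_map PX QX F"
    by (rule lift_between_coverings_open[OF PX.covering covering_restrict[OF covering] FQX F(2)])
  then have Kopen: "openin QX K"
    unfolding K_def open_map_def by blast
  have homeo: "homeomorphic_map QX QX (act' g)" if g: "g \<in> carrier H" for g
    using homeomorphic_map_subtopologies_alt[OF act_homeo[OF g], of "{x. q x \<in> exterior Y}" "{x. q x \<in> exterior Y}"]
      p_act[OF g] by auto
  have "topspace QX - K = (\<Union>g\<in>carrier H - \<phi> ` carrier G. act' g ` K)"
  proof (intro equalityI subsetI)
    fix y assume y: "y \<in> topspace QX - K"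
    then obtain g x where gx: "g \<in> carrier H" "x \<in> topspace PX" "y = act' g (F x)" using translate by blast
    have "g \<notin> \<phi> ` carrier G"
    proof
      assume "g \<in> \<phi> ` carrier G"
      then obtain h where h: "h \<in> carrier G" "g = \<phi> h" by blast
      then have "y = F (act h x)" using gx exterior_lift_equivariant[OF F gx(2) h(1)] by simp
      then show False using y PX.act_closed[OF h(1) gx(2)] unfolding K_def by blast
    qed
    then show "y \<in> (\<Union>g\<in>carrier H - \<phi> ` carrier G. act' g ` K)" using gx unfolding K_def by blast
  next
    fix y assume "y \<in> (\<Union>g\<in>carrier H - \<phi> ` carrier G. act' g ` K)"
    then obtain g x where gx: "g \<in> carrier H" "g \<notin> \<phi> ` carrier G" "x \<in> topspace PX" "y = act' g (F x)"
      unfolding K_def by blast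
    have "y \<notin> K"
    proof
      assume "y \<in> K"
      then obtain x' where "x' \<in> topspace PX" "y = F x'" unfolding K_def by blast
      then show False using same[OF gx(1) gx(3)] gx(2,4) by metis
    qed
    then show "y \<in> topspace QX - K" using Qact[OF gx(1) FX[OF gx(3)]] gx(4) by simp
  qed
  moreover have "openin QX (\<Union>g\<in>carrier H - \<phi> ` carrier G. act' g ` K)"
  proof (rule openin_Union, clarify)
    fix g assume g: "g \<in> carrier H"
    show "openin QX (act' g ` K)" using homeomorphic_map_openness_eq[OF homeo[OF g]] Kopen KQ by blast
  qed
  ultimately have "closedin QX K" using KQ by (simp add: closedin_def)
  moreover have "K \<noteq> {}"
    using exterior_nonempty PX.p_surj unfolding K_def by blast
  ultimately have KX: "K = topspace QX"
    using exterior_cover_connected Kopen unfolding connected_space_clopen_in by blast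
  show ?thesis
  proof (intro equalityI subsetI)
    fix g assume "g \<in> \<phi> ` carrier G"
    then show "g \<in> carrier H" using phi.hom_closed by blast
  next
    fix g assume g: "g \<in> carrier H"
    obtain x where x: "x \<in> topspace PX" using exterior_nonempty PX.p_surj by blast
    have "act' g (F x) \<in> K" unfolding KX using Qact[OF g FX[OF x]] .
    then obtain x' where "x' \<in> topspace PX" "act' g (F x) = F x'" unfolding K_def by blast
    then show "g \<in> \<phi> ` carrier G" using same[OF g x] by blast
  qed
qed

lemma phi_iso:
  assumes "G \<cong> H"
  shows "\<phi> \<in> iso G H"
proof -
  obtain S where S: "finite S" "S \<subseteq> carrier H" "generate H S = carrier H"
    using finitely_generated[OF compact Hausdorff nonempty] by blast
  show ?thesis
    by (rule surjection_of_isomorphic_groups_iso[OF G.is_group _ S assms phi_hom phi_surj]) simp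
qed

end

section \<open>The orbifold cover over the tubes\<close>

text \<open>The factor \<open>w \<mapsto> w\<^sup>n\<close> is proper, being a continuous map of compact Hausdorff spaces, and so is its product with an
  identity map.\<close>

lemma disc_power_quotient:
  assumes "n > 0"
  shows "quotient_map (top_of_set (A \<times> disc)) (top_of_set (A \<times> disc)) (\<lambda>(z, w). (z, w ^ n))"
proof -
  have c: "continuous_map (top_of_set disc) (top_of_set disc) (\<lambda>w. w ^ n)"
    by (auto simp: continuous_map_in_subtopology norm_power power_le_one intro!: continuous_intros)
  have pr: "proper_map (top_of_set disc) (top_of_set disc) (\<lambda>w::complex. w ^ n)"
    by (rule continuous_imp_proper_map[OF _ _ c])
      (auto simp: compact_space_subtopology Hausdorff_imp_kc_space Hausdorff_space_subtopology)
  have "proper_map (prod_topology (top_of_set A) (top_of_set disc)) (prod_topology (top_of_set A) (top_of_set disc)) (\<lambda>(z, w). (id z, w ^ n))"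
    unfolding proper_map_prod using pr proper_map_id[of "top_of_set A"] by (simp add: id_def)
  then have cl: "closed_map (top_of_set (A \<times> disc)) (top_of_set (A \<times> disc)) (\<lambda>(z, w). (z, w ^ n))"
    by (simp add: proper_imp_closed_map)
  have ct: "continuous_map (top_of_set (A \<times> disc)) (top_of_set (A \<times> disc)) (\<lambda>(z, w). (z, w ^ n))"
    by (auto simp: continuous_map_in_subtopology norm_power power_le_one case_prod_beta intro!: continuous_intros)
  have root: "\<exists>w\<in>disc. w ^ n = v" if v: "v \<in> disc" for v :: complex
  proof -
    let ?w = "rcis (root n (cmod v)) (Arg v / n)"
    have "?w ^ n = v" using assms by (simp add: DeMoivre2 rcis_cmod_Arg)
    moreover have "cmod ?w \<le> 1" using v assms by (simp add: real_root_le_1_iff)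
    ultimately show ?thesis by (intro bexI[of _ ?w]) auto
  qed
  have "(\<lambda>(z, w). (z, w ^ n)) ` (A \<times> disc) = A \<times> disc"
  proof (intro equalityI subsetI)
    fix a assume "a \<in> A \<times> disc"
    then obtain z v where a: "a = (z, v)" "z \<in> A" "v \<in> disc" by blast
    then obtain w where "w \<in> disc" "w ^ n = v" using root by blast
    then show "a \<in> (\<lambda>(z, w). (z, w ^ n)) ` (A \<times> disc)" using a by force
  qed (auto simp: norm_power power_le_one)
  then show ?thesis using continuous_closed_imp_quotient_map[OF ct cl] by simp
qed

locale orbifold_covers_iso = orbifold_covers Y Q q act' \<C> d P p act
  for Y :: "'a orbifold3" and Q :: "'c topology" and q :: "'c \<Rightarrow> 'a" and act' \<C> d
    and P :: "'b topology" and p :: "'b \<Rightarrow> 'a" and act +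
  assumes iso: "H1_orb_to_H1 Y \<in> iso (H1_orb Y) (homology_group 1 (under Y))"
begin

lemma phi_inj: "\<lbrakk>g \<in> carrier G; \<phi> g = \<one>\<^bsub>H\<^esub>\<rbrakk> \<Longrightarrow> g = \<one>\<^bsub>G\<^esub>"
  using iso by (auto simp: Group.iso_def bij_betw_def phi.inj_on_one_iff)

text \<open>The lift \<open>t \<mapsto> c (cis (2 * pi * t / \<alpha>))\<close> of the meridian is closed, because the meridian is trivial in \<open>H\<close> and \<open>\<phi>\<close> is
  injective.  Thus \<open>\<Gamma>\<close> contains the primitive root of unity \<open>cis (2 * pi / \<alpha>)\<close>.\<close>

lemma local_group_full:
  assumes i: "i \<in> comps Y" and a: "a \<in> circle"
    and c: "continuous_map (top_of_set disc) P c" "\<forall>w\<in>disc. p (c w) = nbhd Y i (a, w ^ mult Y i)"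
    and Gam: "\<forall>\<zeta>\<in>\<Gamma>. \<forall>\<xi>\<in>\<Gamma>. \<zeta> * \<xi> \<in> \<Gamma>" "1 \<in> \<Gamma>"
    and ceq: "\<forall>w\<in>disc. \<forall>w'\<in>disc. c w = c w' \<longrightarrow> (\<exists>\<zeta>\<in>\<Gamma>. w' = \<zeta> * w)"
    and z: "\<zeta> ^ mult Y i = 1"
  shows "\<zeta> \<in> \<Gamma>"
proof -
  let ?n = "mult Y i"
  have n: "?n > 0" using mult_ge[OF i] by linarith
  define \<gamma> where "\<gamma> t = c (cis (2 * pi * t / ?n))" for t :: real
  have pg: "p (\<gamma> t) = nbhd Y i (a, cis (2 * pi * t))" for t
  proof -
    have "cis (2 * pi * t / ?n) ^ ?n = cis (2 * pi * t)" using Complex.DeMoivre[of "2 * pi * t / ?n" ?n] n by simp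
    then show ?thesis using c(2) by (simp add: \<gamma>_def)
  qed
  have "continuous_map (top_of_set {0..1}) (top_of_set disc) (\<lambda>t. cis (2 * pi * t / ?n))"
    using n by (auto simp: continuous_map_in_subtopology intro!: continuous_intros)
  from continuous_map_compose[OF this c(1)]
  have "pathin P \<gamma>" unfolding pathin_def \<gamma>_def[abs_def] by (simp add: o_def)
  moreover have "p (\<gamma> t) \<in> exterior Y" for t
    unfolding pg using nbhd_exterior[OF i a, of "cis (2 * pi * t)"] by simp
  ultimately have g: "pathin PX \<gamma>" by (simp add: pathin_subtopology)
  have "p (\<gamma> 0) = p (\<gamma> 1)" by (simp add: pg cis_2pi)
  then obtain h where h: "h \<in> carrier G" "act h (\<gamma> 0) = \<gamma> 1"
    using PX.act_trans[OF path_start_in_topspace[OF g] path_finish_in_topspace[OF g]] by metis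
  have oh: "orb_loop_class Y (p \<circ> \<gamma>) = h" using PX.path_class[OF h(1) g] h(2) by simp
  have pX: "pathin X (p \<circ> \<gamma>)" using g PX.p_cont by (rule pathin_compose)
  have "(p \<circ> \<gamma>) 0 = (p \<circ> \<gamma>) 1" by (simp add: pg cis_2pi)
  from orb_loop_class(2)[OF pX this] have "\<phi> h = loop_class M (p \<circ> \<gamma>)" unfolding oh .
  also have "p \<circ> \<gamma> = (\<lambda>t. nbhd Y i (a, cis (2 * pi * t)))" by (rule ext) (simp add: pg)
  also have "loop_class M \<dots> = \<one>\<^bsub>H\<^esub>" by (rule meridian_class[OF i a])
  finally have "h = \<one>\<^bsub>G\<^esub>" by (rule phi_inj[OF h(1)])
  then have "\<gamma> 0 = \<gamma> 1" using h(2) PX.act_one[OF path_start_in_topspace[OF g]] by simp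
  then have "c 1 = c (cis (2 * pi / ?n))" by (simp add: \<gamma>_def)
  moreover have "1 \<in> disc" "cis (2 * pi / ?n) \<in> disc" by simp_all
  ultimately obtain \<zeta>0 where "\<zeta>0 \<in> \<Gamma>" "cis (2 * pi / ?n) = \<zeta>0 * 1" using ceq by blast
  then have g0: "cis (2 * pi / ?n) \<in> \<Gamma>" by simp
  have pow: "cis (2 * pi / ?n) ^ k \<in> \<Gamma>" for k by (induction k) (use g0 Gam in auto)
  obtain k :: nat where "\<zeta> = cis (2 * pi * real k / real ?n)"
    using Complex.bij_betw_roots_unity[OF n] z unfolding bij_betw_def by blast
  then have "\<zeta> = cis (2 * pi / ?n) ^ k" using Complex.DeMoivre[of "2 * pi / ?n" k] by (simp add: ac_simps)
  then show ?thesis using pow by simp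
qed

text \<open>As the local groups are full, the charts of the orbifold cover identify exactly the points with the same image,
  so the sheets of the orbifold cover project homeomorphically.\<close>

lemma tube_sheets:
  assumes i: "i \<in> comps Y" and a: "a \<in> circle"
  obtains A \<V> where "openin (top_of_set circle) A" "a \<in> A"
    "\<Union>\<V> = {x \<in> topspace P. p x \<in> nbhd Y i ` (A \<times> disc)}" "disjoint \<V>"
    "\<forall>V\<in>\<V>. openin (subtopology P (\<Union>\<V>)) V \<and>
        homeomorphic_map (subtopology P V) (subtopology M (nbhd Y i ` (A \<times> disc))) p"
proof -
  have "\<exists>A \<V>. openin (top_of_set circle) A \<and> connected A \<and> a \<in> A \<and>
        \<Union>\<V> = {x \<in> topspace P. p x \<in> nbhd Y i ` (A \<times> disc)} \<and> disjoint \<V> \<and>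
        (\<forall>V\<in>\<V>. openin (subtopology P (\<Union>\<V>)) V \<and>
          (\<exists>\<Gamma> c. \<Gamma> \<subseteq> {\<zeta>. \<zeta> ^ mult Y i = 1} \<and> 1 \<in> \<Gamma> \<and> (\<forall>\<zeta>\<in>\<Gamma>. \<forall>\<xi>\<in>\<Gamma>. \<zeta> * \<xi> \<in> \<Gamma>) \<and>
             quotient_map (top_of_set (A \<times> disc)) (subtopology P V) c \<and>
             (\<forall>z\<in>A. \<forall>z'\<in>A. \<forall>w\<in>disc. \<forall>w'\<in>disc.
                c (z, w) = c (z', w') \<longleftrightarrow> z = z' \<and> (\<exists>\<zeta>\<in>\<Gamma>. w' = \<zeta> * w)) \<and>
             (\<forall>z\<in>A. \<forall>w\<in>disc. p (c (z, w)) = orb_chart Y i (z, w))))"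
    using P_tubes[OF i] a unfolding orbifold_covering_nbhd_def by (rule bspec)
  then obtain A \<V> where A: "openin (top_of_set circle) A" "a \<in> A"
    and V: "\<Union>\<V> = {x \<in> topspace P. p x \<in> nbhd Y i ` (A \<times> disc)}" "disjoint \<V>"
    and VV: "\<forall>V\<in>\<V>. openin (subtopology P (\<Union>\<V>)) V \<and>
          (\<exists>\<Gamma> c. \<Gamma> \<subseteq> {\<zeta>. \<zeta> ^ mult Y i = 1} \<and> 1 \<in> \<Gamma> \<and> (\<forall>\<zeta>\<in>\<Gamma>. \<forall>\<xi>\<in>\<Gamma>. \<zeta> * \<xi> \<in> \<Gamma>) \<and>
             quotient_map (top_of_set (A \<times> disc)) (subtopology P V) c \<and>
             (\<forall>z\<in>A. \<forall>z'\<in>A. \<forall>w\<in>disc. \<forall>w'\<in>disc.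
                c (z, w) = c (z', w') \<longleftrightarrow> z = z' \<and> (\<exists>\<zeta>\<in>\<Gamma>. w' = \<zeta> * w)) \<and>
             (\<forall>z\<in>A. \<forall>w\<in>disc. p (c (z, w)) = orb_chart Y i (z, w)))"
    by (elim exE conjE)
  let ?n = "mult Y i" and ?U = "nbhd Y i ` (A \<times> disc)"
  have n: "?n > 0" using mult_ge[OF i] by linarith
  have Ac: "A \<subseteq> circle" using A(1) openin_imp_subset by blast
  have AD: "A \<times> disc \<subseteq> circle \<times> disc" using Ac by auto
  have nU: "homeomorphic_map (top_of_set (A \<times> disc)) (subtopology M ?U) (nbhd Y i)"
  proof -
    have "homeomorphic_map (subtopology (top_of_set (circle \<times> disc)) (A \<times> disc)) (subtopology (subtopology M (tube Y i)) ?U) (nbhd Y i)"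
      by (rule homeomorphic_map_subtopologies[OF nbhd_homeo[OF i]])
        (use AD tube_subset[OF i] in \<open>auto simp: Int_absorb1 Int_absorb2 image_mono\<close>)
    moreover have "?U \<subseteq> tube Y i" using AD by (rule image_mono)
    ultimately show ?thesis using AD by (simp add: subtopology_subtopology Int_absorb1)
  qed
  have hom: "homeomorphic_map (subtopology P V) (subtopology M ?U) p" if VV': "V \<in> \<V>" for V
  proof -
    obtain \<Gamma> c where G1: "\<Gamma> \<subseteq> {\<zeta>. \<zeta> ^ mult Y i = 1}" "1 \<in> \<Gamma>" "\<forall>\<zeta>\<in>\<Gamma>. \<forall>\<xi>\<in>\<Gamma>. \<zeta> * \<xi> \<in> \<Gamma>"
      and quo: "quotient_map (top_of_set (A \<times> disc)) (subtopology P V) c"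
      and ceq: "\<forall>z\<in>A. \<forall>z'\<in>A. \<forall>w\<in>disc. \<forall>w'\<in>disc.
                c (z, w) = c (z', w') \<longleftrightarrow> z = z' \<and> (\<exists>\<zeta>\<in>\<Gamma>. w' = \<zeta> * w)"
      and pc: "\<forall>z\<in>A. \<forall>w\<in>disc. p (c (z, w)) = orb_chart Y i (z, w)"
      using bspec[OF VV VV'] by (elim exE conjE)
    have cc: "continuous_map (top_of_set (A \<times> disc)) (subtopology P V) c" using quo by (rule quotient_imp_continuous_map)
    have csurj: "c ` (A \<times> disc) = topspace (subtopology P V)" using quotient_imp_surjective_map[OF quo] by simp
    have pc': "p (c (z, w)) = nbhd Y i (z, w ^ ?n)" if "z \<in> A" "w \<in> disc" for z w
      using pc that by (simp add: orb_chart_def)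
    have full: "\<zeta> \<in> \<Gamma>" if "\<zeta> ^ ?n = 1" for \<zeta>
    proof (rule local_group_full[OF i a, where c = "\<lambda>w. c (a, w)"])
      have "continuous_map (top_of_set disc) (top_of_set (A \<times> disc)) (\<lambda>w. (a, w))"
        using A(2) by (auto simp: continuous_map_in_subtopology intro!: continuous_intros)
      from continuous_map_compose[OF this cc] show "continuous_map (top_of_set disc) P (\<lambda>w. c (a, w))"
        by (simp add: o_def continuous_map_in_subtopology)
      show "\<forall>w\<in>disc. p (c (a, w)) = nbhd Y i (a, w ^ ?n)" using pc' A(2) by blast
      show "\<forall>w\<in>disc. \<forall>w'\<in>disc. c (a, w) = c (a, w') \<longrightarrow> (\<exists>\<zeta>\<in>\<Gamma>. w' = \<zeta> * w)" using ceq A(2) by blast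
    qed (use G1 that in blast)+
    have quo2: "quotient_map (top_of_set (A \<times> disc)) (subtopology M ?U) (p \<circ> c)"
    proof (rule quotient_map_eq)
      show "quotient_map (top_of_set (A \<times> disc)) (subtopology M ?U) (nbhd Y i \<circ> (\<lambda>(z, w). (z, w ^ ?n)))"
        using disc_power_quotient[OF n] nU[unfolded homeomorphic_map_def, THEN conjunct1] by (rule quotient_map_compose)
      show "(nbhd Y i \<circ> (\<lambda>(z, w). (z, w ^ ?n))) x = (p \<circ> c) x" if "x \<in> topspace (top_of_set (A \<times> disc))" for x
        using that pc' by auto
    qed
    have VP: "V \<subseteq> {x. p x \<in> ?U}" using VV' V(1) by auto
    have pcont: "continuous_map (subtopology P V) (subtopology M ?U) p"
      using P_cont VP by (auto simp: continuous_map_in_subtopology continuous_map_from_subtopology)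
    have "quotient_map (subtopology P V) (subtopology M ?U) p"
      by (rule quotient_map_from_composition[OF cc pcont quo2])
    moreover have "inj_on p (topspace (subtopology P V))"
      unfolding csurj[symmetric]
    proof (intro inj_onI)
      fix x x' assume "x \<in> c ` (A \<times> disc)" "x' \<in> c ` (A \<times> disc)" and eq: "p x = p x'"
      then obtain z w z' w' where x: "x = c (z, w)" "z \<in> A" "w \<in> disc" "x' = c (z', w')" "z' \<in> A" "w' \<in> disc" by blast
      have "nbhd Y i (z, w ^ ?n) = nbhd Y i (z', w' ^ ?n)" using eq x pc' by simp
      then have "(z, w ^ ?n) = (z', w' ^ ?n)"
        by (rule inj_onD[OF nbhd_inj[OF i]]) (use x Ac in \<open>auto simp: norm_power power_le_one\<close>)
      then have zz: "z = z'" "w ^ ?n = w' ^ ?n" by auto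
      have "\<exists>\<zeta>\<in>\<Gamma>. w' = \<zeta> * w"
      proof (cases "w = 0")
        case True
        then have "w' = 0" using zz(2) n by (metis power_eq_0_iff zero_power)
        then show ?thesis using True G1(2) by auto
      next
        case False
        then have "(w' / w) ^ ?n = 1" unfolding power_divide zz(2)[symmetric] by simp
        then have "w' / w \<in> \<Gamma>" by (rule full)
        then show ?thesis using False by (intro bexI[of _ "w' / w"]) auto
      qed
      then show "x = x'" using ceq x zz(1) by simp
    qed
    ultimately show ?thesis by (simp add: homeomorphic_map_def)
  qed
  show thesis
    by (rule that[OF A V]) (use VV hom in blast)
qed

lemma P_tube_covering: "i \<in> comps Y \<Longrightarrow> tube_covering Y i P p"
proof unfold_locales
  assume i: "i \<in> comps Y"
  show "continuous_map P M p" by (rule P_cont)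
  let ?EN = "subtopology P {x. p x \<in> tube Y i}" and ?N = "subtopology M (tube Y i)"
  have N: "topspace ?N = tube Y i" using tube_subset[OF i] by auto
  have pN: "continuous_map ?EN ?N p"
    using P_cont by (auto simp: continuous_map_in_subtopology continuous_map_from_subtopology)
  have ev: "\<exists>U \<V>. openin ?N U \<and> y \<in> U \<and> \<Union>\<V> = {x \<in> topspace ?EN. p x \<in> U} \<and> disjoint \<V> \<and>
        (\<forall>V\<in>\<V>. openin ?EN V \<and> homeomorphic_map (subtopology ?EN V) (subtopology ?N U) p) \<and> y \<in> p ` topspace ?EN"
    if y: "y \<in> topspace ?N" for y
  proof -
    obtain a w where aw: "y = nbhd Y i (a, w)" "a \<in> circle" "w \<in> disc" using y N by auto
    obtain A \<V> where *: "openin (top_of_set circle) A" "a \<in> A"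
      "\<Union>\<V> = {x \<in> topspace P. p x \<in> nbhd Y i ` (A \<times> disc)}" "disjoint \<V>"
      "\<forall>V\<in>\<V>. openin (subtopology P (\<Union>\<V>)) V \<and>
        homeomorphic_map (subtopology P V) (subtopology M (nbhd Y i ` (A \<times> disc))) p"
      by (rule tube_sheets[OF i aw(2)])
    let ?U = "nbhd Y i ` (A \<times> disc)"
    have AD: "A \<times> disc \<subseteq> circle \<times> disc" using openin_imp_subset[OF *(1)] by auto
    have UN: "?U \<subseteq> tube Y i" using AD by (rule image_mono)
    have "openin (top_of_set (circle \<times> disc)) (A \<times> disc)" using *(1) by (simp add: openin_Times)
    then have U: "openin ?N ?U" using homeomorphic_map_openness_eq[OF nbhd_homeo[OF i], of "A \<times> disc"] AD by simp
    have W: "\<Union>\<V> = {x \<in> topspace ?EN. p x \<in> ?U}" using *(3) UN by auto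
    have Wo: "openin ?EN (\<Union>\<V>)" unfolding W using pN U by (rule openin_continuous_map_preimage)
    have sub: "V \<subseteq> {x. p x \<in> tube Y i}" if "V \<in> \<V>" for V using *(3) that UN by auto
    have V: "openin ?EN V \<and> homeomorphic_map (subtopology ?EN V) (subtopology ?N ?U) p" if VV: "V \<in> \<V>" for V
    proof
      have WT: "\<Union>\<V> \<subseteq> {x. p x \<in> tube Y i}" using sub by blast
      have "subtopology P (\<Union>\<V>) = subtopology ?EN (\<Union>\<V>)" using WT by (simp add: subtopology_subtopology Int_absorb1)
      then have "openin (subtopology ?EN (\<Union>\<V>)) V" using *(5) VV by metis
      then show "openin ?EN V" using Wo by (rule openin_trans_full)
      have "subtopology ?EN V = subtopology P V" using sub[OF VV] by (simp add: subtopology_subtopology Int_absorb1)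
      moreover have "subtopology ?N ?U = subtopology M ?U" using UN by (simp add: subtopology_subtopology Int_absorb1)
      ultimately show "homeomorphic_map (subtopology ?EN V) (subtopology ?N ?U) p" using *(5) VV by metis
    qed
    have "nbhd Y i (a, 1) \<in> topspace X"
      using nbhd_exterior[OF i aw(2), of 1] tube_subset[OF i] aw(2) by auto
    then obtain x where x: "x \<in> topspace PX" "nbhd Y i (a, 1) = p x" unfolding PX.p_surj[symmetric] by blast
    have "p x \<in> ?U" unfolding x(2)[symmetric] using *(2) by (intro imageI) simp
    then have "x \<in> \<Union>\<V>" unfolding *(3) using x(1) by simp
    then obtain V where VV: "V \<in> \<V>" by blast
    have "p ` topspace (subtopology ?EN V) = topspace (subtopology ?N ?U)"
      using V[OF VV] homeomorphic_imp_surjective_map by blast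
    moreover have "y \<in> ?U" using aw *(2) by auto
    ultimately have "y \<in> p ` topspace (subtopology ?EN V)" using y by simp
    then have "y \<in> p ` topspace ?EN" by auto
    then show ?thesis using U W *(4) V \<open>y \<in> ?U\<close> by (intro exI[of _ ?U] exI[of _ \<V>]) blast
  qed
  show "covering ?EN ?N p"
    unfolding covering_def
  proof (intro conjI ballI)
    show "p ` topspace ?EN = topspace ?N"
    proof (intro equalityI subsetI)
      fix y assume "y \<in> topspace ?N"
      from ev[OF this] show "y \<in> p ` topspace ?EN" by (elim exE conjE)
    qed (use pN in \<open>auto simp: continuous_map_def Pi_iff\<close>)
    fix y assume "y \<in> topspace ?N"
    from ev[OF this] show "\<exists>U \<V>. openin ?N U \<and> y \<in> U \<and> \<Union>\<V> = {x \<in> topspace ?EN. p x \<in> U} \<and> disjoint \<V> \<and>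
        (\<forall>V\<in>\<V>. openin ?EN V \<and> homeomorphic_map (subtopology ?EN V) (subtopology ?N U) p)"
      by (elim exE conjE, intro exI conjI)
  qed (rule pN)
  fix x c assume x: "x \<in> topspace P" and c: "c \<in> circle \<times> disc" "p x = nbhd Y i c"
  have fc: "fst c \<in> circle" "snd c \<in> disc" using c(1) by auto
  obtain A \<V> where *: "openin (top_of_set circle) A" "fst c \<in> A"
      "\<Union>\<V> = {x \<in> topspace P. p x \<in> nbhd Y i ` (A \<times> disc)}" "disjoint \<V>"
      "\<forall>V\<in>\<V>. openin (subtopology P (\<Union>\<V>)) V \<and>
        homeomorphic_map (subtopology P V) (subtopology M (nbhd Y i ` (A \<times> disc))) p"
    by (rule tube_sheets[OF i fc(1)])
  let ?U = "nbhd Y i ` (A \<times> disc)"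
  have AD: "A \<times> disc \<subseteq> circle \<times> disc" using openin_imp_subset[OF *(1)] by auto
  have cA: "c \<in> A \<times> disc" using *(2) fc by (simp add: mem_Times_iff)
  then have "x \<in> \<Union>\<V>" unfolding *(3) using x c by blast
  then obtain V where V: "V \<in> \<V>" "x \<in> V" by blast
  obtain s where s: "homeomorphic_maps (subtopology P V) (subtopology M ?U) p s"
    using *(5) V(1) homeomorphic_map_maps by blast
  have "?U \<subseteq> topspace M" using image_mono[OF AD] tube_subset[OF i] by (rule subset_trans)
  then have UM: "topspace (subtopology M ?U) = ?U" by (simp add: Int_absorb1)
  have sc: "continuous_map (subtopology M ?U) P s" and sp: "\<forall>x\<in>topspace (subtopology P V). s (p x) = x"
    and ps0: "\<forall>y\<in>topspace (subtopology M ?U). p (s y) = y"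
    using s by (auto simp: homeomorphic_maps_def continuous_map_in_subtopology)
  note ps = ps0[unfolded UM]
  have "continuous_map (top_of_set (A \<times> disc)) (subtopology M ?U) (nbhd Y i)"
    using continuous_map_from_subtopology[OF nbhd_cont[OF i], of "A \<times> disc"] AD
    by (simp add: continuous_map_in_subtopology subtopology_subtopology Int_absorb1)
  from continuous_map_compose[OF this sc]
  have "continuous_map (top_of_set (A \<times> disc)) P (s \<circ> nbhd Y i)" .
  moreover have "\<forall>a\<in>A \<times> disc. p ((s \<circ> nbhd Y i) a) = nbhd Y i a" using ps by auto
  moreover have "(s \<circ> nbhd Y i) c = x" using bspec[OF sp, of x] x V(2) c(2) by simp
  ultimately show "\<exists>A s. openin (top_of_set circle) A \<and> fst c \<in> A \<and> continuous_map (top_of_set (A \<times> disc)) P s \<and>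
        (\<forall>a\<in>A \<times> disc. p (s a) = nbhd Y i a) \<and> s c = x"
    using *(1,2) by blast
qed auto

end

section \<open>The identification of the two covers\<close>

context orbifold_covers_iso
begin

lemma P_closed: "x \<in> topspace P \<Longrightarrow> p x \<in> topspace M"
  using P_cont by (auto simp: continuous_map_def Pi_iff)

lemma pieces:
  assumes "b \<in> topspace M"
  obtains "b \<in> exterior Y" | i where "i \<in> comps Y" "b \<in> tube Y i"
  using assms tubes_exterior_cover by blast

lemma slice_in_exterior:
  assumes i: "i \<in> comps Y" and u: "disc_slice Y i P p z u" and w: "w \<in> circle"
  shows "u w \<in> topspace PX"
proof -
  interpret t: tube_covering Y i P p using P_tube_covering[OF i] .
  have wd: "w \<in> disc" using w by auto
  have z: "z \<in> circle" using u by (simp add: disc_slice_def)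
  show ?thesis using t.slice_coords[OF u wd] nbhd_exterior[OF i z wd] w by simp
qed

text \<open>The extension over a tube is determined by the condition that it sends slices to slices and agrees with \<open>F\<close> at the
  points over \<open>1\<close>.\<close>

definition tube_map :: "('b \<Rightarrow> 'c) \<Rightarrow> nat \<Rightarrow> 'b \<Rightarrow> 'c" where
  "tube_map F i x = tube_covering.extend Y i Q q (F (tube_covering.slide Y i P p x)) (snd (tube_coords Y i (p x)))"

context
  fixes F
  assumes F: "continuous_map PX Q F" "\<forall>x\<in>topspace PX. q (F x) = p x"
begin

text \<open>On the boundary circle of a slice the new map agrees with \<open>F\<close>, since both are lifts of the same circle that agree
  at one point.\<close>

lemma tube_map_slice:
  assumes i: "i \<in> comps Y" and u: "disc_slice Y i P p z u"
  obtains v where "disc_slice Y i Q q z v" "\<forall>w\<in>disc. tube_map F i (u w) = v w" "\<forall>w\<in>circle. F (u w) = v w"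
proof -
  interpret t: tube_covering Y i P p using P_tube_covering[OF i] .
  interpret s: tube_covering Y i Q q using tube_covering[OF i] .
  have z: "z \<in> circle" using u by (simp add: disc_slice_def)
  have u1: "u 1 \<in> topspace PX" by (rule slice_in_exterior[OF i u]) simp
  have Fu1: "F (u 1) \<in> topspace Q" using F(1) u1 by (auto simp: continuous_map_def Pi_iff)
  have "p (u 1) = nbhd Y i (z, 1)" using t.slice_coords(2)[OF u, of 1] by simp
  then have "q (F (u 1)) = nbhd Y i (z, 1)" using bspec[OF F(2) u1] by simp
  have "(1::complex) \<in> disc" by simp
  from Fu1 z this \<open>q (F (u 1)) = nbhd Y i (z, 1)\<close>
  obtain v where v: "disc_slice Y i Q q z v" "v 1 = F (u 1)" by (rule s.slice_exists)
  have 1: "tube_map F i (u w) = v w" if w: "w \<in> disc" for w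
    unfolding tube_map_def t.slide_slice[OF u w] t.slice_coords(3)[OF u w] v(2)[symmetric]
    using s.extend_slice[OF v(1) w] by simp
  have 2: "F (u w) = v w" if w: "w \<in> circle" for w
  proof (rule lifts_eq_on[OF covering, where X = euclidean and S = circle])
    have sub: "circle \<subseteq> disc" by auto
    have uc: "continuous_map (top_of_set circle) P u" and vc: "continuous_map (top_of_set circle) Q v"
      using continuous_map_from_subtopology[of "top_of_set disc" P u circle] continuous_map_from_subtopology[of "top_of_set disc" Q v circle]
        u v(1) sub by (simp_all add: disc_slice_def subtopology_subtopology Int_absorb1)
    have "continuous_map (top_of_set circle) PX u"
      using uc slice_in_exterior[OF i u] by (auto simp: continuous_map_in_subtopology)
    from continuous_map_compose[OF this F(1)] show "continuous_map (top_of_set circle) Q (\<lambda>w. F (u w))" by (simp add: o_def)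
    show "continuous_map (top_of_set circle) Q v" by (rule vc)
    show "connectedin euclidean circle" using connected_sphere[of "0::complex" 1] by simp
    show "(1::complex) \<in> circle" by simp
    show "F (u 1) = v 1" using v(2) by simp
    show "q (F (u x)) = q (v x)" if x: "x \<in> circle" for x
    proof -
      have xd: "x \<in> disc" using x by auto
      show ?thesis
        using bspec[OF F(2) slice_in_exterior[OF i u x]] t.slice_coords(2)[OF u xd] s.slice_coords(2)[OF v(1) xd] by simp
    qed
  qed (rule w)
  show thesis by (rule that[OF v(1)]) (use 1 2 in blast)+
qed

lemma tube_map_cont:
  assumes i: "i \<in> comps Y"
  shows "continuous_map (subtopology P {x. p x \<in> tube Y i}) Q (tube_map F i)"
proof -
  interpret t: tube_covering Y i P p using P_tube_covering[OF i] .
  interpret s: tube_covering Y i Q q using tube_covering[OF i] .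
  have sl: "t.slide x \<in> topspace PX" "p (t.slide x) \<in> nbhd Y i ` (circle \<times> {1})" if x: "x \<in> topspace t.EN" for x
  proof -
    obtain z w u where u: "disc_slice Y i P p z u" "w \<in> disc" "x = u w" "t.coords x = (z, w)"
      using x by (rule t.slice_through)
    have s: "t.slide x = u 1" using t.slide_slice[OF u(1,2)] u(3) by simp
    show "t.slide x \<in> topspace PX" unfolding s by (rule slice_in_exterior[OF i u(1)]) simp
    show "p (t.slide x) \<in> nbhd Y i ` (circle \<times> {1})"
      unfolding s using t.slice_coords(2)[OF u(1), of 1] u(1) by (simp add: disc_slice_def)
  qed
  have "continuous_map t.EN PX t.slide"
    unfolding continuous_map_in_subtopology using t.slide_cont sl(1) by auto
  from continuous_map_compose[OF this F(1)]
  have 1: "continuous_map t.EN Q (\<lambda>x. F (t.slide x))" by (simp add: o_def)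
  have "continuous_map (top_of_set (circle \<times> disc)) (top_of_set disc) snd"
    by (auto simp: continuous_map_in_subtopology intro!: continuous_intros)
  from continuous_map_compose[OF t.coords_p_cont this]
  have 2: "continuous_map t.EN (top_of_set disc) (\<lambda>x. snd (t.coords x))" by (simp add: o_def)
  have "continuous_map t.EN (prod_topology Q (top_of_set disc)) (\<lambda>x. (F (t.slide x), snd (t.coords x)))"
    using 1 2 by (rule continuous_map_pairedI)
  then have "continuous_map t.EN (subtopology (prod_topology Q (top_of_set disc)) {(b, w). q b \<in> nbhd Y i ` (circle \<times> {1})})
      (\<lambda>x. (F (t.slide x), snd (t.coords x)))"
    unfolding continuous_map_in_subtopology using sl F(2) by auto
  from continuous_map_compose[OF this s.extend_cont]
  show ?thesis by (simp add: o_def tube_map_def[abs_def])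
qed

lemma glued_map:
  obtains F' where "continuous_map P Q F'" "\<forall>x\<in>topspace P. q (F' x) = p x" "\<forall>x\<in>topspace PX. F' x = F x"
proof -
  \<comment> \<open>the index \<open>0\<close> stands for the exterior; tubes have positive indices\<close>
  define T where "T j = {x \<in> topspace P. p x \<in> (if j = 0 then exterior Y else tube Y j)}" for j :: nat
  define f where "f j = (if j = 0 then F else tube_map F j)" for j :: nat
  have T0: "T 0 = topspace PX" by (auto simp: T_def)
  have Ti: "x \<in> topspace (subtopology P {x. p x \<in> tube Y j})" if "x \<in> T j" "j \<in> comps Y" for x j
    using that by (auto simp: T_def)
  have sub: "subtopology P (T j) = subtopology P {x. p x \<in> (if j = 0 then exterior Y else tube Y j)}" for j
    unfolding T_def by (simp add: Collect_conj_eq subtopology_restrict)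
  have on: "tube_map F j x = F x" if j: "j \<in> comps Y" and x: "x \<in> T j" "x \<in> T 0" for j x
  proof -
    interpret t: tube_covering Y j P p using P_tube_covering[OF j] .
    obtain z w u where u: "disc_slice Y j P p z u" "w \<in> disc" "x = u w" "t.coords x = (z, w)"
      using Ti[OF x(1) j] by (rule t.slice_through)
    have z: "z \<in> circle" using u(1) by (simp add: disc_slice_def)
    have "p x \<in> exterior Y" using x(2) by (simp add: T_def)
    then have w: "w \<in> circle" using t.slice_coords(2)[OF u(1,2)] nbhd_exterior[OF j z u(2)] u(3) by simp
    obtain v where "\<forall>w\<in>disc. tube_map F j (u w) = v w" "\<forall>w\<in>circle. F (u w) = v w"
      using tube_map_slice[OF j u(1)] by metis
    then show ?thesis using w u(2,3) by simp
  qed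
  let ?I = "insert 0 (comps Y)"
  obtain F' where F': "continuous_map P Q F'" "\<And>x j. \<lbrakk>j \<in> ?I; x \<in> topspace P \<inter> T j\<rbrakk> \<Longrightarrow> F' x = f j x"
  proof (rule pasting_lemma_exists_closed[of ?I P T Q f])
    show "topspace P \<subseteq> \<Union>(T ` ?I)"
    proof
      fix x assume x: "x \<in> topspace P"
      from P_closed[OF x] show "x \<in> \<Union>(T ` ?I)"
      proof (rule pieces)
        assume "p x \<in> exterior Y"
        then have "x \<in> T 0" using x by (simp add: T_def)
        then show ?thesis by blast
      next
        fix i assume i: "i \<in> comps Y" "p x \<in> tube Y i"
        then have "x \<in> T i" using x by (simp add: T_def)
        then show ?thesis using i(1) by blast
      qed
    qed
    show "closedin P (T j)" if "j \<in> ?I" for j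
      unfolding T_def using that exterior_closed tube_closed
      by (intro closedin_continuous_map_preimage[OF P_cont]) auto
    show "continuous_map (subtopology P (T j)) Q (f j)" if "j \<in> ?I" for j
      unfolding sub f_def using that F(1) tube_map_cont by auto
    show "f i x = f j x" if ij: "i \<in> ?I" "j \<in> ?I" "x \<in> topspace P \<inter> T i \<inter> T j" for i j x
    proof -
      have x: "x \<in> T i" "x \<in> T j" using ij(3) by auto
      consider "i = j" | "i = 0" "j \<in> comps Y" | "j = 0" "i \<in> comps Y" | "i \<in> comps Y" "j \<in> comps Y" "i \<noteq> j"
        using ij(1,2) by blast
      then show ?thesis
      proof cases
        case 1 then show ?thesis by simp
      next
        case 2 then show ?thesis using on[OF 2(2)] x by (auto simp: f_def)
      next
        case 3 then show ?thesis using on[OF 3(2)] x by (auto simp: f_def)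
      next
        case 4
        then have "p x \<in> tube Y i \<inter> tube Y j" using x by (auto simp: T_def)
        then show ?thesis using tubes_disjoint[OF 4] by blast
      qed
    qed
  qed auto
  have ext: "F' x = F x" if "x \<in> topspace PX" for x
  proof -
    have "x \<in> topspace P \<inter> T 0" using that T0 by auto
    from F'(2)[OF _ this] show ?thesis by (simp add: f_def)
  qed
  have "q (F' x) = p x" if x: "x \<in> topspace P" for x
    using P_closed[OF x]
  proof (rule pieces)
    assume "p x \<in> exterior Y"
    then have "x \<in> topspace PX" using x by simp
    then show ?thesis using ext F(2) by simp
  next
    fix i assume i: "i \<in> comps Y" "p x \<in> tube Y i"
    interpret t: tube_covering Y i P p using P_tube_covering[OF i(1)] .
    interpret s: tube_covering Y i Q q using tube_covering[OF i(1)] .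
    have "x \<in> topspace t.EN" using i x by simp
    then obtain z w u where u: "disc_slice Y i P p z u" "w \<in> disc" "x = u w" "t.coords x = (z, w)"
      by (rule t.slice_through)
    obtain v where v: "disc_slice Y i Q q z v" "\<forall>w\<in>disc. tube_map F i (u w) = v w"
      using tube_map_slice[OF i(1) u(1)] by metis
    have i0: "i \<noteq> 0" using i(1) by auto
    have "x \<in> topspace P \<inter> T i" using i x i0 by (auto simp: T_def)
    from F'(2)[OF _ this] have "F' x = tube_map F i x" using i(1) i0 by (simp add: f_def)
    then have "F' x = v w" using v(2) u(2,3) by simp
    then show ?thesis using s.slice_coords(2)[OF v(1) u(2)] t.slice_coords(2)[OF u(1,2)] u(3) by simp
  qed
  then show thesis using that[OF F'(1)] ext by blast
qed

end

text \<open>Equivariance and injectivity are checked over the exterior and carried along slices by uniqueness of lifts;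
  surjectivity follows from equivariance and the surjectivity of \<open>\<phi>\<close>.  The map is closed, because over the exterior
  and over each tube it is an open bijection between covering spaces.\<close>

lemma identification_exists: "\<exists>F. cover_identification Y P p act Q q act' F"
proof -
  obtain F0 where F0: "continuous_map PX Q F0" "\<forall>x\<in>topspace PX. q (F0 x) = p x" by (rule exterior_lift)
  obtain F where Fc: "continuous_map P Q F" and qF: "\<forall>x\<in>topspace P. q (F x) = p x" and FF0: "\<forall>x\<in>topspace PX. F x = F0 x"
    by (rule glued_map[OF F0])
  have FQ: "F x \<in> topspace Q" if "x \<in> topspace P" for x using Fc that by (auto simp: continuous_map_def Pi_iff)
  have PXP: "x \<in> topspace P" if "x \<in> topspace PX" for x using that by simp
  have FX: "continuous_map PX Q F" using Fc by (rule continuous_map_from_subtopology)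
  have FXq: "\<forall>x\<in>topspace PX. q (F x) = p x" using qF by simp
  have actP: "act g x \<in> topspace P" "p (act g x) = p x" if "g \<in> carrier G" "x \<in> topspace P" for g x
    using P_deck that homeomorphic_imp_continuous_map[of P P "act g"]
    by (auto simp: deck_action_def continuous_map_def Pi_iff)
  have slice_image: "disc_slice Y i Q q z (\<lambda>w. F (u w))" if "disc_slice Y i P p z u" for i z u
  proof -
    have uc: "continuous_map (top_of_set disc) P u" using that by (simp add: disc_slice_def)
    then have "u w \<in> topspace P" if "w \<in> disc" for w using that by (auto simp: continuous_map_def Pi_iff)
    then show ?thesis using that continuous_map_compose[OF uc Fc] qF by (simp add: disc_slice_def o_def)
  qed
  have equi: "F (act g x) = act' (\<phi> g) (F x)" if g: "g \<in> carrier G" and x: "x \<in> topspace P" for g x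
    using P_closed[OF x]
  proof (rule pieces)
    assume "p x \<in> exterior Y"
    then have "x \<in> topspace PX" using x by simp
    then show ?thesis using exterior_lift_equivariant[OF FX FXq _ g] by blast
  next
    fix i assume i: "i \<in> comps Y" "p x \<in> tube Y i"
    interpret t: tube_covering Y i P p using P_tube_covering[OF i(1)] .
    interpret s: tube_covering Y i Q q using tube_covering[OF i(1)] .
    have "x \<in> topspace t.EN" using i x by simp
    then obtain z w u where u: "disc_slice Y i P p z u" "w \<in> disc" "x = u w" "t.coords x = (z, w)"
      by (rule t.slice_through)
    have uc: "continuous_map (top_of_set disc) P u" and pu: "\<forall>w\<in>disc. p (u w) = nbhd Y i (z, w)" and z: "z \<in> circle"
      using u(1) by (simp_all add: disc_slice_def)
    have uP: "u w \<in> topspace P" if "w \<in> disc" for w using uc that by (auto simp: continuous_map_def Pi_iff)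
    have gc: "continuous_map P P (act g)"
      using P_deck g homeomorphic_imp_continuous_map by (auto simp: deck_action_def)
    have "disc_slice Y i P p z (\<lambda>w. act g (u w))"
      using continuous_map_compose[OF uc gc] pu z actP(2)[OF g uP] by (simp add: disc_slice_def o_def)
    then have s1: "disc_slice Y i Q q z (\<lambda>w. F (act g (u w)))" by (rule slice_image)
    have fu: "disc_slice Y i Q q z (\<lambda>w. F (u w))" using u(1) by (rule slice_image)
    then have fuc: "continuous_map (top_of_set disc) Q (\<lambda>w. F (u w))" by (simp add: disc_slice_def)
    have pg: "\<phi> g \<in> carrier H" using g by simp
    have s2: "disc_slice Y i Q q z (\<lambda>w. act' (\<phi> g) (F (u w)))"
      using continuous_map_compose[OF fuc act_cont[OF pg]] fu p_act[OF pg] FQ uP by (simp add: disc_slice_def o_def)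
    have u1: "u 1 \<in> topspace PX" by (rule slice_in_exterior[OF i(1) u(1)]) simp
    have "F (act g (u w)) = act' (\<phi> g) (F (u w))"
    proof (rule s.slice_unique[OF s1 s2 _ _ u(2)])
      show "F (act g (u 1)) = act' (\<phi> g) (F (u 1))" by (rule exterior_lift_equivariant[OF FX FXq u1 g])
    qed simp
    then show ?thesis using u(3) by simp
  qed
  have injX: "x = x'" if x: "x \<in> topspace PX" "x' \<in> topspace PX" and eq: "F x = F x'" for x x'
  proof -
    have "p x = p x'" using qF eq PXP x by metis
    then obtain g where g: "g \<in> carrier G" "act g x = x'" using PX.act_trans[OF x] by blast
    have "act' (\<phi> g) (F x) = F x" using equi[OF g(1) PXP[OF x(1)]] g(2) eq by simp
    then have "\<phi> g = \<one>\<^bsub>H\<^esub>" using act_free[OF _ FQ[OF PXP[OF x(1)]]] g(1) by simp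
    then have "g = \<one>\<^bsub>G\<^esub>" by (rule phi_inj[OF g(1)])
    then show ?thesis using g(2) PX.act_one[OF x(1)] by simp
  qed
  have inj: "inj_on F (topspace P)"
  proof (rule inj_onI)
    fix x x' assume x: "x \<in> topspace P" "x' \<in> topspace P" and eq: "F x = F x'"
    have pp: "p x = p x'" using qF eq x by metis
    from P_closed[OF x(1)] show "x = x'"
    proof (rule pieces)
      assume "p x \<in> exterior Y"
      then show ?thesis using injX[of x x'] eq x pp by simp
    next
      fix i assume i: "i \<in> comps Y" "p x \<in> tube Y i"
      interpret t: tube_covering Y i P p using P_tube_covering[OF i(1)] .
      interpret s: tube_covering Y i Q q using tube_covering[OF i(1)] .
      have "x \<in> topspace t.EN" using i x by simp
      then obtain z w u where u: "disc_slice Y i P p z u" "w \<in> disc" "x = u w" "t.coords x = (z, w)"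
        by (rule t.slice_through)
      have "x' \<in> topspace t.EN" using i x pp by simp
      then obtain z' w' u' where u': "disc_slice Y i P p z' u'" "w' \<in> disc" "x' = u' w'" "t.coords x' = (z', w')"
        by (rule t.slice_through)
      have zw: "z' = z" "w' = w" using u(4) u'(4) pp by auto
      note u'' = u'(1)[unfolded zw] u'(3)[unfolded zw]
      have "F (u 1) = F (u' 1)"
        by (rule s.slice_unique[OF slice_image[OF u(1)] slice_image[OF u''(1)] u(2)]) (use eq u(3) u''(2) in simp_all)
      then have "u 1 = u' 1"
        by (rule injX[rotated 2]) (rule slice_in_exterior[OF i(1) u(1)] slice_in_exterior[OF i(1) u''(1)], simp)+
      then have "u w = u' w" by (intro t.slice_unique[OF u(1) u''(1) _ _ u(2), of 1]) simp_all
      then show ?thesis using u(3) u''(2) by simp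
    qed
  qed
  have psurj: "\<exists>x\<in>topspace P. p x = b" if b: "b \<in> topspace M" for b
    using b
  proof (rule pieces)
    assume "b \<in> exterior Y"
    then have "b \<in> p ` topspace PX" using b PX.p_surj by simp
    then show ?thesis by auto
  next
    fix i assume i: "i \<in> comps Y" "b \<in> tube Y i"
    interpret t: tube_covering Y i P p using P_tube_covering[OF i(1)] .
    have "p ` topspace t.EN = topspace (subtopology M (tube Y i))" using t.tube_cov by (simp add: covering_def)
    then have "b \<in> p ` topspace t.EN" using i b by simp
    then show ?thesis by auto
  qed
  have surj: "F ` topspace P = topspace Q"
  proof (intro equalityI subsetI)
    fix y assume y: "y \<in> topspace Q"
    then obtain x where x: "x \<in> topspace P" "p x = q y" using psurj[OF p_closed[OF y]] by blast
    have "q (F x) = q y" using qF x by simp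
    then obtain h where h: "h \<in> carrier H" "act' h (F x) = y" by (rule act_trans[OF FQ[OF x(1)] y])
    then obtain g where g: "g \<in> carrier G" "h = \<phi> g" using phi_surj by blast
    have "y = F (act g x)" using equi[OF g(1) x(1)] h(2) g(2) by simp
    then show "y \<in> F ` topspace P" using actP(1)[OF g(1) x(1)] by blast
  qed (use FQ in auto)
  \<comment> \<open>over a closed set \<open>T\<close> that \<open>P\<close> covers, \<open>F\<close> is an open bijection, hence closed\<close>
  have piece: "closedin Q (F ` (S \<inter> {x. p x \<in> T}))"
    if S: "closedin P S" and T: "closedin M T" and cov1: "covering (subtopology P {x. p x \<in> T}) (subtopology M T) p" for S T
  proof -
    let ?PT = "subtopology P {x. p x \<in> T}" and ?QT = "subtopology Q {x. q x \<in> T}"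
    have F1: "continuous_map ?PT ?QT F"
      unfolding continuous_map_in_subtopology using Fc qF by (auto simp: continuous_map_from_subtopology)
    have op: "open_map ?PT ?QT F"
      by (rule lift_between_coverings_open[OF cov1 covering_restrict[OF covering] F1]) (use qF in simp)
    have "F ` topspace ?PT = topspace ?QT"
    proof (intro equalityI subsetI)
      fix y assume "y \<in> topspace ?QT"
      then have y: "y \<in> topspace Q" "q y \<in> T" by auto
      then have "y \<in> F ` topspace P" using surj by simp
      then obtain x where x: "x \<in> topspace P" "y = F x" by blast
      then have "p x \<in> T" using y(2) qF by simp
      then have "x \<in> topspace ?PT" using x(1) by simp
      then show "y \<in> F ` topspace ?PT" unfolding x(2) by (rule imageI)
    qed (use F1 in \<open>auto simp: continuous_map_def Pi_iff\<close>)
    then have "homeomorphic_map ?PT ?QT F"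
      using F1 op inj by (intro bijective_open_imp_homeomorphic_map) (auto simp: inj_on_def)
    then have "closed_map ?PT ?QT F" by (rule homeomorphic_imp_closed_map)
    moreover have "closedin ?PT (S \<inter> {x. p x \<in> T})"
      using S by (auto simp: closedin_subtopology)
    ultimately have 1: "closedin ?QT (F ` (S \<inter> {x. p x \<in> T}))" by (simp add: closed_map_def)
    have "closedin Q {y \<in> topspace Q. q y \<in> T}" using T by (rule closedin_continuous_map_preimage[OF p_cont])
    with 1 show ?thesis by (rule closedin_preimage_trans)
  qed
  have "closed_map P Q F"
    unfolding closed_map_def
  proof (intro allI impI)
    fix S assume S: "closedin P S"
    have SP: "S \<subseteq> topspace P" using S by (rule closedin_subset)
    have "S = (S \<inter> {x. p x \<in> exterior Y}) \<union> (\<Union>i\<in>comps Y. S \<inter> {x. p x \<in> tube Y i})"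
    proof (intro equalityI subsetI)
      fix x assume x: "x \<in> S"
      then have "p x \<in> topspace M" using SP P_closed by blast
      then show "x \<in> (S \<inter> {x. p x \<in> exterior Y}) \<union> (\<Union>i\<in>comps Y. S \<inter> {x. p x \<in> tube Y i})"
        by (rule pieces) (use x in blast)+
    qed auto
    then have "F ` S = F ` (S \<inter> {x. p x \<in> exterior Y}) \<union> (\<Union>i\<in>comps Y. F ` (S \<inter> {x. p x \<in> tube Y i}))"
      by (metis image_UN image_Un)
    moreover have "closedin Q (F ` (S \<inter> {x. p x \<in> exterior Y}))"
      by (rule piece[OF S exterior_closed PX.covering])
    moreover have "closedin Q (F ` (S \<inter> {x. p x \<in> tube Y i}))" if i: "i \<in> comps Y" for i
      by (rule piece[OF S tube_closed[OF i]]) (rule tube_covering.tube_cov[OF P_tube_covering[OF i]])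
    ultimately show "closedin Q (F ` S)" by (auto intro!: closedin_Un closedin_Union)
  qed
  then have "homeomorphic_map P Q F" by (rule bijective_closed_imp_homeomorphic_map[OF Fc _ surj inj])
  then show ?thesis
    unfolding cover_identification_def using iso qF equi by blast
qed

end

section \<open>Lifts of cells and their quotients\<close>

locale celled_H1_covering = H1_covering B E p act
  for B :: "'a topology" and E :: "'b topology" and p act +
  fixes \<C> :: "'a set set" and d :: "'a set \<Rightarrow> nat"
  assumes cell_decomposition: "cell_decomposition B \<C> d"
begin

abbreviation H where "H \<equiv> homology_group 1 B"

sublocale H: comm_group H by simp

lemma fin_cells: "finite \<C>"
  using cell_decomposition by (simp add: cell_decomposition_def)

lemma cell_subset: "c \<in> \<C> \<Longrightarrow> c \<subseteq> topspace B"
  using cell_decomposition by (auto simp: cell_decomposition_def)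

text \<open>Open cells are contractible.\<close>

lemma cell_section:
  assumes c: "c \<in> \<C>" and y: "y \<in> topspace E" "p y \<in> c"
  obtains s where "continuous_map (subtopology B c) E s" "\<forall>b\<in>c. p (s b) = b" "s (p y) = y"
proof -
  obtain \<Phi> where Phi: "homeomorphic_map (open_cell (d c)) (subtopology B c) \<Phi>"
    using cell_decomposition c unfolding cell_decomposition_def by blast
  then have hs: "open_cell (d c) homeomorphic_space subtopology B c" by (rule homeomorphic_map_imp_homeomorphic_space)
  have t: "topspace (subtopology B c) = c" using cell_subset[OF c] by (simp add: Int_absorb1)
  have f: "continuous_map (subtopology B c) B id" by (simp add: continuous_map_from_subtopology)
  have con: "contractible_space (subtopology B c)"
    using hs open_cell_contractible homeomorphic_space_contractibility by blast
  have loc: "locally_path_connected_space (subtopology B c)"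
    using hs open_cell_locally_path_connected homeomorphic_locally_path_connected_space by blast
  have py: "p y \<in> topspace (subtopology B c)" using y(2) t by simp
  obtain s where s: "continuous_map (subtopology B c) E s" "\<And>b. b \<in> topspace (subtopology B c) \<Longrightarrow> p (s b) = id b" "s (p y) = y"
    by (rule contractible_lift[OF f con loc py y(1)]) simp_all
  show thesis by (rule that[OF s(1) _ s(3)]) (use s(2)[unfolded t] in simp)
qed

text \<open>The image of a section is connected, and by uniqueness of lifts it fills the component.\<close>

lemma cell_over_section:
  assumes c: "c \<in> \<C>" and K: "K \<in> cells_over E p c" and y: "y \<in> K"
    and s: "continuous_map (subtopology B c) E s" "\<forall>b\<in>c. p (s b) = b" "s (p y) = y"
  shows "K = s ` c"
proof
  let ?Ec = "subtopology E {x. p x \<in> c}"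
  have t: "topspace (subtopology B c) = c" using cell_subset[OF c] by (simp add: Int_absorb1)
  have K': "K \<in> connected_components_of ?Ec" using K by (simp add: cells_over_def)
  have KE: "K \<subseteq> topspace ?Ec" using K' by (rule connected_components_of_subset)
  have pc: "continuous_map ?Ec (subtopology B c) p"
    using p_cont by (auto simp: continuous_map_in_subtopology continuous_map_from_subtopology)
  have sc: "continuous_map (subtopology B c) ?Ec s"
    unfolding continuous_map_in_subtopology using s(1,2) t by auto
  obtain \<Phi> where Phi: "homeomorphic_map (open_cell (d c)) (subtopology B c) \<Phi>"
    using cell_decomposition c unfolding cell_decomposition_def by blast
  have "connected_space (open_cell (d c))" using open_cell_contractible by (rule contractible_imp_connected_space)
  then have "connected_space (subtopology B c)"
    using homeomorphic_connected_space homeomorphic_map_imp_homeomorphic_space[OF Phi] by blast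
  then have "connectedin (subtopology B c) c" using t by (metis connectedin_topspace)
  then have con: "connectedin ?Ec (s ` c)" by (rule connectedin_continuous_map_image[OF sc])
  have pyc: "p y \<in> c" using y KE by auto
  then have ys: "y \<in> s ` c" using s(3) by (metis imageI)
  show "s ` c \<subseteq> K"
    by (rule connected_components_of_maximal[OF K' con]) (use y ys in \<open>auto simp: disjnt_def\<close>)
  show "K \<subseteq> s ` c"
  proof
    fix z assume z: "z \<in> K"
    have "s (p z) = z"
    proof (rule lifts_eq_on[OF covering])
      have "continuous_map (subtopology ?Ec K) (subtopology B c) p" using pc by (rule continuous_map_from_subtopology)
      from continuous_map_compose[OF this s(1)] show "continuous_map (subtopology ?Ec K) E (\<lambda>z. s (p z))" by (simp add: o_def)
      show "continuous_map (subtopology ?Ec K) E (\<lambda>z. z)"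
        using continuous_map_from_subtopology[OF continuous_map_from_subtopology[OF continuous_map_id[of E]]] by (simp add: id_def)
      show "connectedin ?Ec K" using K' by (rule connectedin_connected_components_of)
      show "p (s (p x)) = p x" if "x \<in> K" for x using s(2) KE that by auto
    qed (use y z s(3) in auto)
    moreover have "p z \<in> c" using z KE by auto
    ultimately show "z \<in> s ` c" by (metis imageI)
  qed
qed

lemma cell_over_props:
  assumes c: "c \<in> \<C>" and K: "K \<in> cells_over E p c"
  shows "K \<subseteq> topspace E" "K \<noteq> {}" "p ` K = c" "inj_on p K"
proof -
  let ?Ec = "subtopology E {x. p x \<in> c}"
  have K': "K \<in> connected_components_of ?Ec" using K by (simp add: cells_over_def)
  have KE: "K \<subseteq> topspace ?Ec" using K' by (rule connected_components_of_subset)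
  then show KE': "K \<subseteq> topspace E" by auto
  show ne: "K \<noteq> {}" using K' by (rule nonempty_connected_components_of)
  then obtain y where y: "y \<in> K" by blast
  then have "y \<in> topspace E" "p y \<in> c" using KE by auto
  then obtain s where s: "continuous_map (subtopology B c) E s" "\<forall>b\<in>c. p (s b) = b" "s (p y) = y"
    by (rule cell_section[OF c])
  have Ks: "K = s ` c" by (rule cell_over_section[OF c K y s])
  show "p ` K = c" unfolding Ks using s(2) by (simp add: image_image)
  show "inj_on p K" unfolding Ks by (rule inj_on_inverseI[where g = s]) (use s(2) in auto)
qed

lemma act_cell_over:
  assumes g: "g \<in> carrier H" and K: "K \<in> cells_over E p c"
  shows "act g ` K \<in> cells_over E p c"
proof -
  let ?Ec = "subtopology E {x. p x \<in> c}"
  have "homeomorphic_map ?Ec ?Ec (act g)"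
    by (rule homeomorphic_map_subtopologies_alt[OF act_homeo[OF g]]) (use p_act[OF g] in auto)
  from homeomorphic_map_connected_components_of[OF this] show ?thesis
    using K unfolding cells_over_def by blast
qed

text \<open>Two cells over \<open>c\<close> contain points over the same point of \<open>c\<close>, and the deck transformation that relates these maps one
  component to the other.  It is the only one, because a cell over \<open>c\<close> meets each fibre in one point.\<close>

lemma cells_over_torsor:
  assumes c: "c \<in> \<C>" and K: "K \<in> cells_over E p c" and K': "K' \<in> cells_over E p c"
  shows "\<exists>!g. g \<in> carrier H \<and> act g ` K = K'"
proof -
  note P = cell_over_props[OF c K] and P' = cell_over_props[OF c K']
  obtain y where y: "y \<in> K" using P(2) by blast
  then have "p y \<in> p ` K'" using P(3) P'(3) by blast
  then obtain y' where y': "y' \<in> K'" "p y = p y'" by blast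
  obtain g where g: "g \<in> carrier H" "act g y = y'" using act_trans[of y y'] y y' P(1) P'(1) by blast
  have "act g ` K \<inter> K' \<noteq> {}" using y y' g(2) by blast
  then have eq: "act g ` K = K'"
    using act_cell_over[OF g(1) K] K' unfolding cells_over_def by (simp add: connected_components_of_overlap)
  show ?thesis
  proof (rule ex1I[of _ g])
    fix h assume h: "h \<in> carrier H \<and> act h ` K = K'"
    then have "act g y \<in> act h ` K" using eq y by blast
    then obtain z where z: "z \<in> K" "act g y = act h z" by blast
    have "p y = p z" using p_act[OF g(1), of y] p_act[of h z] h y z P(1) by (metis subsetD)
    then have "z = y" using P(4) y z(1) by (metis inj_onD)
    then show "h = g" using act_inj[of h g y] h g(1) z(2) y P(1) by (metis subsetD)
  qed (use g eq in blast)
qed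

definition ratio :: "'b set \<Rightarrow> 'b set \<Rightarrow> 'a chain set" where
  "ratio K' K = (THE g. g \<in> carrier H \<and> act g ` K = K')"

lemma ratio:
  assumes "c \<in> \<C>" "K \<in> cells_over E p c" "K' \<in> cells_over E p c"
  shows "ratio K' K \<in> carrier H" "act (ratio K' K) ` K = K'"
  using theI'[OF cells_over_torsor[OF assms]] by (auto simp: ratio_def)

lemma ratio_eqI:
  assumes "c \<in> \<C>" "K \<in> cells_over E p c" "g \<in> carrier H" "act g ` K = K'"
  shows "ratio K' K = g"
  unfolding ratio_def using cells_over_torsor[OF assms(1,2) act_cell_over[OF assms(3,2)]] assms(3,4)
  by (intro the1_equality) auto

lemma ratio_mult:
  assumes c: "c \<in> \<C>" and K: "K \<in> cells_over E p c" "K' \<in> cells_over E p c" "K'' \<in> cells_over E p c"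
  shows "ratio K'' K = ratio K'' K' \<otimes>\<^bsub>H\<^esub> ratio K' K"
proof (rule ratio_eqI[OF c K(1)])
  note r1 = ratio[OF c K(1,2)] and r2 = ratio[OF c K(2,3)]
  show "ratio K'' K' \<otimes>\<^bsub>H\<^esub> ratio K' K \<in> carrier H" using r1(1) r2(1) by simp
  have "act (ratio K'' K' \<otimes>\<^bsub>H\<^esub> ratio K' K) ` K = act (ratio K'' K') ` (act (ratio K' K) ` K)"
    unfolding image_image
    by (intro image_cong refl act_mult r1(1) r2(1)) (use cell_over_props(1)[OF c K(1)] in blast)
  then show "act (ratio K'' K' \<otimes>\<^bsub>H\<^esub> ratio K' K) ` K = K''" using r1(2) r2(2) by simp
qed

lemma ratio_self: "\<lbrakk>c \<in> \<C>; K \<in> cells_over E p c\<rbrakk> \<Longrightarrow> ratio K K = \<one>\<^bsub>H\<^esub>"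
  using cell_over_props(1)[of c K] act_one by (intro ratio_eqI) (auto simp: subset_iff)

lemma lift_quotient_ratio:
  "lift_quotient H act S d f e = finprod H (\<lambda>c. ratio (f c) (e c) [^]\<^bsub>H\<^esub> ((-1) ^ d c :: int)) S"
  by (simp add: lift_quotient_def ratio_def)

lemma lift_mem: "\<lbrakk>e \<in> cell_lifts E p \<C>; c \<in> \<C>\<rbrakk> \<Longrightarrow> e c \<in> cells_over E p c"
  unfolding cell_lifts_def by (rule PiE_mem)

lemma lift_ratio_carrier:
  "\<lbrakk>e \<in> cell_lifts E p \<C>; f \<in> cell_lifts E p \<C>; c \<in> \<C>\<rbrakk> \<Longrightarrow> ratio (f c) (e c) \<in> carrier H"
  using ratio(1) lift_mem by blast

lemma lift_quotient_closed:
  assumes "e \<in> cell_lifts E p \<C>" "f \<in> cell_lifts E p \<C>" "S \<subseteq> \<C>"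
  shows "lift_quotient H act S d f e \<in> carrier H"
  unfolding lift_quotient_ratio
proof (rule H.finprod_closed, rule Pi_I)
  fix c assume "c \<in> S"
  then show "ratio (f c) (e c) [^]\<^bsub>H\<^esub> ((-1) ^ d c :: int) \<in> carrier H"
    using lift_ratio_carrier[OF assms(1,2)] assms(3) by (intro int_pow_closed) blast
qed

lemma lift_quotient_mult:
  assumes e: "e \<in> cell_lifts E p \<C>" and f: "f \<in> cell_lifts E p \<C>" and g: "g \<in> cell_lifts E p \<C>" and S: "S \<subseteq> \<C>"
  shows "lift_quotient H act S d g e = lift_quotient H act S d g f \<otimes>\<^bsub>H\<^esub> lift_quotient H act S d f e"
proof -
  let ?t = "\<lambda>f e c. ratio (f c) (e c) [^]\<^bsub>H\<^esub> ((-1) ^ d c :: int)"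
  have cl: "?t f e \<in> S \<rightarrow> carrier H" "?t g f \<in> S \<rightarrow> carrier H"
    using lift_ratio_carrier[OF e f] lift_ratio_carrier[OF f g] S by (auto intro!: int_pow_closed)
  have "finprod H (?t g e) S = finprod H (\<lambda>c. ?t g f c \<otimes>\<^bsub>H\<^esub> ?t f e c) S"
  proof (rule H.finprod_cong')
    fix c assume "c \<in> S"
    then have c: "c \<in> \<C>" using S by blast
    show "?t g e c = ?t g f c \<otimes>\<^bsub>H\<^esub> ?t f e c"
      unfolding ratio_mult[OF c lift_mem[OF e c] lift_mem[OF f c] lift_mem[OF g c]]
      by (rule H.int_pow_distrib[OF lift_ratio_carrier[OF f g c] lift_ratio_carrier[OF e f c]])
  qed (use cl in auto)
  then show ?thesis unfolding lift_quotient_ratio H.finprod_multf[OF cl(2,1)] .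
qed

lemma lift_quotient_self:
  assumes "e \<in> cell_lifts E p \<C>" "S \<subseteq> \<C>"
  shows "lift_quotient H act S d e e = \<one>\<^bsub>H\<^esub>"
  unfolding lift_quotient_ratio
proof (rule H.finprod_one_eqI)
  fix c assume "c \<in> S"
  then have c: "c \<in> \<C>" using assms(2) by blast
  show "ratio (e c) (e c) [^]\<^bsub>H\<^esub> ((-1) ^ d c :: int) = \<one>\<^bsub>H\<^esub>"
    unfolding ratio_self[OF c lift_mem[OF assms(1) c]] by (rule int_pow_one)
qed

lemma mfd_lift_equiv_equiv: "equiv (cell_lifts E p \<C>) (mfd_lift_equiv B E p act \<C> d)"
proof (rule equivI)
  have mem: "(e, f) \<in> mfd_lift_equiv B E p act \<C> d \<longleftrightarrow>
      e \<in> cell_lifts E p \<C> \<and> f \<in> cell_lifts E p \<C> \<and> lift_quotient H act \<C> d f e = \<one>\<^bsub>H\<^esub>" for e f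
    by (simp add: mfd_lift_equiv_def lift_equiv_def)
  show "mfd_lift_equiv B E p act \<C> d \<subseteq> cell_lifts E p \<C> \<times> cell_lifts E p \<C>" using mem by auto
  show "refl_on (cell_lifts E p \<C>) (mfd_lift_equiv B E p act \<C> d)"
    by (rule refl_onI) (use mem lift_quotient_self in auto)
  show "sym (mfd_lift_equiv B E p act \<C> d)"
  proof (rule symI)
    fix e f assume ef: "(e, f) \<in> mfd_lift_equiv B E p act \<C> d"
    then have l: "e \<in> cell_lifts E p \<C>" "f \<in> cell_lifts E p \<C>" "lift_quotient H act \<C> d f e = \<one>\<^bsub>H\<^esub>" using mem by auto
    have "lift_quotient H act \<C> d e e = lift_quotient H act \<C> d e f \<otimes>\<^bsub>H\<^esub> \<one>\<^bsub>H\<^esub>"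
      unfolding l(3)[symmetric] by (rule lift_quotient_mult[OF l(1,2,1) subset_refl])
    then have "lift_quotient H act \<C> d e f = \<one>\<^bsub>H\<^esub>"
      using lift_quotient_self[OF l(1) subset_refl] lift_quotient_closed[OF l(2,1) subset_refl] by simp
    then show "(f, e) \<in> mfd_lift_equiv B E p act \<C> d" using mem l by simp
  qed
  show "trans (mfd_lift_equiv B E p act \<C> d)"
  proof (rule transI)
    fix e f g assume "(e, f) \<in> mfd_lift_equiv B E p act \<C> d" "(f, g) \<in> mfd_lift_equiv B E p act \<C> d"
    then have l: "e \<in> cell_lifts E p \<C>" "f \<in> cell_lifts E p \<C>" "g \<in> cell_lifts E p \<C>"
      "lift_quotient H act \<C> d f e = \<one>\<^bsub>H\<^esub>" "lift_quotient H act \<C> d g f = \<one>\<^bsub>H\<^esub>" using mem by auto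
    have "lift_quotient H act \<C> d g e = \<one>\<^bsub>H\<^esub>"
      unfolding lift_quotient_mult[OF l(1-3) subset_refl] l(4,5) by simp
    then show "(e, g) \<in> mfd_lift_equiv B E p act \<C> d" using mem l by simp
  qed
qed

text \<open>Dimension \<open>0\<close> makes the exponent \<open>1\<close>, so any prescribed quotient is realized.\<close>

lemma move_cell:
  assumes e: "e \<in> cell_lifts E p \<C>" and c: "c \<in> \<C>" "d c = 0" and g: "g \<in> carrier H"
  shows "e(c := act g ` e c) \<in> cell_lifts E p \<C>"
    "lift_quotient H act \<C> d (e(c := act g ` e c)) e = g"
proof -
  let ?f = "e(c := act g ` e c)"
  show f: "?f \<in> cell_lifts E p \<C>"
    using e act_cell_over[OF g lift_mem[OF e c(1)]] c(1) unfolding cell_lifts_def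
    by (auto simp: PiE_iff extensional_def)
  have r: "ratio (?f x) (e x) [^]\<^bsub>H\<^esub> ((-1) ^ d x :: int) = (if c = x then g else \<one>\<^bsub>H\<^esub>)" if x: "x \<in> \<C>" for x
  proof (cases "c = x")
    case True
    then show ?thesis using ratio_eqI[OF c(1) lift_mem[OF e c(1)] g] c(2) g by (simp add: int_pow_1)
  next
    case False
    then show ?thesis using ratio_self[OF x lift_mem[OF e x]] by (simp add: int_pow_one)
  qed
  have "lift_quotient H act \<C> d ?f e = finprod H (\<lambda>x. if c = x then g else \<one>\<^bsub>H\<^esub>) \<C>"
    unfolding lift_quotient_ratio by (rule H.finprod_cong') (use r g in auto)
  also have "\<dots> = g" using H.finprod_singleton[OF c(1) fin_cells, of "\<lambda>_. g"] g by simp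
  finally show "lift_quotient H act \<C> d ?f e = g" .
qed

end

text \<open>A map that preserves and reflects two equivalence relations, and meets every class of the second one, induces a
  bijection of the classes.\<close>

lemma quotient_bij_betw:
  assumes R: "R \<subseteq> A \<times> A" and S: "equiv B S" and h: "\<And>x. x \<in> A \<Longrightarrow> h x \<in> B"
    and iff: "\<And>x y. \<lbrakk>x \<in> A; y \<in> A\<rbrakk> \<Longrightarrow> (x, y) \<in> R \<longleftrightarrow> (h x, h y) \<in> S"
    and surj: "\<And>b. b \<in> B \<Longrightarrow> \<exists>a\<in>A. (h a, b) \<in> S"
  shows "\<exists>\<Phi>. bij_betw \<Phi> (A // R) (B // S) \<and> (\<forall>a\<in>A. \<Phi> (R `` {a}) = S `` {h a})"
proof -
  define \<Phi> where "\<Phi> C = S `` {h (SOME a. a \<in> C)}" for C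
  have Phi: "\<Phi> (R `` {a}) = S `` {h a}" if a: "a \<in> A" for a
  proof -
    have "(h a, h a) \<in> S" using S h[OF a] by (auto simp: equiv_def refl_on_def)
    then have "a \<in> R `` {a}" using iff[OF a a] by simp
    then have "(SOME x. x \<in> R `` {a}) \<in> R `` {a}" by (rule someI)
    then have x: "(a, SOME x. x \<in> R `` {a}) \<in> R" by simp
    then have "(SOME x. x \<in> R `` {a}) \<in> A" using R by blast
    then have "(h a, h (SOME x. x \<in> R `` {a})) \<in> S" using iff[OF a] x by blast
    then show ?thesis unfolding \<Phi>_def by (rule equiv_class_eq[OF S, symmetric])
  qed
  have "bij_betw \<Phi> (A // R) (B // S)"
    unfolding bij_betw_def
  proof
    show "inj_on \<Phi> (A // R)"
    proof (rule inj_onI)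
      fix C D assume "C \<in> A // R" "D \<in> A // R" and eq: "\<Phi> C = \<Phi> D"
      then obtain a b where ab: "a \<in> A" "C = R `` {a}" "b \<in> A" "D = R `` {b}" by (auto elim!: quotientE)
      have Seq: "S `` {h a} = S `` {h b}" using eq Phi ab by simp
      have "(a, x) \<in> R \<longleftrightarrow> (b, x) \<in> R" for x
      proof (cases "x \<in> A")
        case True
        then show ?thesis using iff[OF ab(1) True] iff[OF ab(3) True] Seq by blast
      next
        case False
        then show ?thesis using R by blast
      qed
      then show "C = D" unfolding ab by blast
    qed
    show "\<Phi> ` (A // R) = B // S"
    proof (intro equalityI subsetI)
      fix D assume "D \<in> \<Phi> ` (A // R)"
      then obtain a where "a \<in> A" "D = \<Phi> (R `` {a})" by (auto elim!: quotientE)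
      then show "D \<in> B // S" using Phi h by (simp add: quotientI)
    next
      fix D assume "D \<in> B // S"
      then obtain b where b: "b \<in> B" "D = S `` {b}" by (rule quotientE)
      obtain a where a: "a \<in> A" "(h a, b) \<in> S" using surj[OF b(1)] by blast
      have "D = \<Phi> (R `` {a})" unfolding Phi[OF a(1)] b(2) by (rule equiv_class_eq[OF S a(2), symmetric])
      then show "D \<in> \<Phi> ` (A // R)" using a(1) by (auto intro: quotientI)
    qed
  qed
  then show ?thesis using Phi by blast
qed

section \<open>Lifts of the singular curves\<close>

lemma circle_angle:
  assumes "z \<in> circle" "z \<noteq> 1"
  obtains t where "t \<in> {0<..<1}" "z = cis (2 * pi * t)"
proof -
  have z: "z = cis (Arg2pi z)" using Arg2pi_eq[of z] assms(1) by (simp add: cis_conv_exp)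
  have "Arg2pi z \<noteq> 0" using z assms(2) by (metis cis_zero)
  then have "0 < Arg2pi z" "Arg2pi z < 2 * pi" using Arg2pi_ge_0[of z] Arg2pi_lt_2pi[of z] by linarith+
  then have "Arg2pi z / (2 * pi) \<in> {0<..<1}" by (simp add: field_simps)
  moreover have "z = cis (2 * pi * (Arg2pi z / (2 * pi)))" using z by simp
  ultimately show thesis by (rule that)
qed

lemma circle_angle_ne_1: "t \<in> {0<..<1} \<Longrightarrow> cis (2 * pi * t) \<noteq> 1"
proof
  assume t: "t \<in> {0<..<1}" and "cis (2 * pi * t) = 1"
  then have "cos (2 * pi * t) = 1" by (metis cis.simps(1) one_complex.simps(1))
  then obtain n :: int where "2 * pi * t = of_int n * (2 * pi)" unfolding cos_one_2pi_int by (auto simp: ac_simps)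
  then have "t = of_int n" by simp
  then show False using t by auto
qed

context orbifold_covers
begin

sublocale Qc: celled_H1_covering M Q q act' \<C> d
  using cells by unfold_locales (simp add: orbifold_cell_decomposition_def)

abbreviation ratio where "ratio \<equiv> Qc.ratio"
abbreviation I where "I \<equiv> comps Y"
abbreviation e0 where "e0 \<equiv> sing_cell0 Y"
abbreviation e1 where "e1 \<equiv> sing_cell1 Y"
abbreviation corner where "corner i \<equiv> nbhd Y i ` ({1} \<times> {1})"
abbreviation \<C>' where "\<C>' \<equiv> {c \<in> \<C>. c \<inter> sing_set Y = {}}"

lemma sing_cells:
  assumes i: "i \<in> I"
  shows "e0 i \<in> \<C>" "d (e0 i) = 0" "e1 i \<in> \<C>" "d (e1 i) = 1" "corner i \<in> \<C>" "d (corner i) = 0"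
proof -
  have t: "({1} \<times> {0}, 0) \<in> torus_cells" "((circle - {1}) \<times> {0}, 1) \<in> torus_cells" "({1} \<times> {1}, 0) \<in> torus_cells"
    unfolding torus_cells_def Let_def by simp_all
  show "e0 i \<in> \<C>" "d (e0 i) = 0" "e1 i \<in> \<C>" "d (e1 i) = 1" "corner i \<in> \<C>" "d (corner i) = 0"
    using tube_cell[OF i t(1)] tube_cell[OF i t(2)] tube_cell[OF i t(3)]
    by (simp_all add: sing_cell0_def sing_cell1_def)
qed

lemma e0_eq: "e0 i = {nbhd Y i (1, 0)}"
  by (simp add: sing_cell0_def)

lemma e1_mem: "b \<in> e1 i \<longleftrightarrow> (\<exists>t\<in>{0<..<1}. b = nbhd Y i (cis (2 * pi * t), 0))"
proof
  assume "b \<in> e1 i"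
  then obtain z where z: "z \<in> circle" "z \<noteq> 1" "b = nbhd Y i (z, 0)" unfolding sing_cell1_def by blast
  then show "\<exists>t\<in>{0<..<1}. b = nbhd Y i (cis (2 * pi * t), 0)" using circle_angle[OF z(1,2)] by metis
next
  assume "\<exists>t\<in>{0<..<1}. b = nbhd Y i (cis (2 * pi * t), 0)"
  then obtain t where t: "t \<in> {0<..<1}" "b = nbhd Y i (cis (2 * pi * t), 0)" by blast
  then show "b \<in> e1 i" using circle_angle_ne_1[OF t(1)] unfolding sing_cell1_def by auto
qed

lemma sing_curve_cells: "sing_curve Y i = e0 i \<union> e1 i"
proof -
  have "circle \<times> {0} = ({1} \<times> {0}) \<union> ((circle - {1}) \<times> {0 :: complex})" by auto
  then show ?thesis unfolding sing_curve_def sing_cell0_def sing_cell1_def by (metis image_Un)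
qed

lemma tube_points_eq:
  assumes "i \<in> I" "j \<in> I" "c \<in> circle \<times> disc" "c' \<in> circle \<times> disc" "nbhd Y i c = nbhd Y j c'"
  shows "i = j" "c = c'"
proof -
  have "nbhd Y i c \<in> tube Y i \<inter> tube Y j" using assms by (metis IntI imageI)
  then show ij: "i = j" using tubes_disjoint[OF assms(1,2)] by blast
  show "c = c'" using inj_onD[OF nbhd_inj[OF assms(1)]] assms ij by blast
qed

lemma cells_split:
  "\<C> = \<C>' \<union> (e0 ` I \<union> e1 ` I)" "\<C>' \<inter> (e0 ` I \<union> e1 ` I) = {}" "e0 ` I \<inter> e1 ` I = {}" "inj_on e0 I" "inj_on e1 I"
proof -
  show "\<C> = \<C>' \<union> (e0 ` I \<union> e1 ` I)"
  proof (intro equalityI subsetI)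
    fix c assume c: "c \<in> \<C>"
    show "c \<in> \<C>' \<union> (e0 ` I \<union> e1 ` I)"
    proof (cases "c \<inter> sing_set Y = {}")
      case False
      then obtain b i where b: "b \<in> c" "i \<in> I" "b \<in> sing_curve Y i" unfolding sing_set_def by blast
      then have "b \<in> e0 i \<or> b \<in> e1 i" unfolding sing_curve_cells by blast
      then have "c = e0 i \<or> c = e1 i" using cells_eq[OF c _ b(1)] sing_cells[OF b(2)] by blast
      then show ?thesis using b(2) by blast
    qed (use c in blast)
  qed (use sing_cells in blast)
  have m: "nbhd Y i (1, 0) \<in> e0 i" "nbhd Y i (-1, 0) \<in> e1 i" for i
    by (auto simp: e0_eq sing_cell1_def)
  have "e0 i \<inter> sing_set Y \<noteq> {}" "e1 i \<inter> sing_set Y \<noteq> {}" if "i \<in> I" for i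
    using m[of i] that unfolding sing_set_def sing_curve_cells by blast+
  then show "\<C>' \<inter> (e0 ` I \<union> e1 ` I) = {}" by blast
  have mem: "(1, 0) \<in> circle \<times> disc" "(-1, 0) \<in> circle \<times> disc" by auto
  show "e0 ` I \<inter> e1 ` I = {}"
  proof (rule ccontr)
    assume "e0 ` I \<inter> e1 ` I \<noteq> {}"
    then obtain i j where ij: "i \<in> I" "j \<in> I" "e0 i = e1 j" by blast
    have "nbhd Y j (-1, 0) \<in> e0 i" unfolding ij(3) by (rule m(2))
    then have "nbhd Y j (-1, 0) = nbhd Y i (1, 0)" by (simp add: e0_eq)
    from tube_points_eq(2)[OF ij(2,1) mem(2,1) this] show False by simp
  qed
  show "inj_on e0 I"
  proof (rule inj_onI)
    fix i j assume ij: "i \<in> I" "j \<in> I" "e0 i = e0 j"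
    then have "nbhd Y i (1, 0) = nbhd Y j (1, 0)" by (simp add: e0_eq)
    then show "i = j" by (rule tube_points_eq(1)[OF ij(1,2) mem(1) mem(1)])
  qed
  show "inj_on e1 I"
  proof (rule inj_onI)
    fix i j assume ij: "i \<in> I" "j \<in> I" "e1 i = e1 j"
    then have "nbhd Y i (-1, 0) \<in> e1 j" using m(2)[of i] by simp
    then obtain z where "z \<in> circle" "nbhd Y i (-1, 0) = nbhd Y j (z, 0)" unfolding sing_cell1_def by blast
    then show "i = j" using tube_points_eq(1)[OF ij(1,2) mem(2), of "(z, 0)"] by auto
  qed
qed

text \<open>The two cells of a singular curve have dimensions \<open>0\<close> and \<open>1\<close>, so that they contribute inverse factors if they are
  translated by the same element.\<close>

lemma lift_quotient_singular_cancel: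
  assumes e: "e \<in> cell_lifts Q q \<C>" and f: "f \<in> cell_lifts Q q \<C>"
    and eq: "\<And>i. i \<in> I \<Longrightarrow> ratio (f (e0 i)) (e (e0 i)) = ratio (f (e1 i)) (e (e1 i))"
  shows "lift_quotient H act' \<C> d f e = lift_quotient H act' \<C>' d f e"
proof -
  let ?t = "\<lambda>c. ratio (f c) (e c) [^]\<^bsub>H\<^esub> ((-1) ^ d c :: int)"
  have t: "?t c \<in> carrier H" if "c \<in> \<C>" for c
    using Qc.lift_ratio_carrier[OF e f that] by (rule int_pow_closed)
  have e0C: "e0 ` I \<subseteq> \<C>" and e1C: "e1 ` I \<subseteq> \<C>" using sing_cells by auto
  have fin: "finite I" "finite \<C>'" using cells_finite by auto
  have t0: "?t \<in> e0 ` I \<rightarrow> carrier H" and t1: "?t \<in> e1 ` I \<rightarrow> carrier H" and t': "?t \<in> \<C>' \<rightarrow> carrier H"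
    using t e0C e1C by blast+
  have t01: "?t \<in> e0 ` I \<union> e1 ` I \<rightarrow> carrier H" using t0 t1 by blast
  have i0: "(\<lambda>i. ?t (e0 i)) \<in> I \<rightarrow> carrier H" and i1: "(\<lambda>i. ?t (e1 i)) \<in> I \<rightarrow> carrier H" using t0 t1 by auto
  have "finprod H ?t (e0 ` I \<union> e1 ` I) = finprod H ?t (e0 ` I) \<otimes>\<^bsub>H\<^esub> finprod H ?t (e1 ` I)"
    using fin cells_split(3) t0 t1 by (intro Qc.H.finprod_Un_disjoint) auto
  also have "\<dots> = finprod H (\<lambda>i. ?t (e0 i)) I \<otimes>\<^bsub>H\<^esub> finprod H (\<lambda>i. ?t (e1 i)) I"
    unfolding Qc.H.finprod_reindex[OF t0 cells_split(4)] Qc.H.finprod_reindex[OF t1 cells_split(5)] ..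
  also have "\<dots> = finprod H (\<lambda>i. ?t (e0 i) \<otimes>\<^bsub>H\<^esub> ?t (e1 i)) I"
    unfolding Qc.H.finprod_multf[OF i0 i1] ..
  also have "\<dots> = \<one>\<^bsub>H\<^esub>"
  proof (rule Qc.H.finprod_one_eqI)
    fix i assume i: "i \<in> I"
    have c: "ratio (f (e1 i)) (e (e1 i)) \<in> carrier H" using Qc.lift_ratio_carrier[OF e f sing_cells(3)[OF i]] .
    show "?t (e0 i) \<otimes>\<^bsub>H\<^esub> ?t (e1 i) = \<one>\<^bsub>H\<^esub>"
      unfolding eq[OF i] sing_cells(2,4)[OF i] using c int_pow_mult[OF c, of 1 "-1"] by simp
  qed
  finally have s: "finprod H ?t (e0 ` I \<union> e1 ` I) = \<one>\<^bsub>H\<^esub>" .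
  have "finprod H ?t (\<C>' \<union> (e0 ` I \<union> e1 ` I)) = finprod H ?t \<C>' \<otimes>\<^bsub>H\<^esub> finprod H ?t (e0 ` I \<union> e1 ` I)"
    using fin cells_split(2) t' t01 by (intro Qc.H.finprod_Un_disjoint) auto
  also have "\<dots> = finprod H ?t \<C>'" using s t' by simp
  finally show ?thesis unfolding Qc.lift_quotient_ratio cells_split(1)[symmetric] .
qed

definition curve_path :: "nat \<Rightarrow> (real \<Rightarrow> 'c) \<Rightarrow> bool" where
  "curve_path i \<sigma> \<longleftrightarrow> pathin Q \<sigma> \<and> (\<forall>t\<in>{0..1}. q (\<sigma> t) = nbhd Y i (cis (2 * pi * t), 0))"

lemma curve_path_unique:
  assumes "curve_path i \<sigma>" "curve_path i \<tau>" "s \<in> {0..1}" "\<sigma> s = \<tau> s" "t \<in> {0..1}"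
  shows "\<sigma> t = \<tau> t"
  by (rule lifts_eq_on[OF covering, of euclideanreal "{0..1}" \<sigma> \<tau> s t])
    (use assms in \<open>auto simp: curve_path_def pathin_def\<close>)

lemma curve_path_act:
  assumes s: "curve_path i \<sigma>" and g: "g \<in> carrier H"
  shows "curve_path i (\<lambda>t. act' g (\<sigma> t))"
proof -
  have p: "pathin Q \<sigma>" using s by (simp add: curve_path_def)
  have "\<sigma> t \<in> topspace Q" if "t \<in> {0..1}" for t using path_image_subset_topspace[OF p] that by blast
  then show ?thesis
    using s p_act[OF g] pathin_compose[OF p act_cont[OF g]] by (simp add: curve_path_def o_def)
qed

lemma strip_curve_path:
  assumes "continuous_map (top_of_set (UNIV \<times> disc)) Q l" "\<And>t v. v \<in> disc \<Longrightarrow> q (l (t, v)) = nbhd Y i (cis t, v)"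
  shows "curve_path i (\<lambda>t. l (2 * pi * t, 0))"
proof -
  have "continuous_map (top_of_set {0..1}) (top_of_set (UNIV \<times> disc)) (\<lambda>t::real. (2 * pi * t, 0::complex))"
    by (auto simp: continuous_map_in_subtopology intro!: continuous_intros)
  from continuous_map_compose[OF this assms(1)] show ?thesis
    using assms(2) by (simp add: curve_path_def pathin_def o_def)
qed

text \<open>The strip through the path also contains a lift of the parallel of the curve.  The deck transformation given by
  the class of the parallel shifts the strip by \<open>2 * pi\<close> along its boundary, hence everywhere.\<close>

lemma curve_path_ends:
  assumes i: "i \<in> I" and s: "curve_path i \<sigma>"
  shows "act' (loop_class M (parallel Y i)) (\<sigma> 0) = \<sigma> 1"
proof -
  have p: "pathin Q \<sigma>" using s by (simp add: curve_path_def)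
  have s0: "\<sigma> 0 \<in> topspace Q" using path_start_in_topspace[OF p] .
  have qs: "q (\<sigma> 0) = nbhd Y i (cis 0, 0)" using s by (simp add: curve_path_def)
  obtain l where l: "continuous_map (top_of_set (UNIV \<times> disc)) Q l" "\<And>t v. v \<in> disc \<Longrightarrow> q (l (t, v)) = nbhd Y i (cis t, v)" "l (0, 0) = \<sigma> 0"
    using strip_lift[OF i s0 _ qs] by (metis centre_in_cball zero_le_one)
  have "continuous_map (top_of_set {0..1}) (top_of_set (UNIV \<times> disc)) (\<lambda>t::real. (2 * pi * t, 1::complex))"
    by (auto simp: continuous_map_in_subtopology intro!: continuous_intros)
  from continuous_map_compose[OF this l(1)]
  have tp: "pathin Q (\<lambda>t. l (2 * pi * t, 1))" (is "pathin Q ?\<tau>") by (simp add: pathin_def o_def)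
  have lQ: "l (t, v) \<in> topspace Q" if "v \<in> disc" for t v using l(1) that by (auto simp: continuous_map_def Pi_iff)
  have "q (?\<tau> 0) = q (?\<tau> 1)" by (simp add: l(2) cis_2pi)
  then obtain g where g: "g \<in> carrier H" "act' g (?\<tau> 0) = ?\<tau> 1" using act_trans[of "?\<tau> 0" "?\<tau> 1"] lQ[of 1] by auto
  have "loop_class M (q \<circ> ?\<tau>) = g" by (rule path_class[OF g(1) tp]) (use g(2) in simp)
  moreover have "q \<circ> ?\<tau> = parallel Y i" by (rule ext) (simp add: l(2) parallel_def)
  ultimately have gp: "loop_class M (parallel Y i) = g" by simp
  have "act' g (l (0, 0)) = l (0 + 2 * pi, 0)"
  proof (rule strip_unique[OF i, of "\<lambda>a. act' g (l a)" "\<lambda>a. l (fst a + 2 * pi, snd a)" 1 0 0 0, simplified fst_conv snd_conv])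
    show "continuous_map (top_of_set (UNIV \<times> disc)) Q (\<lambda>a. act' g (l a))"
      using continuous_map_compose[OF l(1) act_cont[OF g(1)]] by (simp add: o_def)
    have "continuous_map (top_of_set (UNIV \<times> disc)) (top_of_set (UNIV \<times> disc)) (\<lambda>a::real \<times> complex. (fst a + 2 * pi, snd a))"
      by (auto simp: continuous_map_in_subtopology intro!: continuous_intros)
    from continuous_map_compose[OF this l(1)]
    show "continuous_map (top_of_set (UNIV \<times> disc)) Q (\<lambda>a. l (fst a + 2 * pi, snd a))" by (simp add: o_def)
    show "q (act' g (l (t, v))) = nbhd Y i (cis t, v)" if "v \<in> disc" for t v
      using p_act[OF g(1) lQ[OF that]] l(2)[OF that] by simp
    show "q (l (t + 2 * pi, v)) = nbhd Y i (cis t, v)" if "v \<in> disc" for t v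
      using l(2)[OF that] by (simp flip: cis_mult add: cis_2pi)
    show "act' g (l (0, 1)) = l (0 + 2 * pi, 1)" using g(2) by simp
  qed simp_all
  moreover have "\<sigma> 1 = l (2 * pi * 1, 0)"
    by (rule curve_path_unique[OF s strip_curve_path[OF l(1,2)], of 0]) (use l(3) in simp_all)
  ultimately show ?thesis unfolding gp using l(3) by simp
qed

text \<open>The cells over a point are single points.\<close>

lemma curve_path_start:
  assumes i: "i \<in> I" and s: "curve_path i \<sigma>"
  shows "{\<sigma> 0} \<in> cells_over Q q (e0 i)"
proof -
  have p: "pathin Q \<sigma>" using s by (simp add: curve_path_def)
  have "q (\<sigma> 0) \<in> e0 i" using s by (simp add: curve_path_def e0_eq)
  then have "\<sigma> 0 \<in> topspace (subtopology Q {x. q x \<in> e0 i})" using path_start_in_topspace[OF p] by simp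
  then obtain K where K: "K \<in> cells_over Q q (e0 i)" "\<sigma> 0 \<in> K"
    unfolding cells_over_def Union_connected_components_of[symmetric] by blast
  note P = Qc.cell_over_props[OF sing_cells(1)[OF i] K(1)]
  have "K = {\<sigma> 0}"
  proof (intro equalityI subsetI)
    fix y assume y: "y \<in> K"
    then have "q y \<in> e0 i" "q (\<sigma> 0) \<in> e0 i" using P(3) K(2) by blast+
    then have "q y = q (\<sigma> 0)" by (simp add: e0_eq)
    then have "y = \<sigma> 0" using P(4) y K(2) by (metis inj_onD)
    then show "y \<in> {\<sigma> 0}" by simp
  qed (use K(2) in simp)
  then show ?thesis using K(1) by simp
qed

lemma curve_path_cell:
  assumes i: "i \<in> I" and K: "K \<in> cells_over Q q (e1 i)"
  obtains \<sigma> where "curve_path i \<sigma>" "K = \<sigma> ` {0<..<1}"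
proof -
  note P = Qc.cell_over_props[OF sing_cells(3)[OF i] K]
  obtain y where y: "y \<in> K" using P(2) by blast
  have yQ: "y \<in> topspace Q" using y P(1) by blast
  have "q y \<in> e1 i" using y P(3) by blast
  then obtain t0 where t0: "t0 \<in> {0<..<1}" "q y = nbhd Y i (cis (2 * pi * t0), 0)" unfolding e1_mem by blast
  obtain l where l: "continuous_map (top_of_set (UNIV \<times> disc)) Q l" "\<And>t v. v \<in> disc \<Longrightarrow> q (l (t, v)) = nbhd Y i (cis t, v)" "l (2 * pi * t0, 0) = y"
    using strip_lift[OF i yQ _ t0(2)] by (metis centre_in_cball zero_le_one)
  define \<sigma> where "\<sigma> t = l (2 * pi * t, 0)" for t
  have s: "curve_path i \<sigma>" unfolding \<sigma>_def[abs_def] by (rule strip_curve_path[OF l(1,2)])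
  then have p: "pathin Q \<sigma>" and qs: "\<And>t. t \<in> {0..1} \<Longrightarrow> q (\<sigma> t) = nbhd Y i (cis (2 * pi * t), 0)" by (auto simp: curve_path_def)
  let ?Q1 = "subtopology Q {x. q x \<in> e1 i}"
  have "continuous_map (top_of_set {0<..<1}) Q \<sigma>"
    using continuous_map_from_subtopology[OF p[unfolded pathin_def], of "{0<..<1}"]
    by (simp add: subtopology_subtopology Int_absorb1 greaterThanLessThan_subseteq_atLeastAtMost_iff)
  moreover have "q (\<sigma> t) \<in> e1 i" if "t \<in> {0<..<1}" for t using qs[of t] that unfolding e1_mem by auto
  ultimately have "continuous_map (top_of_set {0<..<1}) ?Q1 \<sigma>" by (auto simp: continuous_map_in_subtopology)
  moreover have "connectedin (top_of_set {0<..<1::real}) {0<..<1}" by (simp add: connectedin_subtopology)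
  ultimately have con: "connectedin ?Q1 (\<sigma> ` {0<..<1})" by (rule connectedin_continuous_map_image)
  have ys: "y \<in> \<sigma> ` {0<..<1}" using l(3) t0(1) unfolding \<sigma>_def by blast
  have K': "K \<in> connected_components_of ?Q1" using K by (simp add: cells_over_def)
  have sub: "\<sigma> ` {0<..<1} \<subseteq> K"
    by (rule connected_components_of_maximal[OF K' con]) (use y ys in \<open>auto simp: disjnt_def\<close>)
  have "K \<subseteq> \<sigma> ` {0<..<1}"
  proof
    fix y' assume y': "y' \<in> K"
    then have "q y' \<in> e1 i" using P(3) by blast
    then obtain t where t: "t \<in> {0<..<1}" "q y' = nbhd Y i (cis (2 * pi * t), 0)" unfolding e1_mem by blast
    then have "q y' = q (\<sigma> t)" using qs[of t] by simp
    moreover have "\<sigma> t \<in> K" using sub t(1) by blast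
    ultimately have "y' = \<sigma> t" using P(4) y' by (metis inj_onD)
    then show "y' \<in> \<sigma> ` {0<..<1}" using t(1) by blast
  qed
  then show thesis using that[OF s] sub by blast
qed

text \<open>This is the form that the boundary condition takes in \<open>Q\<close>: by \<open>curve_path_ends\<close>, the terminal point of \<open>\<sigma>\<close> is
  the translate of the initial point by the class of the curve.\<close>

definition curve_condition :: "nat \<Rightarrow> ('a set \<Rightarrow> 'c set) \<Rightarrow> bool" where
  "curve_condition i e \<longleftrightarrow> (\<exists>\<sigma>. curve_path i \<sigma> \<and> e (e1 i) = \<sigma> ` {0<..<1} \<and> e (e0 i) = {\<sigma> 0})"

lemma curve_condition_ratio:
  assumes i: "i \<in> I" and e: "e \<in> cell_lifts Q q \<C>" "curve_condition i e" and f: "f \<in> cell_lifts Q q \<C>" "curve_condition i f"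
  shows "ratio (f (e0 i)) (e (e0 i)) = ratio (f (e1 i)) (e (e1 i))"
proof -
  obtain \<sigma> where s: "curve_path i \<sigma>" "e (e1 i) = \<sigma> ` {0<..<1}" "e (e0 i) = {\<sigma> 0}" using e(2) by (auto simp: curve_condition_def)
  obtain \<tau> where t: "curve_path i \<tau>" "f (e1 i) = \<tau> ` {0<..<1}" "f (e0 i) = {\<tau> 0}" using f(2) by (auto simp: curve_condition_def)
  let ?g = "ratio (f (e0 i)) (e (e0 i))"
  note r = Qc.ratio[OF sing_cells(1)[OF i] Qc.lift_mem[OF e(1) sing_cells(1)[OF i]] Qc.lift_mem[OF f(1) sing_cells(1)[OF i]]]
  have g0: "act' ?g (\<sigma> 0) = \<tau> 0" using r(2) unfolding s(3) t(3) by simp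
  have "act' ?g (\<sigma> u) = \<tau> u" if "u \<in> {0..1}" for u
    by (rule curve_path_unique[OF curve_path_act[OF s(1) r(1)] t(1), of 0]) (use g0 that in simp_all)
  then have "act' ?g ` e (e1 i) = f (e1 i)" unfolding s(2) t(2) image_image by (intro image_cong) auto
  from Qc.ratio_eqI[OF sing_cells(3)[OF i] Qc.lift_mem[OF e(1) sing_cells(3)[OF i]] r(1) this]
  show ?thesis by (rule sym)
qed

text \<open>The 0-cells of the singular curves are adapted to the given 1-cells, which changes the quotient by some element; this
  is undone by moving the 0-cell at the corner of the boundary of a tube.\<close>

lemma curve_condition_representative:
  assumes e: "e \<in> cell_lifts Q q \<C>"
  obtains f where "f \<in> cell_lifts Q q \<C>" "\<forall>i\<in>I. curve_condition i f" "lift_quotient H act' \<C> d f e = \<one>\<^bsub>H\<^esub>"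
proof (cases "I = {}")
  case True
  then show thesis using that[OF e] Qc.lift_quotient_self[OF e subset_refl] by blast
next
  case False
  then obtain j where j: "j \<in> I" by blast
  have "\<forall>i\<in>I. \<exists>\<sigma>. curve_path i \<sigma> \<and> e (e1 i) = \<sigma> ` {0<..<1}"
    using curve_path_cell Qc.lift_mem[OF e sing_cells(3)] by (metis (no_types, lifting))
  from bchoice[OF this] obtain \<sigma> where s: "\<forall>i\<in>I. curve_path i (\<sigma> i) \<and> e (e1 i) = \<sigma> i ` {0<..<1}" by (rule exE)
  define f1 where "f1 c = (if c \<in> e0 ` I then {\<sigma> (the_inv_into I e0 c) 0} else e c)" for c
  have f10: "f1 (e0 i) = {\<sigma> i 0}" if "i \<in> I" for i
    using that the_inv_into_f_f[OF cells_split(4) that] unfolding f1_def by simp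
  have f1other: "f1 c = e c" if "c \<notin> e0 ` I" for c using that by (simp add: f1_def)
  have f1: "f1 \<in> cell_lifts Q q \<C>"
    unfolding cell_lifts_def
  proof (rule PiE_I)
    fix c assume c: "c \<in> \<C>"
    show "f1 c \<in> cells_over Q q c"
    proof (cases "c \<in> e0 ` I")
      case True
      then obtain i where i: "i \<in> I" "c = e0 i" by blast
      then show ?thesis using f10 curve_path_start[OF i(1)] s by simp
    next
      case False
      then show ?thesis using f1other Qc.lift_mem[OF e c] by simp
    qed
  next
    fix c assume c: "c \<notin> \<C>"
    then have "c \<notin> e0 ` I" using sing_cells(1) by blast
    then have "f1 c = e c" by (rule f1other)
    also have "e c = undefined" using e unfolding cell_lifts_def by (rule PiE_arb[OF _ c])
    finally show "f1 c = undefined" .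
  qed
  let ?c = "corner j"
  have cj: "?c \<in> \<C>" "d ?c = 0" using sing_cells(5,6)[OF j] .
  have mem: "(1, 1) \<in> circle \<times> disc" "(1, 0) \<in> circle \<times> disc" by auto
  have c0: "?c \<noteq> e0 i" if "i \<in> I" for i
    using tube_points_eq(2)[OF j that mem] by (auto simp: e0_eq)
  have c1: "?c \<noteq> e1 i" if i: "i \<in> I" for i
  proof
    assume "?c = e1 i"
    then have "nbhd Y j (1, 1) \<in> e1 i" by auto
    then obtain z where z: "z \<in> circle" "nbhd Y j (1, 1) = nbhd Y i (z, 0)" unfolding sing_cell1_def by blast
    have "(z, 0) \<in> circle \<times> disc" using z(1) by simp
    from tube_points_eq(2)[OF j i mem(1) this z(2)] show False by simp
  qed
  \<comment> \<open>moving the corner by \<open>?k\<close> multiplies the quotient by \<open>?k\<close>\<close>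
  let ?k = "inv\<^bsub>H\<^esub> (lift_quotient H act' \<C> d f1 e)"
  have lc: "lift_quotient H act' \<C> d f1 e \<in> carrier H" using Qc.lift_quotient_closed[OF e f1 subset_refl] .
  then have k: "?k \<in> carrier H" by simp
  define f where "f = f1(?c := act' ?k ` f1 ?c)"
  note mv = Qc.move_cell[OF f1 cj k, folded f_def]
  have "lift_quotient H act' \<C> d f e = ?k \<otimes>\<^bsub>H\<^esub> lift_quotient H act' \<C> d f1 e"
    unfolding Qc.lift_quotient_mult[OF e f1 mv(1) subset_refl] mv(2) ..
  then have "lift_quotient H act' \<C> d f e = \<one>\<^bsub>H\<^esub>" using lc by simp
  moreover have "curve_condition i f" if i: "i \<in> I" for i
  proof -
    have "e1 i \<notin> e0 ` I" using cells_split(3) i by blast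
    then have "f (e1 i) = \<sigma> i ` {0<..<1}" "f (e0 i) = {\<sigma> i 0}"
      using c0[OF i] c1[OF i] f10[OF i] f1other s i unfolding f_def by auto
    then show ?thesis using s i unfolding curve_condition_def by blast
  qed
  ultimately show thesis using that[OF mv(1)] by blast
qed

end

section \<open>Comparison of the Euler structures\<close>

context orbifold_covers
begin

context
  fixes F
  assumes identification: "cover_identification Y P p act Q q act' F"
begin

lemma id_iso: "\<phi> \<in> iso G H" and id_homeo: "homeomorphic_map P Q F"
  and id_over: "x \<in> topspace P \<Longrightarrow> q (F x) = p x"
  and id_equivariant: "\<lbrakk>g \<in> carrier G; x \<in> topspace P\<rbrakk> \<Longrightarrow> F (act g x) = act' (\<phi> g) (F x)"
  using identification by (auto simp: cover_identification_def)

lemma P_act_closed: "\<lbrakk>g \<in> carrier G; x \<in> topspace P\<rbrakk> \<Longrightarrow> act g x \<in> topspace P"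
  using P_deck homeomorphic_imp_continuous_map[of P P "act g"] by (auto simp: deck_action_def continuous_map_def Pi_iff)

lemma id_inj: "inj_on F (topspace P)"
  using id_homeo by (rule homeomorphic_imp_injective_map)

lemma id_cells: "cells_over Q q c = image F ` cells_over P p c"
  unfolding cells_over_def
  by (rule homeomorphic_map_connected_components_of, rule homeomorphic_map_subtopologies_alt[OF id_homeo])
    (use id_over in auto)

lemma P_cell_subset: "K \<in> cells_over P p c \<Longrightarrow> K \<subseteq> topspace P"
  unfolding cells_over_def using connected_components_of_subset by fastforce

text \<open>The lift to \<open>Q\<close> that corresponds to a lift to \<open>P\<close>.\<close>

definition hat :: "('a set \<Rightarrow> 'b set) \<Rightarrow> 'a set \<Rightarrow> 'c set" where
  "hat e = (\<lambda>c\<in>\<C>. F ` e c)"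

lemma P_lift_mem: "\<lbrakk>e \<in> cell_lifts P p \<C>; c \<in> \<C>\<rbrakk> \<Longrightarrow> e c \<in> cells_over P p c"
  unfolding cell_lifts_def by (rule PiE_mem)

lemma hat_lift:
  assumes e: "e \<in> cell_lifts P p \<C>"
  shows "hat e \<in> cell_lifts Q q \<C>"
  unfolding cell_lifts_def
proof (rule PiE_I)
  fix c assume c: "c \<in> \<C>"
  then show "hat e c \<in> cells_over Q q c" unfolding id_cells using P_lift_mem[OF e c] by (simp add: hat_def)
qed (simp add: hat_def)

lemma hat_surj:
  assumes f: "f \<in> cell_lifts Q q \<C>"
  obtains e where "e \<in> cell_lifts P p \<C>" "hat e = f"
proof -
  have "\<forall>c\<in>\<C>. \<exists>K. K \<in> cells_over P p c \<and> f c = F ` K"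
    using Qc.lift_mem[OF f] unfolding id_cells by blast
  from bchoice[OF this] obtain k where k: "\<forall>c\<in>\<C>. k c \<in> cells_over P p c \<and> f c = F ` k c" by (rule exE)
  have "(\<lambda>c\<in>\<C>. k c) \<in> cell_lifts P p \<C>" unfolding cell_lifts_def using k by auto
  moreover have "hat (\<lambda>c\<in>\<C>. k c) = f"
  proof
    fix c
    show "hat (\<lambda>c\<in>\<C>. k c) c = f c"
    proof (cases "c \<in> \<C>")
      case True
      then show ?thesis using k by (simp add: hat_def)
    next
      case False
      then have "f c = undefined" using f unfolding cell_lifts_def by (intro PiE_arb)
      then show ?thesis using False by (simp add: hat_def)
    qed
  qed
  ultimately show thesis by (rule that)
qed

lemma id_act_image:
  assumes "g \<in> carrier G" "K \<subseteq> topspace P"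
  shows "F ` (act g ` K) = act' (\<phi> g) ` (F ` K)"
  unfolding image_image using id_equivariant[OF assms(1)] assms(2) by (intro image_cong) auto

lemma ratio_transport:
  assumes e: "e \<in> cell_lifts P p \<C>" and f: "f \<in> cell_lifts P p \<C>" and c: "c \<in> \<C>"
  shows "(THE g. g \<in> carrier G \<and> act g ` e c = f c) \<in> carrier G"
    "\<phi> (THE g. g \<in> carrier G \<and> act g ` e c = f c) = ratio (hat f c) (hat e c)"
proof -
  let ?r = "ratio (hat f c) (hat e c)"
  note r = Qc.ratio[OF c Qc.lift_mem[OF hat_lift[OF e] c] Qc.lift_mem[OF hat_lift[OF f] c]]
  note eP = P_cell_subset[OF P_lift_mem[OF e c]] and fP = P_cell_subset[OF P_lift_mem[OF f c]]
  have h: "hat e c = F ` e c" "hat f c = F ` f c" using c by (simp_all add: hat_def)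
  obtain g where g: "g \<in> carrier G" "\<phi> g = ?r" using phi_surj r(1) by (metis imageE)
  have inj: "inj_on \<phi> (carrier G)" using id_iso by (simp add: Group.iso_def bij_betw_def)
  have Fge: "F ` (act g ` e c) = F ` f c"
    unfolding id_act_image[OF g(1) eP] g(2) using r(2) unfolding h .
  have "act g ` e c \<subseteq> topspace P" using P_act_closed[OF g(1)] eP by blast
  from inj_on_image_eq_iff[OF id_inj this fP] have ge: "act g ` e c = f c" using Fge by simp
  have the: "(THE g. g \<in> carrier G \<and> act g ` e c = f c) = g"
  proof (rule the_equality)
    fix g' assume g': "g' \<in> carrier G \<and> act g' ` e c = f c"
    have "act' (\<phi> g') ` hat e c = hat f c"
      unfolding h using id_act_image[of g' "e c"] g' eP by metis
    from Qc.ratio_eqI[OF c Qc.lift_mem[OF hat_lift[OF e] c] _ this] have "\<phi> g' = \<phi> g" using g' g(2) by simp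
    then show "g' = g" using inj g' g(1) by (metis inj_onD)
  qed (use g ge in blast)
  show "(THE g. g \<in> carrier G \<and> act g ` e c = f c) \<in> carrier G"
    "\<phi> (THE g. g \<in> carrier G \<and> act g ` e c = f c) = ?r"
    unfolding the using g by auto
qed

lemma quotient_transport:
  assumes e: "e \<in> cell_lifts P p \<C>" and f: "f \<in> cell_lifts P p \<C>" and S: "S \<subseteq> \<C>"
  shows "lift_quotient G act S d f e \<in> carrier G"
    "\<phi> (lift_quotient G act S d f e) = lift_quotient H act' S d (hat f) (hat e)"
proof -
  let ?t = "\<lambda>c. (THE g. g \<in> carrier G \<and> act g ` e c = f c) [^]\<^bsub>G\<^esub> ((-1) ^ d c :: int)"
  let ?u = "\<lambda>c. ratio (hat f c) (hat e c) [^]\<^bsub>H\<^esub> ((-1) ^ d c :: int)"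
  have t: "?t c \<in> carrier G" if "c \<in> \<C>" for c using ratio_transport(1)[OF e f that] by (rule G.int_pow_closed)
  have u: "?u c \<in> carrier H" if "c \<in> \<C>" for c
    using Qc.lift_ratio_carrier[OF hat_lift[OF e] hat_lift[OF f] that] by (rule int_pow_closed)
  have tu: "\<phi> (?t c) = ?u c" if "c \<in> \<C>" for c
    using phi.hom_int_pow[OF ratio_transport(1)[OF e f that]] ratio_transport(2)[OF e f that] by simp
  have fin: "finite S" using S cells_finite by (rule finite_subset)
  have "finprod G ?t S \<in> carrier G \<and> \<phi> (finprod G ?t S) = finprod H ?u S"
    using fin S
  proof (induction S rule: finite_induct)
    case empty
    show ?case by simp
  next
    case (insert c S)
    have cS: "c \<in> \<C>" "S \<subseteq> \<C>" using insert.prems by auto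
    have tS: "?t \<in> S \<rightarrow> carrier G" and uS: "?u \<in> S \<rightarrow> carrier H" using t u cS(2) by blast+
    show ?case
      unfolding G.finprod_insert[OF insert.hyps tS t[OF cS(1)]] Qc.H.finprod_insert[OF insert.hyps uS u[OF cS(1)]]
      using insert.IH[OF cS(2)] t[OF cS(1)] tu[OF cS(1)] by simp
  qed
  then show "lift_quotient G act S d f e \<in> carrier G"
    "\<phi> (lift_quotient G act S d f e) = lift_quotient H act' S d (hat f) (hat e)"
    unfolding lift_quotient_def[of G] Qc.lift_quotient_ratio by auto
qed

text \<open>For the reverse direction the path in \<open>Q\<close> is pulled back, and the terminal point is identified by
  \<open>curve_path_ends\<close>.\<close>

lemma boundary_condition_iff:
  assumes e: "e \<in> cell_lifts P p \<C>" and i: "i \<in> I"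
  shows "boundary_condition Y P p act i e \<longleftrightarrow> curve_condition i (hat e)"
proof -
  have h: "hat e (e0 i) = F ` e (e0 i)" "hat e (e1 i) = F ` e (e1 i)" using sing_cells[OF i] by (simp_all add: hat_def)
  show ?thesis
  proof
    assume "boundary_condition Y P p act i e"
    then obtain \<gamma> where g: "pathin P \<gamma>" "\<forall>t\<in>{0..1}. p (\<gamma> t) = nbhd Y i (cis (2 * pi * t), 0)"
      "e (e1 i) = \<gamma> ` {0<..<1}" "e (e0 i) = {\<gamma> 0}" unfolding boundary_condition_def by (elim exE conjE)
    have gP: "\<gamma> t \<in> topspace P" if "t \<in> {0..1}" for t using path_image_subset_topspace[OF g(1)] that by blast
    have "pathin Q (F \<circ> \<gamma>)" using g(1) homeomorphic_imp_continuous_map[OF id_homeo] by (rule pathin_compose)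
    moreover have "\<forall>t\<in>{0..1}. q ((F \<circ> \<gamma>) t) = nbhd Y i (cis (2 * pi * t), 0)" using g(2) id_over gP by simp
    ultimately have "curve_path i (F \<circ> \<gamma>)" by (simp add: curve_path_def)
    then show "curve_condition i (hat e)"
      unfolding curve_condition_def h g(3,4) by (intro exI[of _ "F \<circ> \<gamma>"]) (simp add: image_comp)
  next
    assume "curve_condition i (hat e)"
    then obtain \<sigma> where s: "curve_path i \<sigma>" "F ` e (e1 i) = \<sigma> ` {0<..<1}" "F ` e (e0 i) = {\<sigma> 0}"
      unfolding curve_condition_def h by (elim exE conjE)
    obtain F' where F': "homeomorphic_maps P Q F F'" using id_homeo homeomorphic_map_maps by blast
    have F'c: "continuous_map Q P F'" and F'F: "\<forall>x\<in>topspace P. F' (F x) = x" and FF': "\<forall>y\<in>topspace Q. F (F' y) = y"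
      using F' by (simp_all add: homeomorphic_maps_def)
    have sp: "pathin Q \<sigma>" using s(1) by (simp add: curve_path_def)
    have sQ: "\<sigma> t \<in> topspace Q" if "t \<in> {0..1}" for t using path_image_subset_topspace[OF sp] that by blast
    define \<gamma> where "\<gamma> = F' \<circ> \<sigma>"
    have g: "pathin P \<gamma>" unfolding \<gamma>_def using sp F'c by (rule pathin_compose)
    have gP: "\<gamma> t \<in> topspace P" if "t \<in> {0..1}" for t using path_image_subset_topspace[OF g] that by blast
    have Fg: "F (\<gamma> t) = \<sigma> t" if "t \<in> {0..1}" for t using FF' sQ[OF that] by (simp add: \<gamma>_def)
    have pg: "p (\<gamma> t) = nbhd Y i (cis (2 * pi * t), 0)" if t: "t \<in> {0..1}" for t
      using id_over[OF gP[OF t]] Fg[OF t] s(1) t by (simp add: curve_path_def)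
    have pull: "K = F' ` (F ` K)" if "K \<subseteq> topspace P" for K
      unfolding image_image using F'F that by (simp add: subset_iff)
    have 1: "e (e1 i) = \<gamma> ` {0<..<1}"
      using pull[OF P_cell_subset[OF P_lift_mem[OF e sing_cells(3)[OF i]]]] unfolding s(2) by (simp add: \<gamma>_def image_comp)
    have 0: "e (e0 i) = {\<gamma> 0}"
      using pull[OF P_cell_subset[OF P_lift_mem[OF e sing_cells(1)[OF i]]]] unfolding s(3) by (simp add: \<gamma>_def)
    have par: "parallel Y i = (\<lambda>t. nbhd Y i (cis (2 * pi * t), 1))" by (rule ext) (simp add: parallel_def)
    have ol: "orb_loop_class Y (parallel Y i) \<in> carrier G" "\<phi> (orb_loop_class Y (parallel Y i)) = loop_class M (parallel Y i)"
      unfolding par by (rule orb_loop_class[OF parallel_path[OF i]], simp add: cis_2pi)+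
    have "F (act (orb_loop_class Y (parallel Y i)) (\<gamma> 0)) = act' (loop_class M (parallel Y i)) (\<sigma> 0)"
      using id_equivariant[OF ol(1) gP[of 0]] ol(2) Fg[of 0] by simp
    also have "\<dots> = \<sigma> 1" by (rule curve_path_ends[OF i s(1)])
    also have "\<dots> = F (\<gamma> 1)" using Fg[of 1] by simp
    finally have "act (orb_loop_class Y (parallel Y i)) (\<gamma> 0) = \<gamma> 1"
      by (rule inj_onD[OF id_inj]) (use P_act_closed[OF ol(1) gP[of 0]] gP[of 1] in simp_all)
    then show "boundary_condition Y P p act i e"
      unfolding boundary_condition_def using g pg 1 0 by (intro exI[of _ \<gamma>]) simp
  qed
qed

lemma Euler_structures_bijection:
  "\<exists>\<Phi>. bij_betw \<Phi> (Eul_orb Y P p act \<C> d) (Eul M Q q act' \<C> d) \<and>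
    (\<forall>e\<in>orb_cell_lifts Y P p act \<C>. \<Phi> (orb_lift_equiv Y P p act \<C> d `` {e}) = mfd_lift_equiv M Q q act' \<C> d `` {\<lambda>c\<in>\<C>. F ` e c})"
proof -
  have orb: "e \<in> cell_lifts P p \<C>" "\<forall>i\<in>I. curve_condition i (hat e)" if "e \<in> orb_cell_lifts Y P p act \<C>" for e
    using that boundary_condition_iff by (auto simp: orb_cell_lifts_def)
  have mem: "(e, f) \<in> mfd_lift_equiv M Q q act' \<C> d \<longleftrightarrow>
      e \<in> cell_lifts Q q \<C> \<and> f \<in> cell_lifts Q q \<C> \<and> lift_quotient H act' \<C> d f e = \<one>\<^bsub>H\<^esub>" for e f
    by (simp add: mfd_lift_equiv_def lift_equiv_def)
  have "\<exists>\<Phi>. bij_betw \<Phi> (orb_cell_lifts Y P p act \<C> // orb_lift_equiv Y P p act \<C> d) (cell_lifts Q q \<C> // mfd_lift_equiv M Q q act' \<C> d)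
      \<and> (\<forall>e\<in>orb_cell_lifts Y P p act \<C>. \<Phi> (orb_lift_equiv Y P p act \<C> d `` {e}) = mfd_lift_equiv M Q q act' \<C> d `` {hat e})"
  proof (rule quotient_bij_betw)
    show "orb_lift_equiv Y P p act \<C> d \<subseteq> orb_cell_lifts Y P p act \<C> \<times> orb_cell_lifts Y P p act \<C>"
      by (auto simp: orb_lift_equiv_def lift_equiv_def)
    show "equiv (cell_lifts Q q \<C>) (mfd_lift_equiv M Q q act' \<C> d)" by (rule Qc.mfd_lift_equiv_equiv)
    show "hat e \<in> cell_lifts Q q \<C>" if "e \<in> orb_cell_lifts Y P p act \<C>" for e
      using orb(1)[OF that] by (rule hat_lift)
    show "(e, f) \<in> orb_lift_equiv Y P p act \<C> d \<longleftrightarrow> (hat e, hat f) \<in> mfd_lift_equiv M Q q act' \<C> d"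
      if e: "e \<in> orb_cell_lifts Y P p act \<C>" and f: "f \<in> orb_cell_lifts Y P p act \<C>" for e f
    proof -
      note he = hat_lift[OF orb(1)[OF e]] and hf = hat_lift[OF orb(1)[OF f]]
      have sub: "\<C>' \<subseteq> \<C>" by blast
      note t = quotient_transport[OF orb(1)[OF e] orb(1)[OF f] sub]
      have "(e, f) \<in> orb_lift_equiv Y P p act \<C> d \<longleftrightarrow> lift_quotient G act \<C>' d f e = \<one>\<^bsub>G\<^esub>"
        using e f by (simp add: orb_lift_equiv_def lift_equiv_def)
      also have "\<dots> \<longleftrightarrow> \<phi> (lift_quotient G act \<C>' d f e) = \<one>\<^bsub>H\<^esub>"
        using id_iso t(1) phi.inj_on_one_iff by (auto simp: Group.iso_def bij_betw_def)
      also have "\<dots> \<longleftrightarrow> lift_quotient H act' \<C> d (hat f) (hat e) = \<one>\<^bsub>H\<^esub>"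
        unfolding t(2)
        using lift_quotient_singular_cancel[OF he hf curve_condition_ratio[OF _ he _ hf]] orb(2)[OF e] orb(2)[OF f] by simp
      also have "\<dots> \<longleftrightarrow> (hat e, hat f) \<in> mfd_lift_equiv M Q q act' \<C> d" using he hf mem by simp
      finally show ?thesis .
    qed
    show "\<exists>e\<in>orb_cell_lifts Y P p act \<C>. (hat e, b) \<in> mfd_lift_equiv M Q q act' \<C> d" if b: "b \<in> cell_lifts Q q \<C>" for b
    proof -
      obtain f where f: "f \<in> cell_lifts Q q \<C>" "\<forall>i\<in>I. curve_condition i f" "lift_quotient H act' \<C> d f b = \<one>\<^bsub>H\<^esub>"
        using b by (rule curve_condition_representative)
      obtain e where e: "e \<in> cell_lifts P p \<C>" "hat e = f" using f(1) by (rule hat_surj)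
      have "e \<in> orb_cell_lifts Y P p act \<C>"
        using e f(2) boundary_condition_iff[OF e(1)] by (simp add: orb_cell_lifts_def)
      moreover have "(b, f) \<in> mfd_lift_equiv M Q q act' \<C> d" using mem b f by simp
      then have "(f, b) \<in> mfd_lift_equiv M Q q act' \<C> d"
        using Qc.mfd_lift_equiv_equiv by (metis equivE symD)
      ultimately show ?thesis using e(2) by blast
    qed
  qed
  then show ?thesis unfolding Eul_orb_def Eul_def hat_def .
qed

end

end

theorem theorem3p6:
  fixes Y :: "'a orbifold3"
    and P :: "'b topology" and p :: "'b \<Rightarrow> 'a" and act :: "'a chain set set \<Rightarrow> 'b \<Rightarrow> 'b"
    and Q :: "'c topology" and q :: "'c \<Rightarrow> 'a" and act' :: "'a chain set \<Rightarrow> 'c \<Rightarrow> 'c"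
    and \<C> :: "'a set set" and d :: "'a set \<Rightarrow> nat"
  assumes "link_orbifold3 Y"
    and "compact_space (under Y)"
    and "connected_space (under Y)"
    and "toral_boundary (under Y)"
    and "orbifold_cell_decomposition Y \<C> d"
    and "H1_orb_cover Y P p act"
    and "H1_cover (under Y) Q q act'"
    and "H1_orb Y \<cong> homology_group 1 (under Y)"
  shows "(\<exists>F. cover_identification Y P p act Q q act' F) \<and>
    (\<forall>F. cover_identification Y P p act Q q act' F \<longrightarrow>
      (\<exists>\<Phi>. bij_betw \<Phi> (Eul_orb Y P p act \<C> d) (Eul (under Y) Q q act' \<C> d) \<and>
        (\<forall>e\<in>orb_cell_lifts Y P p act \<C>.
          \<Phi> (orb_lift_equiv Y P p act \<C> d `` {e}) =
          mfd_lift_equiv (under Y) Q q act' \<C> d `` {\<lambda>c\<in>\<C>. F ` e c})))"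
proof -
  interpret orbifold_covers Y Q q act' \<C> d P p act
    using assms by unfold_locales
  interpret iso: orbifold_covers_iso Y Q q act' \<C> d P p act
    using phi_iso[OF assms(8)] by unfold_locales
  show ?thesis
    using iso.identification_exists Euler_structures_bijection by blast
qed

end
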